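(* Let $\mathbf{x}$ be a random variable with values in $[0,\infty)$, whose law does not depend on $n$, with mean $m$, finite positive variance $\sigma^2$, and $\mathbb{E}|\mathbf{x}|^4<\infty$. Then with probability one, for $n\gg1$, every eigenvalue $\underline\lambda$ of $\underline L$ satisfies $$|\Re\underline\lambda|\le\sigma\sqrt{2n\log(n)}\,(1+o(1))\quad\text{and}\quad|\Im\underline\lambda|\le\sigma\sqrt n\,(2+o(1)).$$ Moreover, with probability one, for $n\gg1$, every eigenvalue $\lambda\ne0$ of $L$ satisfies $$|\Re\lambda+mn|\le\sigma\sqrt{2n\log(n)}\,(1+o(1))\quad\text{and}\quad|\Im\lambda|\le\sigma\sqrt n\,(2+o(1)).$$
   Context: For each integer $n\ge1$, $X=(X_{ij})_{1\le i,j\le n}$ is the $n\times n$ random matrix whose entries are i.i.d. copies of $\mathbf{x}$; all random variables (for all $n$) are defined on a common probability space. $D$ is the $n\times n$ diagonal matrix with $D_{ii}=\sum_{k=1}^nX_{ik}$, $L=X-D$, and $\underline L=L-\mathbb{E}L$. (So $\mathbb{E}L=mJ-mnI$, with $J$ the all-ones matrix and $I$ the identity matrix, and $0$ is always an eigenvalue of $L$.) The matrices $X$, $D$, $L$, $\underline L$ all depend on $n$. "With probability one, for $n\gg1$, … $o(1)$" means: almost surely the bounds hold for all $n$ large enough, simultaneously for all the eigenvalues considered, with $o(1)$ a quantity tending to $0$ as $n\to\infty$. *)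

theory Defs
  imports "HOL-Probability.Probability" "Jordan_Normal_Form.Char_Poly"
begin

text \<open>
  The random matrices of all sizes are built from one infinite array \<open>X i j\<close> of random variables:
  the matrix of size \<open>n\<close> is the corner \<open>i, j < n\<close>. This fixes the coupling between different
  sizes, on which the almost sure statements depend. Indices start at 0.
\<close>

definition X_mat :: "(nat \<Rightarrow> nat \<Rightarrow> 'a \<Rightarrow> real) \<Rightarrow> nat \<Rightarrow> 'a \<Rightarrow> real mat" where
  "X_mat X n \<omega> = Matrix.mat n n (\<lambda>(i, j). X i j \<omega>)"

definition D_mat :: "(nat \<Rightarrow> nat \<Rightarrow> 'a \<Rightarrow> real) \<Rightarrow> nat \<Rightarrow> 'a \<Rightarrow> real mat" where
  "D_mat X n \<omega> = mat_diag n (\<lambda>i. \<Sum>k<n. X i k \<omega>)"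

definition L_mat :: "(nat \<Rightarrow> nat \<Rightarrow> 'a \<Rightarrow> real) \<Rightarrow> nat \<Rightarrow> 'a \<Rightarrow> real mat" where
  "L_mat X n \<omega> = X_mat X n \<omega> - D_mat X n \<omega>"

definition mat_expectation :: "'a measure \<Rightarrow> nat \<Rightarrow> ('a \<Rightarrow> real mat) \<Rightarrow> real mat" where
  "mat_expectation M n A = Matrix.mat n n (\<lambda>(i, j). \<integral>\<omega>. A \<omega> $$ (i, j) \<partial>M)"

definition L_centered ::
    "'a measure \<Rightarrow> (nat \<Rightarrow> nat \<Rightarrow> 'a \<Rightarrow> real) \<Rightarrow> nat \<Rightarrow> 'a \<Rightarrow> real mat" where
  "L_centered M X n \<omega> = L_mat X n \<omega> - mat_expectation M n (L_mat X n)"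

abbreviation complex_eigenvalue :: "real mat \<Rightarrow> complex \<Rightarrow> bool" where
  "complex_eigenvalue A \<equiv> eigenvalue (map_mat complex_of_real A)"

end

theory Submission
  imports Defs "HOL-Real_Asymp.Real_Asymp"
begin

text \<open>
  Let \<open>Y = X - m\<close> entrywise. The centred matrix is \<open>Y\<close> minus the diagonal matrix of the row sums of \<open>Y\<close>, so
  evaluating the quadratic form at an eigenvector bounds the imaginary part of an eigenvalue by the norm of
  \<open>Y\<close>, and its real part by the norm of \<open>Y\<close> plus the largest row sum. If \<open>L v = \<lambda> v\<close> with \<open>\<lambda> \<noteq> 0\<close>, then
  the projection of \<open>v\<close> orthogonal to the constants is nonzero since \<open>L\<close> kills constants, and there the
  mean of \<open>L\<close> acts as \<open>- m n\<close>.

  For the norm bound \<open>(2 + o(1)) \<sigma> sqrt n\<close>, truncate \<open>Y\<close> at \<open>n powr (7 / 16)\<close>. Almost surely the larger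
  entries lie in different rows and columns and are \<open>o(sqrt n)\<close>, by the fourth moment, so they do not
  contribute. The expected trace of a high power of the Gram matrix of the truncated part is a sum over
  walks in the bipartite graph of rows and columns. Reading a walk step by step, opening an edge has \<open>n\<close>
  choices, closing it essentially one, and all other steps are rare, which gives a factor
  \<open>2 \<sigma> sqrt n\<close> per step. The row sums are controlled by exponential moments of the truncated entries.
\<close>

text \<open>The leading constants are prescribed, so only lower-order terms may be estimated
  crudely. The truncation exponent \<open>a\<close> has to lie strictly between 3/8 and 1/2. Above
  3/8, the chance of two large entries in one row or column is of order
  \<open>N ^ 3 * N powr (- 8 * a)\<close>, summable along powers of 2. Below 1/2, the steps of
  weight \<open>K\<close> stay negligible against \<open>sqrt n\<close> for walks of length of order
  \<open>(ln n)^2\<close>, and the exponential moments of the row sums keep the Gaussian constant.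
  The gap between the two exponents 5/12 and 7/16 absorbs the comparison of different sizes within a
  block.

  A union bound over the rows alone leaves a failure probability of order
  \<open>n powr (- \<eta>)\<close>, which is not summable over \<open>n\<close> for small
  \<open>\<eta>\<close>. Hence sizes are grouped into blocks and Borel-Cantelli is applied once per
  block. Large entries are treated in dyadic blocks for the same reason: a union bound for each
  \<open>n\<close> separately would ask for more than four moments.\<close>

subsection \<open>Walks on the complete bipartite graph\<close>

text \<open>The vertices are the rows and the columns of the matrix; \<open>True\<close> marks a column. An edge is the
  position (row, column) of an entry, and \<open>edge b u w\<close> joins the vertex \<open>(b, u)\<close> to \<open>(\<not> b, w)\<close>.\<close>

definition edge :: "bool \<Rightarrow> nat \<Rightarrow> nat \<Rightarrow> nat \<times> nat" where
  "edge b u w = (if b then (w, u) else (u, w))"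

fun walk_edges :: "bool \<Rightarrow> nat \<Rightarrow> nat list \<Rightarrow> (nat \<times> nat) list" where
  "walk_edges b u [] = []"
| "walk_edges b u (w # ws) = edge b u w # walk_edges (\<not> b) w ws"

definition walks :: "nat \<Rightarrow> nat \<Rightarrow> nat list set" where
  "walks n r = {ws. set ws \<subseteq> {..<n} \<and> length ws = r}"

lemma finite_walks [simp]: "finite (walks n r)"
  unfolding walks_def by (rule finite_lists_length_eq) simp

lemma walks_0 [simp]: "walks n 0 = {[]}"
  by (auto simp: walks_def)

lemma sum_walks_Suc:
  "(\<Sum>ws\<in>walks n (Suc r). f ws) = (\<Sum>w<n. \<Sum>ws\<in>walks n r. f (w # ws))"
proof -
  have "walks n (Suc r) = (\<lambda>(w, ws). w # ws) ` ({..<n} \<times> walks n r)"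
    by (auto simp: walks_def length_Suc_conv image_iff)
  then have "sum f (walks n (Suc r)) = (\<Sum>(w, ws)\<in>{..<n} \<times> walks n r. f (w # ws))"
    by (simp add: sum.reindex inj_on_def case_prod_unfold)
  then show ?thesis
    by (simp add: sum.cartesian_product)
qed

text \<open>\<open>V\<close> is the set of vertices visited so far, and \<open>F\<close> the set of open edges: those which led to a new
  vertex and have been traversed exactly once. A walk that ends with an open edge contributes a product of
  entries with mean zero, hence the weight 0. An edge that opens and closes pays \<open>\<sigma>\<close> twice, its variance;
  every other traversal pays the uniform bound \<open>K\<close>.\<close>

fun walk_weight ::
    "real \<Rightarrow> real \<Rightarrow> bool \<Rightarrow> nat \<Rightarrow> (bool \<times> nat) set \<Rightarrow> (nat \<times> nat) set \<Rightarrow> nat list \<Rightarrow> real" where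
  "walk_weight \<sigma> K b u V F [] = (if F = {} then 1 else 0)"
| "walk_weight \<sigma> K b u V F (w # ws) =
     (if (\<not> b, w) \<notin> V
      then \<sigma> * walk_weight \<sigma> K (\<not> b) w (insert (\<not> b, w) V) (insert (edge b u w) F) ws
      else if edge b u w \<in> F
      then \<sigma> * walk_weight \<sigma> K (\<not> b) w V (F - {edge b u w}) ws
      else K * walk_weight \<sigma> K (\<not> b) w V F ws)"

definition endpoint :: "bool \<Rightarrow> nat \<times> nat \<Rightarrow> nat" where
  "endpoint b e = (if b then snd e else fst e)"

definition deg :: "(nat \<times> nat) set \<Rightarrow> bool \<times> nat \<Rightarrow> nat" where
  "deg F v = card {e \<in> F. endpoint (fst v) e = snd v}"

text \<open>A potential that pays for the choice of the edge to close. At the current vertex it counts the open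
  edges beyond the first; elsewhere beyond the second, because the walk can only come back by closing one
  of them or by a step of weight \<open>K\<close>. Opening an edge leaves it unchanged, closing one out of several
  lowers it, and a step of weight \<open>K\<close> raises it by at most one.\<close>

definition excess :: "(bool \<times> nat) set \<Rightarrow> (nat \<times> nat) set \<Rightarrow> bool \<times> nat \<Rightarrow> nat" where
  "excess V F v = (\<Sum>y\<in>V - {v}. deg F y - 2) + (deg F v - 1)"

text \<open>The invariant of the reading. The inequality \<open>card F \<le> card V\<close> persists
  because an edge is opened only together with a new vertex; once \<open>card V\<close> is bounded
  by \<open>g\<close>, it bounds every degree by \<open>g\<close> as well.\<close>

definition walk_state :: "(bool \<times> nat) set \<Rightarrow> (nat \<times> nat) set \<Rightarrow> bool \<times> nat \<Rightarrow> bool" where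
  "walk_state V F v \<longleftrightarrow> finite V \<and> finite F \<and> v \<in> V \<and> card F \<le> card V \<and>
     (\<forall>e\<in>F. \<forall>b. (b, endpoint b e) \<in> V)"

lemma endpoint_edge [simp]: "endpoint b (edge b u w) = u" "endpoint (\<not> b) (edge b u w) = w"
  by (auto simp: endpoint_def edge_def)

lemma endpoint_edge_cases: "endpoint c (edge b u w) = (if c = b then u else w)"
  by (cases b; cases c) (auto simp: endpoint_def edge_def)

lemma deg_insert:
  assumes "finite F" "edge b u w \<notin> F"
  shows "deg (insert (edge b u w) F) v = deg F v + (if v = (b, u) \<or> v = (\<not> b, w) then 1 else 0)"
proof -
  obtain c y where v: "v = (c, y)" by force
  have "{e \<in> insert (edge b u w) F. endpoint c e = y} =
     (if endpoint c (edge b u w) = y then insert (edge b u w) {e \<in> F. endpoint c e = y}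
      else {e \<in> F. endpoint c e = y})" by auto
  then show ?thesis using assms
    by (cases b; cases c) (auto simp: deg_def v endpoint_edge_cases)
qed

lemma deg_remove:
  assumes "finite F" "edge b u w \<in> F"
  shows "deg F v = deg (F - {edge b u w}) v + (if v = (b, u) \<or> v = (\<not> b, w) then 1 else 0)"
  using deg_insert[of "F - {edge b u w}" b u w v] assms by (simp add: insert_absorb)

lemma deg_outside:
  assumes "walk_state V F v" "y \<notin> V"
  shows "deg F y = 0"
proof -
  have "{e \<in> F. endpoint (fst y) e = snd y} = {}"
    using assms by (auto simp: walk_state_def) (metis prod.collapse)
  then show ?thesis by (simp only: deg_def card.empty)
qed

lemma walk_state_new:
  assumes "walk_state V F (b, u)" "(\<not> b, w) \<notin> V"
  shows "walk_state (insert (\<not> b, w) V) (insert (edge b u w) F) (\<not> b, w)"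
  using assms unfolding walk_state_def
  by (auto simp: endpoint_edge_cases card_insert_if)

lemma walk_state_close:
  assumes "walk_state V F (b, u)" "(\<not> b, w) \<in> V"
  shows "walk_state V (F - {e}) (\<not> b, w)"
  using assms unfolding walk_state_def by (auto intro: order.trans[OF card_Diff1_le])

lemma walk_state_move:
  assumes "walk_state V F (b, u)" "(\<not> b, w) \<in> V"
  shows "walk_state V F (\<not> b, w)"
  using assms unfolding walk_state_def by auto

lemma edge_new_notin:
  assumes "walk_state V F (b, u)" "(\<not> b, w) \<notin> V"
  shows "edge b u w \<notin> F"
  using assms unfolding walk_state_def by (metis endpoint_edge(2))

text \<open>The degree of the vertex left behind grows by one while its allowance rises from one to
  two, and the new vertex has degree exactly one. The truncated subtractions agree even at degree
  zero.\<close>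

lemma excess_new:
  assumes "walk_state V F (b, u)" "(\<not> b, w) \<notin> V"
  shows "excess (insert (\<not> b, w) V) (insert (edge b u w) F) (\<not> b, w) = excess V F (b, u)"
proof -
  have fin: "finite V" "finite F" "(b, u) \<in> V"
    using assms(1) by (auto simp: walk_state_def)
  have d: "deg (insert (edge b u w) F) v = deg F v + (if v = (b, u) \<or> v = (\<not> b, w) then 1 else 0)" for v
    using deg_insert[OF fin(2) edge_new_notin[OF assms]] .
  have 1: "(insert (\<not> b, w) V) - {(\<not> b, w)} = V" using assms(2) by auto
  have 2: "(\<Sum>y\<in>V - {(b, u)}. deg (insert (edge b u w) F) y - 2) = (\<Sum>y\<in>V - {(b, u)}. deg F y - 2)"
    by (rule sum.cong) (use assms(2) d in auto)
  show ?thesis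
    unfolding excess_def 1
    using fin deg_outside[OF assms] by (simp add: sum.remove[of V "(b, u)"] 2) (simp add: d)
qed

lemma excess_split:
  assumes "finite V" "(b, u) \<in> V" "(\<not> b, w) \<in> V"
  shows "excess V F (b, u) = (\<Sum>y\<in>V - {(b, u)} - {(\<not> b, w)}. deg F y - 2) +
      (deg F (\<not> b, w) - 2) + (deg F (b, u) - 1)"
    "excess V F (\<not> b, w) = (\<Sum>y\<in>V - {(b, u)} - {(\<not> b, w)}. deg F y - 2) +
      (deg F (b, u) - 2) + (deg F (\<not> b, w) - 1)"
proof -
  show "excess V F (b, u) = (\<Sum>y\<in>V - {(b, u)} - {(\<not> b, w)}. deg F y - 2) +
      (deg F (\<not> b, w) - 2) + (deg F (b, u) - 1)"
    unfolding excess_def using assms by (subst sum.remove[of _ "(\<not> b, w)"]) auto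
  have "V - {(\<not> b, w)} - {(b, u)} = V - {(b, u)} - {(\<not> b, w)}" by auto
  then show "excess V F (\<not> b, w) = (\<Sum>y\<in>V - {(b, u)} - {(\<not> b, w)}. deg F y - 2) +
      (deg F (b, u) - 2) + (deg F (\<not> b, w) - 1)"
    unfolding excess_def using assms by (subst sum.remove[of _ "(b, u)"]) auto
qed

text \<open>At the vertex reached, degree and allowance both drop by one. At the vertex left, the
  degree drops and the allowance rises, so its term falls whenever there were at least two open
  edges to choose from; the factor \<open>g\<close> thus released pays for the choice.\<close>

lemma excess_close:
  assumes "walk_state V F (b, u)" "edge b u w \<in> F"
  shows "excess V (F - {edge b u w}) (\<not> b, w) + (if deg F (b, u) \<ge> 2 then 1 else 0) \<le> excess V F (b, u)"
    and "deg F (b, u) \<ge> 1"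
proof -
  have fin: "finite V" "finite F" "(b, u) \<in> V" and w: "(\<not> b, w) \<in> V"
    using assms by (auto simp: walk_state_def) (metis endpoint_edge(2))
  have d: "deg F v = deg (F - {edge b u w}) v + (if v = (b, u) \<or> v = (\<not> b, w) then 1 else 0)" for v
    using deg_remove[OF fin(2) assms(2)] .
  have s: "(\<Sum>y\<in>V - {(b, u)} - {(\<not> b, w)}. deg F y - 2) =
        (\<Sum>y\<in>V - {(b, u)} - {(\<not> b, w)}. deg (F - {edge b u w}) y - 2)"
    by (rule sum.cong) (auto simp: d)
  show "deg F (b, u) \<ge> 1" using d[of "(b, u)"] by simp
  show "excess V (F - {edge b u w}) (\<not> b, w) + (if deg F (b, u) \<ge> 2 then 1 else 0) \<le> excess V F (b, u)"
    unfolding excess_split[OF fin(1,3) w] s using d[of "(b, u)"] d[of "(\<not> b, w)"] by auto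
qed

lemma excess_move:
  assumes "walk_state V F (b, u)" "(\<not> b, w) \<in> V"
  shows "excess V F (\<not> b, w) \<le> excess V F (b, u) + 1"
proof -
  have fin: "finite V" "(b, u) \<in> V" using assms by (auto simp: walk_state_def)
  show ?thesis unfolding excess_split[OF fin assms(2)] by auto
qed

text \<open>Induction on the number of remaining steps, with \<open>s\<close> in the role of
  \<open>sqrt n\<close>. Valuing an open edge at \<open>1 / s\<close> balances the two kinds of
  step: the at most \<open>s^2\<close> openings and the one effective closing each contribute
  \<open>\<sigma> * s\<close>. The other steps have at most \<open>g\<close> targets and lose at
  most one more factor \<open>g\<close> to the potential, hence \<open>K * g^2\<close>.\<close>

lemma sum_walk_weight_le:
  fixes \<sigma> K s :: real and g n :: nat
  assumes "0 \<le> \<sigma>" "0 \<le> K" "0 < s" "real n \<le> s\<^sup>2"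
    and "walk_state V F (b, u)" "card V + r \<le> g"
  shows "(\<Sum>ws\<in>walks n r. walk_weight \<sigma> K b u V F ws) \<le>
    (2 * \<sigma> * s + K * real g ^ 2) ^ r * (1 / s) ^ card F * real g ^ excess V F (b, u)"
  using assms(5,6)
proof (induction r arbitrary: b u V F)
  case 0
  then have "card V \<ge> 1" by (auto simp: walk_state_def Suc_le_eq card_gt_0_iff)
  with 0 have "g \<ge> 1" by simp
  then show ?case using assms by auto
next
  case (Suc r)
  let ?B = "2 * \<sigma> * s + K * real g ^ 2"
  let ?P = "?B ^ r * (1 / s) ^ card F * real g ^ excess V F (b, u)"
  let ?d = "deg F (b, u)"
  define G where "G w = (\<Sum>ws\<in>walks n r. walk_weight \<sigma> K b u V F (w # ws))" for w
  have fin: "finite V" "finite F" "(b, u) \<in> V" and cF: "card F \<le> card V"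
    using Suc.prems by (auto simp: walk_state_def)
  have "card V \<ge> 1" using fin by (auto simp: Suc_le_eq card_gt_0_iff)
  with Suc.prems have g1: "g \<ge> 1" by simp
  have B0: "?B \<ge> 0" using assms by simp
  have P0: "?P \<ge> 0" using assms by simp
  have dg: "?d \<le> g"
  proof -
    have "?d \<le> card F" unfolding deg_def by (rule card_mono) (use fin in auto)
    then show ?thesis using cF Suc.prems by linarith
  qed
  \<comment> \<open>The targets of opening steps are \<open>A\<close>, those of closing steps
    \<open>C\<close>, and those of all other steps the elements of \<open>D\<close> outside
    \<open>C\<close>.\<close>
  define A where "A = {w. w < n \<and> (\<not> b, w) \<notin> V}"
  define C where "C = {w. edge b u w \<in> F}"
  define D where "D = {w. (\<not> b, w) \<in> V}"
  have finD: "finite D"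
  proof -
    have "D \<subseteq> snd ` V" by (force simp: D_def)
    then show ?thesis using fin(1) finite_surj by blast
  qed
  have cD: "card D \<le> g"
  proof -
    have "card D = card ((\<lambda>w. (\<not> b, w)) ` D)" by (rule card_image[symmetric]) (auto simp: inj_on_def)
    also have "\<dots> \<le> card V" by (rule card_mono) (use fin in \<open>auto simp: D_def\<close>)
    finally show ?thesis using Suc.prems by simp
  qed
  have inj: "inj (edge b u)" by (auto simp: inj_on_def edge_def split: if_splits)
  have finC: "finite C" unfolding C_def using finite_vimageI[OF fin(2) inj] by (simp add: vimage_def)
  have cC: "card C = ?d"
  proof -
    have "card C = card (edge b u ` C)" by (rule card_image[symmetric]) (meson inj inj_on_subset subset_UNIV)
    also have "edge b u ` C = {e \<in> F. endpoint b e = u}"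
    proof -
      have "e \<in> edge b u ` C" if "e \<in> F" "endpoint b e = u" for e
      proof -
        have "e = edge b u (endpoint (\<not> b) e)" using that by (cases b; cases e) (auto simp: edge_def endpoint_def)
        then show ?thesis using that by (auto simp: C_def)
      qed
      then show ?thesis by (auto simp: C_def)
    qed
    finally show ?thesis by (simp add: deg_def)
  qed
  have GA: "G w \<le> \<sigma> * ?P / s" if "w \<in> A" for w
  proof -
    have nV: "(\<not> b, w) \<notin> V" using that by (simp add: A_def)
    have "G w = \<sigma> * (\<Sum>ws\<in>walks n r. walk_weight \<sigma> K (\<not> b) w (insert (\<not> b, w) V) (insert (edge b u w) F) ws)"
      using nV by (simp add: G_def sum_distrib_left)
    also have "\<dots> \<le> \<sigma> * (?B ^ r * (1 / s) ^ card (insert (edge b u w) F) *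
        real g ^ excess (insert (\<not> b, w) V) (insert (edge b u w) F) (\<not> b, w))"
      using Suc.IH[OF walk_state_new[OF Suc.prems(1) nV]] Suc.prems nV fin assms(1)
      by (intro mult_left_mono) auto
    also have "\<dots> = \<sigma> * ?P / s"
      using excess_new[OF Suc.prems(1) nV] edge_new_notin[OF Suc.prems(1) nV] fin by simp
    finally show ?thesis .
  qed
  \<comment> \<open>There are exactly \<open>?d\<close> closings, so a factor \<open>1 / ?d\<close>
    is needed for each. For \<open>?d \<ge> 2\<close> it comes from the drop of the excess and
    \<open>?d \<le> g\<close>.\<close>
  have GC: "G w \<le> \<sigma> * ?P * s / ?d" if "w \<in> C" for w
  proof -
    have eF: "edge b u w \<in> F" using that by (simp add: C_def)
    then have V: "(\<not> b, w) \<in> V" using Suc.prems(1) unfolding walk_state_def by (metis endpoint_edge(2))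
    note ec = excess_close[OF Suc.prems(1) eF]
    let ?x = "excess V (F - {edge b u w}) (\<not> b, w)"
    have x: "real g ^ ?x \<le> real g ^ excess V F (b, u) / ?d"
    proof (cases "?d \<ge> 2")
      case True
      have "real g ^ ?x * ?d \<le> real g ^ ?x * real g" using dg by (intro mult_left_mono) auto
      also have "\<dots> = real g ^ (?x + 1)" by simp
      also have "\<dots> \<le> real g ^ excess V F (b, u)"
        using ec True g1 by (intro power_increasing) auto
      finally show ?thesis using ec by (simp add: field_simps)
    next
      case False
      then have "?d = 1" using ec by simp
      then show ?thesis using ec g1 by (auto intro!: power_increasing)
    qed
    have cc: "card F = Suc (card (F - {edge b u w}))" using eF fin by (metis card_Suc_Diff1)
    have "G w = \<sigma> * (\<Sum>ws\<in>walks n r. walk_weight \<sigma> K (\<not> b) w V (F - {edge b u w}) ws)"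
      using V eF by (simp add: G_def sum_distrib_left)
    also have "\<dots> \<le> \<sigma> * (?B ^ r * (1 / s) ^ card (F - {edge b u w}) * real g ^ ?x)"
      using Suc.IH[OF walk_state_close[OF Suc.prems(1) V]] Suc.prems assms(1)
      by (intro mult_left_mono) auto
    also have "\<dots> \<le> \<sigma> * (?B ^ r * (1 / s) ^ card (F - {edge b u w}) * (real g ^ excess V F (b, u) / ?d))"
      using x assms B0 by (intro mult_left_mono) auto
    also have "\<dots> = \<sigma> * ?P * s / ?d" using assms(3) by (simp add: cc)
    finally show ?thesis .
  qed
  have GD: "G w \<le> K * ?P * g" if "w \<in> D" "w \<notin> C" for w
  proof -
    have eF: "edge b u w \<notin> F" and V: "(\<not> b, w) \<in> V" using that by (auto simp: C_def D_def)
    have "G w = K * (\<Sum>ws\<in>walks n r. walk_weight \<sigma> K (\<not> b) w V F ws)"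
      using V eF by (simp add: G_def sum_distrib_left)
    also have "\<dots> \<le> K * (?B ^ r * (1 / s) ^ card F * real g ^ excess V F (\<not> b, w))"
      using Suc.IH[OF walk_state_move[OF Suc.prems(1) V]] Suc.prems assms(2)
      by (intro mult_left_mono) auto
    also have "\<dots> \<le> K * (?B ^ r * (1 / s) ^ card F * real g ^ (excess V F (b, u) + 1))"
      using assms B0 g1 excess_move[OF Suc.prems(1) V]
      by (intro mult_left_mono power_increasing) auto
    finally show ?thesis by (simp add: mult_ac)
  qed
  have "(\<Sum>ws\<in>walks n (Suc r). walk_weight \<sigma> K b u V F ws) = (\<Sum>w<n. G w)"
    by (simp add: sum_walks_Suc G_def)
  also have "\<dots> \<le> (\<Sum>w<n. \<sigma> * ?P / s + (if w \<in> C then \<sigma> * ?P * s / ?d else 0) + (if w \<in> D then K * ?P * g else 0))"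
  proof (rule sum_mono)
    fix w assume "w \<in> {..<n}"
    have p: "0 \<le> \<sigma> * ?P / s" "0 \<le> \<sigma> * ?P * s / ?d" "0 \<le> K * ?P * g"
      using P0 assms by (simp_all only: mult_nonneg_nonneg divide_nonneg_nonneg of_nat_0_le_iff less_imp_le)
    consider "w \<in> A" | "w \<in> C" | "w \<in> D" "w \<notin> C" using \<open>w \<in> {..<n}\<close> by (auto simp: A_def D_def)
    then show "G w \<le> \<sigma> * ?P / s + (if w \<in> C then \<sigma> * ?P * s / ?d else 0) + (if w \<in> D then K * ?P * g else 0)"
      by cases (use GA[of w] GC[of w] GD[of w] p in \<open>simp_all split: if_splits\<close>)
  qed
  also have "\<dots> = real n * (\<sigma> * ?P / s) + real (card ({..<n} \<inter> C)) * (\<sigma> * ?P * s / ?d) +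
       real (card ({..<n} \<inter> D)) * (K * ?P * g)"
    by (simp add: sum.distrib sum.If_cases)
  also have "\<dots> \<le> s\<^sup>2 * (\<sigma> * ?P / s) + real (card C) * (\<sigma> * ?P * s / ?d) + real g * (K * ?P * g)"
  proof -
    have "card ({..<n} \<inter> C) \<le> card C" "card ({..<n} \<inter> D) \<le> g"
      using finC finD cD by (auto intro: card_mono order.trans[OF card_mono])
    moreover have p: "0 \<le> \<sigma> * ?P / s" "0 \<le> \<sigma> * ?P * s / ?d" "0 \<le> K * ?P * g"
      using P0 assms by (simp_all only: mult_nonneg_nonneg divide_nonneg_nonneg of_nat_0_le_iff less_imp_le)
    ultimately show ?thesis using assms(4)
      by (intro add_mono mult_right_mono) auto
  qed
  also have "\<dots> \<le> s * \<sigma> * ?P + s * \<sigma> * ?P + K * (real g)\<^sup>2 * ?P"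
  proof -
    have "s\<^sup>2 * (\<sigma> * ?P / s) = s * \<sigma> * ?P" using assms(3) by (simp add: power2_eq_square)
    moreover have "real (card C) * (\<sigma> * ?P * s / ?d) \<le> s * \<sigma> * ?P"
    \<comment> \<open>For \<open>?d = 0\<close> there is no closing, and the quotient is 0 by
      convention.\<close>
    proof (cases "?d = 0")
      case True
      have "0 \<le> s * \<sigma> * ?P" using P0 assms by (simp only: mult_nonneg_nonneg less_imp_le)
      then show ?thesis by (simp add: True del: mult_nonneg_nonneg)
    next
      case False then show ?thesis by (simp add: cC)
    qed
    moreover have "real g * (K * ?P * g) = K * (real g)\<^sup>2 * ?P" by (simp add: power2_eq_square)
    ultimately show ?thesis by (intro add_mono) (simp_all only: order_refl)
  qed
  also have "\<dots> = ?B * ?P" by (simp add: algebra_simps)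
  finally show ?case by (simp add: mult_ac)
qed

subsection \<open>Expectation of the product along a walk\<close>

text \<open>Bounds the absolute value of the moment of order \<open>c\<close> of a centred variable
  with variance at most \<open>\<sigma>^2\<close> and absolute value at most \<open>K\<close>: two
  factors pay the variance, the others \<open>K\<close>.\<close>

definition moment_bound :: "real \<Rightarrow> real \<Rightarrow> nat \<Rightarrow> real" where
  "moment_bound \<sigma> K c = (if c = 0 then 1 else if c = 1 then 0 else \<sigma>\<^sup>2 * K ^ (c - 2))"

text \<open>The bound for the \<open>c\<close> traversals of \<open>e\<close> that are still to come, given the current state: the first
  traversal of an open edge has already paid its \<open>\<sigma>\<close>, and an edge with an unvisited endpoint is untouched.\<close>

definition edge_factor ::
    "real \<Rightarrow> real \<Rightarrow> (bool \<times> nat) set \<Rightarrow> (nat \<times> nat) set \<Rightarrow> nat \<times> nat \<Rightarrow> nat \<Rightarrow> real" where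
  "edge_factor \<sigma> K V F e c =
     (if e \<in> F then (if c = 0 then 0 else \<sigma> * K ^ (c - 1))
      else if \<forall>b. (b, endpoint b e) \<in> V then K ^ c
      else moment_bound \<sigma> K c)"

lemma moment_bound_nonneg: "0 \<le> \<sigma> \<Longrightarrow> 0 \<le> K \<Longrightarrow> 0 \<le> moment_bound \<sigma> K c"
  by (simp add: moment_bound_def)

lemma edge_factor_nonneg: "0 \<le> \<sigma> \<Longrightarrow> 0 \<le> K \<Longrightarrow> 0 \<le> edge_factor \<sigma> K V F e c"
  by (simp add: edge_factor_def moment_bound_nonneg)

lemma moment_bound_le_power:
  assumes "0 \<le> \<sigma>" "\<sigma> \<le> K"
  shows "moment_bound \<sigma> K c \<le> K ^ c"
proof (cases "c \<ge> 2")
  case True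
  have "\<sigma>\<^sup>2 * K ^ (c - 2) \<le> K\<^sup>2 * K ^ (c - 2)"
    using assms by (intro mult_right_mono power_mono) auto
  also have "\<dots> = K ^ c" using True by (metis le_add_diff_inverse power_add)
  finally show ?thesis using True by (simp add: moment_bound_def)
next
  case False
  then have "c = 0 \<or> c = 1" by auto
  then show ?thesis using assms by (auto simp: moment_bound_def)
qed

lemma prod_le_mult_prod:
  fixes f g :: "'b \<Rightarrow> real"
  assumes "finite S" "x \<in> S" "f x \<le> k * g x" "\<And>y. y \<in> S \<Longrightarrow> y \<noteq> x \<Longrightarrow> f y \<le> g y"
    and "\<And>y. y \<in> S \<Longrightarrow> 0 \<le> f y" "\<And>y. y \<in> S \<Longrightarrow> 0 \<le> g y"
  shows "prod f S \<le> k * prod g S"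
proof -
  have "prod f S = f x * prod f (S - {x})" using assms by (simp add: prod.remove)
  also have "\<dots> \<le> (k * g x) * prod g (S - {x})"
    using assms order.trans[OF assms(5)[OF assms(2)] assms(3)]
    by (intro mult_mono prod_mono prod_nonneg) auto
  also have "\<dots> = k * prod g S" using assms by (simp add: prod.remove)
  finally show ?thesis .
qed

text \<open>Each step of the walk is charged to the edge it traverses, whose factor releases exactly
  the weight of that step. The factors of all other edges can only grow, since visiting a vertex
  merely replaces some moment bounds by powers of \<open>K\<close>.\<close>

lemma prod_edge_factor_le_walk_weight:
  assumes "0 \<le> \<sigma>" "\<sigma> \<le> K" "finite S"
    and "walk_state V F (b, u)" "F \<subseteq> S" "set (walk_edges b u ws) \<subseteq> S"
  shows "(\<Prod>e\<in>S. edge_factor \<sigma> K V F e (count_list (walk_edges b u ws) e)) \<le> walk_weight \<sigma> K b u V F ws"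
  using assms(4-)
proof (induction ws arbitrary: b u V F)
  case Nil
  show ?case
  proof (cases "F = {}")
    case True
    have "(\<Prod>e\<in>S. edge_factor \<sigma> K V F e 0) = 1"
      by (rule prod.neutral) (simp add: True edge_factor_def moment_bound_def)
    then show ?thesis using True by simp
  next
    case False
    then obtain e where "e \<in> F" by auto
    then have "(\<Prod>e\<in>S. edge_factor \<sigma> K V F e 0) = 0"
      using Nil assms(3) by (intro prod_zero) (auto simp: edge_factor_def)
    then show ?thesis by simp
  qed
next
  case (Cons w ws)
  have K0: "0 \<le> K" using assms by simp
  let ?e = "edge b u w"
  let ?c = "count_list (walk_edges (\<not> b) w ws)"
  have eS: "?e \<in> S" and S: "set (walk_edges (\<not> b) w ws) \<subseteq> S" using Cons.prems by auto
  have u: "(b, u) \<in> V" using Cons.prems by (simp add: walk_state_def)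
  note nn = edge_factor_nonneg[OF assms(1) K0]
  consider (new) "(\<not> b, w) \<notin> V" | (close) "(\<not> b, w) \<in> V" "?e \<in> F" | (move) "(\<not> b, w) \<in> V" "?e \<notin> F"
    by blast
  then show ?case
  proof cases
    case new
    have e: "?e \<notin> F" by (rule edge_new_notin[OF Cons.prems(1) new])
    have "(\<Prod>e\<in>S. edge_factor \<sigma> K V F e (count_list (walk_edges b u (w # ws)) e)) \<le>
      \<sigma> * (\<Prod>e\<in>S. edge_factor \<sigma> K (insert (\<not> b, w) V) (insert ?e F) e (?c e))"
    proof (rule prod_le_mult_prod[OF assms(3) eS])
      have "\<not> (\<forall>d. (d, endpoint d ?e) \<in> V)" using new by (metis endpoint_edge(2))
      then show "edge_factor \<sigma> K V F ?e (count_list (walk_edges b u (w # ws)) ?e) \<le>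
        \<sigma> * edge_factor \<sigma> K (insert (\<not> b, w) V) (insert ?e F) ?e (?c ?e)"
        using e by (cases "?c ?e") (auto simp: edge_factor_def moment_bound_def power2_eq_square)
    next
      fix e assume "e \<in> S" "e \<noteq> ?e"
      then show "edge_factor \<sigma> K V F e (count_list (walk_edges b u (w # ws)) e) \<le>
        edge_factor \<sigma> K (insert (\<not> b, w) V) (insert ?e F) e (?c e)"
        using moment_bound_le_power[OF assms(1,2)] by (auto simp: edge_factor_def)
    qed (use nn in auto)
    also have "\<dots> \<le> \<sigma> * walk_weight \<sigma> K (\<not> b) w (insert (\<not> b, w) V) (insert ?e F) ws"
      using Cons.IH[OF walk_state_new[OF Cons.prems(1) new]] Cons.prems S eS assms(1)
      by (intro mult_left_mono) auto
    finally show ?thesis using new by simp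
  next
    case close
    have "(\<Prod>e\<in>S. edge_factor \<sigma> K V F e (count_list (walk_edges b u (w # ws)) e)) \<le>
      \<sigma> * (\<Prod>e\<in>S. edge_factor \<sigma> K V (F - {?e}) e (?c e))"
    proof (rule prod_le_mult_prod[OF assms(3) eS])
      have "(d, endpoint d ?e) \<in> V" for d
        using close u by (cases b; cases d) (simp_all add: endpoint_edge_cases)
      then show "edge_factor \<sigma> K V F ?e (count_list (walk_edges b u (w # ws)) ?e) \<le>
        \<sigma> * edge_factor \<sigma> K V (F - {?e}) ?e (?c ?e)"
        using close by (auto simp: edge_factor_def)
    next
      fix e assume "e \<in> S" "e \<noteq> ?e"
      then show "edge_factor \<sigma> K V F e (count_list (walk_edges b u (w # ws)) e) \<le>
        edge_factor \<sigma> K V (F - {?e}) e (?c e)"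
        by (auto simp: edge_factor_def)
    qed (use nn in auto)
    also have "\<dots> \<le> \<sigma> * walk_weight \<sigma> K (\<not> b) w V (F - {?e}) ws"
      using Cons.IH[OF walk_state_close[OF Cons.prems(1) close(1), of ?e]] Cons.prems S assms(1)
      by (intro mult_left_mono) auto
    finally show ?thesis using close by simp
  next
    case move
    have "(\<Prod>e\<in>S. edge_factor \<sigma> K V F e (count_list (walk_edges b u (w # ws)) e)) \<le>
      K * (\<Prod>e\<in>S. edge_factor \<sigma> K V F e (?c e))"
    proof (rule prod_le_mult_prod[OF assms(3) eS])
      have "(d, endpoint d ?e) \<in> V" for d
        using move u by (cases b; cases d) (simp_all add: endpoint_edge_cases)
      then show "edge_factor \<sigma> K V F ?e (count_list (walk_edges b u (w # ws)) ?e) \<le>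
        K * edge_factor \<sigma> K V F ?e (?c ?e)"
        using move by (auto simp: edge_factor_def)
    qed (use nn in auto)
    also have "\<dots> \<le> K * walk_weight \<sigma> K (\<not> b) w V F ws"
      using Cons.IH[OF walk_state_move[OF Cons.prems(1) move(1)]] Cons.prems S K0
      by (intro mult_left_mono) auto
    finally show ?thesis using move by simp
  qed
qed

lemma prod_list_eq_prod_count:
  fixes f :: "'b \<Rightarrow> 'c::comm_monoid_mult"
  assumes "finite S" "set xs \<subseteq> S"
  shows "prod_list (map f xs) = (\<Prod>x\<in>S. f x ^ count_list xs x)"
  using assms(2)
proof (induction xs)
  case (Cons y xs)
  have "(\<Prod>x\<in>S. f x ^ count_list (y # xs) x) = (\<Prod>x\<in>S. (if x = y then f x else 1) * f x ^ count_list xs x)"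
    by (rule prod.cong) auto
  also have "\<dots> = f y * prod_list (map f xs)"
    using Cons assms(1) by (simp add: prod.distrib)
  finally show ?case by simp
qed simp

text \<open>The endpoints of an edge lie on different sides, so the start vertex alone never
  contains both. At the start every edge factor is therefore the plain moment bound.\<close>

lemma prod_moment_bound_le_walk_weight:
  assumes "0 \<le> \<sigma>" "\<sigma> \<le> K" "finite S" "set (walk_edges b u ws) \<subseteq> S"
  shows "(\<Prod>e\<in>S. moment_bound \<sigma> K (count_list (walk_edges b u ws) e)) \<le> walk_weight \<sigma> K b u {(b, u)} {} ws"
proof -
  have nb: "\<not> (\<forall>c. (c, endpoint c e) \<in> {(b, u)})" for e by auto
  have "(\<Prod>e\<in>S. moment_bound \<sigma> K (count_list (walk_edges b u ws) e)) =
      (\<Prod>e\<in>S. edge_factor \<sigma> K {(b, u)} {} e (count_list (walk_edges b u ws) e))"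
    by (simp only: edge_factor_def nb empty_iff if_False)
  also have "\<dots> \<le> walk_weight \<sigma> K b u {(b, u)} {} ws"
    by (rule prod_edge_factor_le_walk_weight) (use assms in \<open>auto simp: walk_state_def\<close>)
  finally show ?thesis .
qed

context prob_space
begin

lemma abs_expectation_power_le_moment_bound:
  fixes T :: "'a \<Rightarrow> real"
  assumes [measurable]: "random_variable borel T"
    and bnd: "\<And>\<omega>. \<omega> \<in> space M \<Longrightarrow> \<bar>T \<omega>\<bar> \<le> K" and "expectation T = 0" "expectation (\<lambda>\<omega>. (T \<omega>)\<^sup>2) \<le> \<sigma>\<^sup>2"
  shows "\<bar>expectation (\<lambda>\<omega>. T \<omega> ^ c)\<bar> \<le> moment_bound \<sigma> K c"
    and "integrable M (\<lambda>\<omega>. T \<omega> ^ c)"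
proof -
  have pb: "\<bar>T \<omega> ^ d\<bar> \<le> K ^ d" if "\<omega> \<in> space M" for \<omega> d
    using bnd[OF that] by (simp add: power_abs power_mono)
  have int: "integrable M (\<lambda>\<omega>. T \<omega> ^ d)" for d
    by (rule integrable_const_bound[where B = "K ^ d"]) (use pb in auto)
  then show "integrable M (\<lambda>\<omega>. T \<omega> ^ c)" .
  obtain \<omega>0 where "\<omega>0 \<in> space M" using not_empty by auto
  then have K: "0 \<le> K" using bnd[of \<omega>0] by simp
  show "\<bar>expectation (\<lambda>\<omega>. T \<omega> ^ c)\<bar> \<le> moment_bound \<sigma> K c"
  proof (cases "c \<ge> 2")
    case True
    have "\<bar>expectation (\<lambda>\<omega>. T \<omega> ^ c)\<bar> \<le> expectation (\<lambda>\<omega>. \<bar>T \<omega> ^ c\<bar>)"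
      using integral_norm_bound[of M "\<lambda>\<omega>. T \<omega> ^ c"] by simp
    also have "\<dots> \<le> expectation (\<lambda>\<omega>. K ^ (c - 2) * (T \<omega>)\<^sup>2)"
    proof (rule integral_mono)
      show "integrable M (\<lambda>\<omega>. \<bar>T \<omega> ^ c\<bar>)" using int by (rule integrable_abs)
      show "integrable M (\<lambda>\<omega>. K ^ (c - 2) * (T \<omega>)\<^sup>2)" using int by simp
      fix \<omega> assume "\<omega> \<in> space M"
      have "T \<omega> ^ c = T \<omega> ^ (c - 2) * (T \<omega>)\<^sup>2" using True by (metis le_add_diff_inverse2 power_add)
      then have "\<bar>T \<omega> ^ c\<bar> = \<bar>T \<omega> ^ (c - 2)\<bar> * (T \<omega>)\<^sup>2" by (simp add: abs_mult)
      also have "\<dots> \<le> K ^ (c - 2) * (T \<omega>)\<^sup>2"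
        using pb[OF \<open>\<omega> \<in> space M\<close>] by (intro mult_right_mono) auto
      finally show "\<bar>T \<omega> ^ c\<bar> \<le> K ^ (c - 2) * (T \<omega>)\<^sup>2" .
    qed
    also have "\<dots> = K ^ (c - 2) * expectation (\<lambda>\<omega>. (T \<omega>)\<^sup>2)" by simp
    also have "\<dots> \<le> K ^ (c - 2) * \<sigma>\<^sup>2" using assms K by (intro mult_left_mono) auto
    finally show ?thesis using True by (simp add: moment_bound_def mult.commute)
  next
    case False
    then have "c = 0 \<or> c = 1" by auto
    then show ?thesis using assms by (auto simp: moment_bound_def prob_space)
  qed
qed

lemma abs_expectation_walk_le:
  fixes T :: "nat \<times> nat \<Rightarrow> 'a \<Rightarrow> real"
  assumes ind: "indep_vars (\<lambda>_. borel) T UNIV"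
    and bnd: "\<And>e \<omega>. \<omega> \<in> space M \<Longrightarrow> \<bar>T e \<omega>\<bar> \<le> K"
    and mean: "\<And>e. expectation (T e) = 0" and var: "\<And>e. expectation (\<lambda>\<omega>. (T e \<omega>)\<^sup>2) \<le> \<sigma>\<^sup>2"
    and "0 \<le> \<sigma>" "\<sigma> \<le> K"
  shows "\<bar>expectation (\<lambda>\<omega>. prod_list (map (\<lambda>e. T e \<omega>) (walk_edges b u ws)))\<bar> \<le>
      walk_weight \<sigma> K b u {(b, u)} {} ws" (is "?A \<le> ?B")
    and "integrable M (\<lambda>\<omega>. prod_list (map (\<lambda>e. T e \<omega>) (walk_edges b u ws)))" (is ?C)
proof -
  let ?S = "set (walk_edges b u ws)" and ?c = "count_list (walk_edges b u ws)"
  have rv: "random_variable borel (T e)" for e using ind unfolding indep_vars_def2 by blast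
  note mom = abs_expectation_power_le_moment_bound[OF rv bnd mean var]
  have ind': "indep_vars (\<lambda>_. borel) (\<lambda>e \<omega>. T e \<omega> ^ ?c e) ?S"
    using indep_vars_compose2[OF indep_vars_subset[OF ind, of ?S], of "\<lambda>e x. x ^ ?c e" "\<lambda>_. borel"] by simp
  have eq: "prod_list (map (\<lambda>e. T e \<omega>) (walk_edges b u ws)) = (\<Prod>e\<in>?S. T e \<omega> ^ ?c e)" for \<omega>
    by (rule prod_list_eq_prod_count) auto
  have "expectation (\<lambda>\<omega>. \<Prod>e\<in>?S. T e \<omega> ^ ?c e) = (\<Prod>e\<in>?S. expectation (\<lambda>\<omega>. T e \<omega> ^ ?c e))"
    by (rule indep_vars_lebesgue_integral[OF _ ind' mom(2)]) auto
  then have "?A = (\<Prod>e\<in>?S. \<bar>expectation (\<lambda>\<omega>. T e \<omega> ^ ?c e)\<bar>)"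
    by (simp add: eq abs_prod)
  also have "\<dots> \<le> (\<Prod>e\<in>?S. moment_bound \<sigma> K (?c e))"
    by (rule prod_mono) (use mom(1) in auto)
  also have "\<dots> \<le> ?B" by (rule prod_moment_bound_le_walk_weight) (use assms in auto)
  finally show "?A \<le> ?B" .
  show ?C unfolding eq by (rule indep_vars_integrable[OF _ ind' mom(2)]) auto
qed

end

subsection \<open>The trace of powers bounds the norm\<close>

text \<open>The entry \<open>(u, z)\<close> of a product of \<open>r\<close> factors alternating
  between \<open>T\<close> and its transpose; the transpose comes first if \<open>b\<close> is
  \<open>True\<close>.\<close>

fun path_sum :: "(nat \<times> nat \<Rightarrow> real) \<Rightarrow> nat \<Rightarrow> bool \<Rightarrow> nat \<Rightarrow> nat \<Rightarrow> nat \<Rightarrow> real" where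
  "path_sum T n b 0 u z = of_bool (u = z)"
| "path_sum T n b (Suc r) u z = (\<Sum>w<n. T (edge b u w) * path_sum T n (\<not> b) r w z)"

text \<open>For even \<open>r\<close> this is the trace of the power \<open>r / 2\<close> of the Gram matrix of \<open>T\<close>.\<close>

definition path_trace :: "(nat \<times> nat \<Rightarrow> real) \<Rightarrow> nat \<Rightarrow> nat \<Rightarrow> real" where
  "path_trace T n r = (\<Sum>u<n. path_sum T n True r u u)"

lemma path_sum_walks:
  "path_sum T n b r u z =
    (\<Sum>ws\<in>walks n r. if last (u # ws) = z then prod_list (map T (walk_edges b u ws)) else 0)"
proof (induction r arbitrary: b u)
  case (Suc r)
  show ?case
    unfolding path_sum.simps sum_walks_Suc Suc.IH sum_distrib_left
    by (intro sum.cong refl) auto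
qed auto

lemma path_sum_append:
  assumes "u < n"
  shows "path_sum T n b (r + s) u z =
    (\<Sum>w<n. path_sum T n b r u w * path_sum T n (if even r then b else \<not> b) s w z)"
  using assms
proof (induction r arbitrary: b u)
  case 0
  then show ?case by simp
next
  case (Suc r)
  have "path_sum T n b (Suc r + s) u z = (\<Sum>y<n. T (edge b u y) *
     (\<Sum>w<n. path_sum T n (\<not> b) r y w * path_sum T n (if even r then \<not> b else b) s w z))"
    using Suc.IH[of _ "\<not> b"] by simp
  also have "\<dots> = (\<Sum>w<n. (\<Sum>y<n. T (edge b u y) * path_sum T n (\<not> b) r y w) *
      path_sum T n (if even r then \<not> b else b) s w z)"
    unfolding sum_distrib_left sum_distrib_right by (subst sum.swap) (simp add: mult_ac)
  finally show ?case by (simp cong: if_cong)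
qed

lemma path_sum_Suc_right:
  assumes "u < n" "z < n"
  shows "path_sum T n b (Suc r) u z = (\<Sum>w<n. path_sum T n b r u w * T (edge (if even r then b else \<not> b) w z))"
  using path_sum_append[OF assms(1), of T b r 1 z] assms(2) by simp

lemma edge_commute: "edge (\<not> b) u w = edge b w u"
  by (simp add: edge_def)

text \<open>Transposing an alternating product reads it backwards. For even \<open>r\<close> it
  begins with the same kind of factor, so the matrix of path sums is symmetric.\<close>

lemma path_sum_reverse:
  assumes "u < n" "z < n"
  shows "path_sum T n b r u z = path_sum T n (if even r then b else \<not> b) r z u"
  using assms
proof (induction r arbitrary: b u)
  case (Suc r)
  define c where "c = (if even r then \<not> b else b)"
  have c: "c = (if even (Suc r) then b else \<not> b)" and c': "(if even r then c else \<not> c) = (\<not> b)"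
    by (auto simp: c_def)
  have IH: "path_sum T n (\<not> b) r w z = path_sum T n c r z w" if "w < n" for w
    using Suc.IH[OF that Suc.prems(2), of "\<not> b"] by (simp only: c_def not_not)
  have "path_sum T n b (Suc r) u z = (\<Sum>w<n. path_sum T n c r z w * T (edge (\<not> b) w u))"
    unfolding path_sum.simps
  proof (rule sum.cong[OF refl])
    fix w assume "w \<in> {..<n}"
    then show "T (edge b u w) * path_sum T n (\<not> b) r w z = path_sum T n c r z w * T (edge (\<not> b) w u)"
      by (simp only: IH lessThan_iff edge_commute mult.commute)
  qed
  also have "\<dots> = path_sum T n c (Suc r) z u"
    by (simp only: path_sum_Suc_right[OF Suc.prems(2,1)] c')
  finally show ?case by (simp only: c)
qed auto

text \<open>The trace of the square of a symmetric matrix is its squared Frobenius norm.\<close>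

lemma sum_path_sum_squares:
  assumes "even r"
  shows "(\<Sum>u<n. \<Sum>z<n. (path_sum T n True r u z)\<^sup>2) = path_trace T n (2 * r)"
proof -
  have "(\<Sum>z<n. (path_sum T n True r u z)\<^sup>2) = path_sum T n True (2 * r) u u" if "u < n" for u
    unfolding mult_2 path_sum_append[OF that]
    by (rule sum.cong) (use assms that path_sum_reverse[of u n _ T True r] in \<open>auto simp: power2_eq_square\<close>)
  then show ?thesis by (simp add: path_trace_def)
qed

lemma (in prob_space) expectation_path_trace_le:
  fixes T :: "nat \<times> nat \<Rightarrow> 'a \<Rightarrow> real"
  assumes ind: "indep_vars (\<lambda>_. borel) T UNIV"
    and bnd: "\<And>e \<omega>. \<omega> \<in> space M \<Longrightarrow> \<bar>T e \<omega>\<bar> \<le> K"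
    and mean: "\<And>e. expectation (T e) = 0" and var: "\<And>e. expectation (\<lambda>\<omega>. (T e \<omega>)\<^sup>2) \<le> \<sigma>\<^sup>2"
    and sK: "0 \<le> \<sigma>" "\<sigma> \<le> K"
  shows "expectation (\<lambda>\<omega>. path_trace (\<lambda>e. T e \<omega>) n r) \<le>
      real n * (2 * \<sigma> * sqrt (real n) + K * real (r + 1) ^ 2) ^ r"
    and "integrable M (\<lambda>\<omega>. path_trace (\<lambda>e. T e \<omega>) n r)"
proof -
  note walk = abs_expectation_walk_le[OF ind bnd mean var sK]
  let ?f = "\<lambda>u ws \<omega>. if last (u # ws) = u then prod_list (map (\<lambda>e. T e \<omega>) (walk_edges True u ws)) else 0"
  have int: "integrable M (?f u ws)" for u ws
    by (cases "last (u # ws) = u") (simp_all add: walk(2) del: last.simps)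
  have ex: "expectation (?f u ws) \<le> walk_weight \<sigma> K True u {(True, u)} {} ws" for u ws
    using walk(1)[of True u ws] by (cases "last (u # ws) = u") (auto simp del: last.simps)
  show "integrable M (\<lambda>\<omega>. path_trace (\<lambda>e. T e \<omega>) n r)"
    unfolding path_trace_def path_sum_walks using int by (intro Bochner_Integration.integrable_sum) auto
  have "expectation (\<lambda>\<omega>. path_trace (\<lambda>e. T e \<omega>) n r) = (\<Sum>u<n. \<Sum>ws\<in>walks n r. expectation (?f u ws))"
    unfolding path_trace_def path_sum_walks
    by (subst Bochner_Integration.integral_sum, (intro Bochner_Integration.integrable_sum int),
        subst Bochner_Integration.integral_sum, rule int, rule refl)
  also have "\<dots> \<le> (\<Sum>u<n. \<Sum>ws\<in>walks n r. walk_weight \<sigma> K True u {(True, u)} {} ws)"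
    by (intro sum_mono ex)
  also have "\<dots> \<le> (\<Sum>u<n. (2 * \<sigma> * sqrt (real n) + K * real (r + 1) ^ 2) ^ r)"
  proof (rule sum_mono)
    fix u assume "u \<in> {..<n}"
    then have "0 < sqrt (real n)" by simp
    \<comment> \<open>The start has one visited vertex, no open edge and excess zero, so
      \<open>g = r + 1\<close> is admissible and both trailing factors are 1.\<close>
    then have "(\<Sum>ws\<in>walks n r. walk_weight \<sigma> K True u {(True, u)} {} ws) \<le>
      (2 * \<sigma> * sqrt (real n) + K * real (r + 1) ^ 2) ^ r * (1 / sqrt (real n)) ^ card ({} :: (nat \<times> nat) set) *
       real (r + 1) ^ excess {(True, u)} {} (True, u)"
      using sK by (intro sum_walk_weight_le) (auto simp: walk_state_def)
    then show "(\<Sum>ws\<in>walks n r. walk_weight \<sigma> K True u {(True, u)} {} ws) \<le>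
        (2 * \<sigma> * sqrt (real n) + K * real (r + 1) ^ 2) ^ r"
      by (simp add: excess_def deg_def)
  qed
  finally show "expectation (\<lambda>\<omega>. path_trace (\<lambda>e. T e \<omega>) n r) \<le>
      real n * (2 * \<sigma> * sqrt (real n) + K * real (r + 1) ^ 2) ^ r" by simp
qed

text \<open>The squared norms of the alternating images of \<open>v\<close> under \<open>T\<close> and its transpose form a log-convex
  sequence, so the first ratio is controlled by the growth of the sequence.\<close>

fun alt_image :: "(nat \<times> nat \<Rightarrow> real) \<Rightarrow> nat \<Rightarrow> (nat \<Rightarrow> real) \<Rightarrow> nat \<Rightarrow> nat \<Rightarrow> real" where
  "alt_image T n v 0 i = v i"
| "alt_image T n v (Suc r) i = (\<Sum>j<n. T (edge (even r) j i) * alt_image T n v r j)"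

lemma alt_image_path_sum:
  assumes "i < n"
  shows "alt_image T n v r i = (\<Sum>u<n. v u * path_sum T n True r u i)"
  using assms
proof (induction r arbitrary: i)
  case 0
  then show ?case by simp
next
  case (Suc r)
  have "alt_image T n v (Suc r) i = (\<Sum>j<n. T (edge (even r) j i) * (\<Sum>u<n. v u * path_sum T n True r u j))"
    using Suc by simp
  also have "\<dots> = (\<Sum>u<n. v u * (\<Sum>j<n. path_sum T n True r u j * T (edge (even r) j i)))"
    unfolding sum_distrib_left by (subst sum.swap) (simp add: mult_ac)
  also have "\<dots> = (\<Sum>u<n. v u * path_sum T n True (Suc r) u i)"
    using Suc.prems by (intro sum.cong refl) (auto simp: path_sum_Suc_right simp del: path_sum.simps)
  finally show ?case .
qed

text \<open>The last factor moves to the other side of the inner product as its transpose.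
  Cauchy-Schwarz then yields the log-convexity.\<close>

lemma alt_image_adjoint:
  "(\<Sum>i<n. (alt_image T n v (Suc r) i)\<^sup>2) = (\<Sum>i<n. alt_image T n v r i * alt_image T n v (Suc (Suc r)) i)"
proof -
  have "edge (even (Suc r)) i j = edge (even r) j i" for i j by (simp add: edge_def)
  then have 2: "alt_image T n v (Suc (Suc r)) j = (\<Sum>i<n. T (edge (even r) j i) * alt_image T n v (Suc r) i)" for j
    by (subst alt_image.simps(2)) (simp only:)
  have 1: "(alt_image T n v (Suc r) i)\<^sup>2 =
      (\<Sum>j<n. T (edge (even r) j i) * alt_image T n v r j) * alt_image T n v (Suc r) i" for i
    by (simp add: power2_eq_square)
  show ?thesis
    unfolding 1 2 sum_distrib_left sum_distrib_right by (subst sum.swap) (simp only: mult_ac)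
qed

text \<open>The ratios of consecutive terms are nondecreasing, so the product of the first
  \<open>r + 1\<close> of them is at least a power of the first ratio. The claim is multiplied out
  because terms may vanish.\<close>

lemma log_convex_power_le:
  fixes a :: "nat \<Rightarrow> real"
  assumes nn: "\<And>r. 0 \<le> a r" and lc: "\<And>r. (a (Suc r))\<^sup>2 \<le> a r * a (Suc (Suc r))"
  shows "a 1 ^ Suc r \<le> a (Suc r) * a 0 ^ r"
proof -
  have step: "a r * a 1 \<le> a (Suc r) * a 0" for r
  proof (induction r)
    case (Suc r)
    show ?case
    proof (cases "a (Suc r) = 0")
      case True
      then show ?thesis using nn by simp
    next
      \<comment> \<open>Log-convexity turns positivity of \<open>a (Suc r)\<close> into positivity
        of \<open>a r\<close>, which can then be cancelled.\<close>
      case False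
      then have "0 < (a (Suc r))\<^sup>2" by simp
      then have "0 < a r * a (Suc (Suc r))" using lc[of r] by linarith
      then have "0 < a r" using nn[of r] by (metis less_eq_real_def mult_zero_left)
      have "a (Suc r) * (a r * a 1) \<le> a (Suc r) * (a (Suc r) * a 0)"
        using Suc nn by (intro mult_left_mono) auto
      also have "\<dots> = (a (Suc r))\<^sup>2 * a 0" by (simp add: power2_eq_square)
      also have "\<dots> \<le> a r * a (Suc (Suc r)) * a 0" using lc nn by (intro mult_right_mono) auto
      finally have "a r * (a (Suc r) * a 1) \<le> a r * (a (Suc (Suc r)) * a 0)" by (simp add: mult_ac)
      then show ?thesis using \<open>0 < a r\<close> by simp
    qed
  qed simp
  show ?thesis
  proof (induction r)
    case (Suc r)
    have "a 1 ^ Suc (Suc r) \<le> a 1 * (a (Suc r) * a 0 ^ r)"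
      using Suc nn by (simp add: mult_left_mono)
    also have "\<dots> = a (Suc r) * a 1 * a 0 ^ r" by simp
    also have "\<dots> \<le> a (Suc (Suc r)) * a 0 * a 0 ^ r" using step nn by (intro mult_right_mono) auto
    finally show ?case by (simp add: mult_ac)
  qed simp
qed

text \<open>The Frobenius norm of the path sums controls the image number \<open>r\<close> of
  \<open>v\<close>, and log-convexity brings this back to the first image. This takes the place of a
  spectral decomposition of the Gram matrix.\<close>

lemma norm_image_le_path_trace:
  assumes "even r" "0 < r" "0 \<le> \<beta>" "path_trace T n (2 * r) \<le> \<beta> ^ (2 * r)"
  shows "(\<Sum>i<n. (\<Sum>j<n. T (i, j) * v j)\<^sup>2) \<le> \<beta>\<^sup>2 * (\<Sum>j<n. (v j)\<^sup>2)"
proof -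
  define a where "a k = (\<Sum>i<n. (alt_image T n v k i)\<^sup>2)" for k
  have nn: "0 \<le> a k" for k by (simp add: a_def sum_nonneg)
  have lc: "(a (Suc k))\<^sup>2 \<le> a k * a (Suc (Suc k))" for k
    unfolding a_def alt_image_adjoint[of T n v k] by (rule Cauchy_Schwarz_ineq_sum)
  obtain k where r: "r = Suc k" using assms(2) by (cases r) auto
  have "a r \<le> (\<Sum>i<n. (\<Sum>u<n. (v u)\<^sup>2) * (\<Sum>u<n. (path_sum T n True r u i)\<^sup>2))"
    unfolding a_def
  proof (rule sum_mono)
    fix i assume "i \<in> {..<n}"
    then show "(alt_image T n v r i)\<^sup>2 \<le> (\<Sum>u<n. (v u)\<^sup>2) * (\<Sum>u<n. (path_sum T n True r u i)\<^sup>2)"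
      using Cauchy_Schwarz_ineq_sum[of v "\<lambda>u. path_sum T n True r u i" "{..<n}"]
      by (simp add: alt_image_path_sum)
  qed
  also have "\<dots> = (\<Sum>u<n. (v u)\<^sup>2) * path_trace T n (2 * r)"
    unfolding sum_path_sum_squares[OF assms(1), symmetric] sum_distrib_left[symmetric]
    by (subst (2) sum.swap) simp
  also have "\<dots> = a 0 * path_trace T n (2 * r)" by (simp add: a_def)
  also have "\<dots> \<le> a 0 * (\<beta>\<^sup>2) ^ r" using assms nn by (intro mult_left_mono) (auto simp: power_mult)
  finally have ar: "a r \<le> a 0 * (\<beta>\<^sup>2) ^ r" .
  have "a 1 ^ r \<le> a r * a 0 ^ k" using log_convex_power_le[of a k, OF nn lc] by (simp add: r)
  also have "\<dots> \<le> a 0 * (\<beta>\<^sup>2) ^ r * a 0 ^ k" using ar nn by (intro mult_right_mono) auto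
  also have "\<dots> = (\<beta>\<^sup>2 * a 0) ^ r" by (simp add: r power_mult_distrib)
  finally have "a 1 \<le> \<beta>\<^sup>2 * a 0" using nn assms(2) by (simp add: power_mono_iff)
  then show ?thesis by (simp add: a_def edge_def)
qed

subsection \<open>Truncation and the norm of the truncated matrix\<close>

definition trunc :: "real \<Rightarrow> real \<Rightarrow> real" where
  "trunc K y = (if \<bar>y\<bar> \<le> K then y else 0)"

lemma trunc_measurable [measurable]: "trunc K \<in> borel_measurable borel"
  unfolding trunc_def[abs_def] by measurable

lemma abs_trunc_le: "0 \<le> K \<Longrightarrow> \<bar>trunc K y\<bar> \<le> K"
  by (simp add: trunc_def)

lemma trunc_tail_le:
  assumes "0 < K"
  shows "\<bar>y - trunc K y\<bar> \<le> y ^ 4 / K ^ 3"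
proof (cases "\<bar>y\<bar> \<le> K")
  case False
  have "\<bar>y\<bar> * K ^ 3 \<le> \<bar>y\<bar> * \<bar>y\<bar> ^ 3" using False assms by (intro mult_left_mono power_mono) auto
  also have "\<dots> = y ^ 4" by (simp add: power_abs[symmetric] power4_eq_xxxx power3_eq_cube abs_mult[symmetric])
  finally show ?thesis using False assms by (simp add: trunc_def field_simps)
qed (use assms in \<open>simp add: trunc_def\<close>)

lemma abs_le_one_plus_power4: "\<bar>y\<bar> \<le> 1 + y ^ 4" for y :: real
proof (cases "\<bar>y\<bar> \<le> 1")
  case False
  then have "\<bar>y\<bar> ^ 1 \<le> \<bar>y\<bar> ^ 4" by (intro power_increasing) auto
  then show ?thesis by simp
qed (use zero_le_even_power'[of y 2] in \<open>simp add: add_increasing2\<close>)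

text \<open>The truncation level must stay below \<open>sqrt n\<close> by more than a power of \<open>ln n\<close>, and above the threshold
  \<open>n powr (5 / 12)\<close> beyond which entries are isolated. The length of the walks must exceed \<open>ln n\<close>.\<close>

definition level :: "nat \<Rightarrow> real" where
  "level n = real n powr (7 / 16)"

definition trace_len :: "nat \<Rightarrow> nat" where
  "trace_len n = 4 * nat \<lceil>(ln (real n))\<^sup>2\<rceil>"

text \<open>The base of the power in \<open>expectation_path_trace_le\<close> for entries bounded by
  \<open>2 * level n\<close>; the factor 2 is the price of recentring after truncation.\<close>

definition norm_bound :: "real \<Rightarrow> nat \<Rightarrow> real" where
  "norm_bound \<sigma> n = 2 * \<sigma> * sqrt (real n) + 2 * level n * real (trace_len n + 1) ^ 2"

lemma (in prob_space) AE_eventuallyI: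
  assumes meas: "\<And>n. Measurable.pred M (P n)"
    and sum: "summable f" and bnd: "\<forall>\<^sub>F n in sequentially. prob {\<omega> \<in> space M. \<not> P n \<omega>} \<le> f n"
  shows "AE \<omega> in M. \<forall>\<^sub>F n in sequentially. P n \<omega>"
proof -
  have "summable (\<lambda>n. prob {\<omega> \<in> space M. \<not> P n \<omega>})"
    by (rule summable_comparison_test_ev[OF _ sum]) (use bnd in eventually_elim, simp)
  then have "AE \<omega> in M. \<forall>\<^sub>F n in sequentially. \<omega> \<in> space M - {\<omega> \<in> space M. \<not> P n \<omega>}"
    using meas by (intro borel_cantelli_AE1) (auto simp: emeasure_eq_measure)
  then show ?thesis by eventually_elim (auto elim: eventually_mono)
qed

section \<open>The centred array and its truncation\<close>

locale iid_array = prob_space M for M :: "'a measure" +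
  fixes Y :: "nat \<times> nat \<Rightarrow> 'a \<Rightarrow> real" and \<sigma> :: real
  assumes indep: "indep_vars (\<lambda>_. borel) Y UNIV"
    and same_distr: "distr M borel (Y e) = distr M borel (Y e')"
    and mean: "expectation (Y e) = 0"
    and second: "expectation (\<lambda>\<omega>. (Y e \<omega>)\<^sup>2) = \<sigma>\<^sup>2"
    and int4: "integrable M (\<lambda>\<omega>. Y e \<omega> ^ 4)"
    and sigma_pos: "0 < \<sigma>"
begin

lemma Y_rv [measurable]: "random_variable borel (Y e)"
  using indep unfolding indep_vars_def2 by blast

definition C4 :: real where "C4 = expectation (\<lambda>\<omega>. Y (0, 0) \<omega> ^ 4)"

lemma C4_nonneg: "0 \<le> C4"
  by (simp add: C4_def)

lemma expectation_same:
  assumes [measurable]: "f \<in> borel_measurable borel"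
  shows "expectation (\<lambda>\<omega>. f (Y e \<omega>)) = (expectation (\<lambda>\<omega>. f (Y e' \<omega>)) :: real)"
proof -
  have "expectation (\<lambda>\<omega>. f (Y e \<omega>)) = integral\<^sup>L (distr M borel (Y e)) f" for e
    by (simp add: integral_distr)
  then show ?thesis using same_distr[of e e'] by metis
qed

lemma fourth: "expectation (\<lambda>\<omega>. Y e \<omega> ^ 4) = C4"
  unfolding C4_def by (rule expectation_same) simp

lemma int1: "integrable M (Y e)" and int2: "integrable M (\<lambda>\<omega>. (Y e \<omega>)\<^sup>2)"
proof -
  show "integrable M (Y e)"
  proof (rule Bochner_Integration.integrable_bound)
    show "integrable M (\<lambda>\<omega>. 1 + Y e \<omega> ^ 4)" using int4 by simp
    show "AE \<omega> in M. norm (Y e \<omega>) \<le> norm (1 + Y e \<omega> ^ 4)"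
      using abs_le_one_plus_power4 by auto
  qed simp
  show "integrable M (\<lambda>\<omega>. (Y e \<omega>)\<^sup>2)"
  proof (rule Bochner_Integration.integrable_bound)
    show "integrable M (\<lambda>\<omega>. 1 + Y e \<omega> ^ 4)" using int4 by simp
    have "y\<^sup>2 \<le> 1 + y ^ 4" for y :: real
    proof -
      have "2 * y\<^sup>2 \<le> y ^ 4 + 1"
        using sum_squares_bound[of "y\<^sup>2" 1] by (simp add: power_mult[symmetric])
      then show ?thesis using zero_le_power2[of y] by linarith
    qed
    then show "AE \<omega> in M. norm ((Y e \<omega>)\<^sup>2) \<le> norm (1 + Y e \<omega> ^ 4)" by auto
  qed simp
qed

text \<open>Truncation shifts the mean slightly. It is subtracted because walks with an unpaired
  edge vanish only for entries of mean exactly zero.\<close>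

definition T :: "real \<Rightarrow> nat \<times> nat \<Rightarrow> 'a \<Rightarrow> real" where
  "T K e \<omega> = trunc K (Y e \<omega>) - expectation (\<lambda>\<omega>. trunc K (Y e \<omega>))"

lemma int_trunc: "0 \<le> K \<Longrightarrow> integrable M (\<lambda>\<omega>. trunc K (Y e \<omega>))"
  by (rule integrable_const_bound[where B = K]) (auto simp: abs_trunc_le)

lemma abs_expectation_trunc_le: "0 \<le> K \<Longrightarrow> \<bar>expectation (\<lambda>\<omega>. trunc K (Y e \<omega>))\<bar> \<le> K"
proof -
  assume K: "0 \<le> K"
  have "\<bar>expectation (\<lambda>\<omega>. trunc K (Y e \<omega>))\<bar> \<le> expectation (\<lambda>\<omega>. \<bar>trunc K (Y e \<omega>)\<bar>)"
    using integral_norm_bound[of M "\<lambda>\<omega>. trunc K (Y e \<omega>)"] by simp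
  also have "\<dots> \<le> expectation (\<lambda>\<omega>. K)"
    using int_trunc[OF K] abs_trunc_le[OF K] by (intro integral_mono) auto
  finally show ?thesis by (simp add: prob_space)
qed

lemma T_rv [measurable]: "random_variable borel (T K e)"
  unfolding T_def[abs_def] by measurable

lemma abs_T_le: "0 \<le> K \<Longrightarrow> \<bar>T K e \<omega>\<bar> \<le> 2 * K"
  using abs_expectation_trunc_le[of K e] abs_trunc_le[of K "Y e \<omega>"] unfolding T_def by linarith

lemma T_mean: "0 \<le> K \<Longrightarrow> expectation (T K e) = 0"
  unfolding T_def[abs_def] by (simp add: int_trunc prob_space)

lemma T_second:
  assumes "0 \<le> K"
  shows "expectation (\<lambda>\<omega>. (T K e \<omega>)\<^sup>2) \<le> \<sigma>\<^sup>2"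
proof -
  let ?t = "\<lambda>\<omega>. trunc K (Y e \<omega>)"
  have i2: "integrable M (\<lambda>\<omega>. (?t \<omega>)\<^sup>2)"
    by (rule integrable_const_bound[where B = "K\<^sup>2"])
       (use abs_trunc_le[OF assms] assms in \<open>auto simp: abs_le_square_iff[symmetric]\<close>)
  have "expectation (\<lambda>\<omega>. (T K e \<omega>)\<^sup>2) = variance ?t" by (simp add: T_def)
  also have "\<dots> = expectation (\<lambda>\<omega>. (?t \<omega>)\<^sup>2) - (expectation ?t)\<^sup>2"
    by (rule variance_eq) (use i2 int_trunc assms in auto)
  also have "\<dots> \<le> expectation (\<lambda>\<omega>. (?t \<omega>)\<^sup>2)" by simp
  also have "\<dots> \<le> expectation (\<lambda>\<omega>. (Y e \<omega>)\<^sup>2)"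
    using i2 int2 by (intro integral_mono) (auto simp: trunc_def)
  finally show ?thesis by (simp add: second)
qed

lemma T_indep: "indep_vars (\<lambda>_. borel) (T K) UNIV"
  using indep_vars_compose2[OF indep, of "\<lambda>e y. trunc K y - expectation (\<lambda>\<omega>. trunc K (Y e \<omega>))" "\<lambda>_. borel"]
  by (simp add: T_def[abs_def])

text \<open>As \<open>Y e\<close> has mean zero, the mean of its truncation is minus the mean of the
  discarded part, which the fourth moment controls.\<close>

lemma expectation_trunc_small:
  assumes "0 < K"
  shows "\<bar>expectation (\<lambda>\<omega>. trunc K (Y e \<omega>))\<bar> \<le> C4 / K ^ 3"
proof -
  have i: "integrable M (\<lambda>\<omega>. Y e \<omega> - trunc K (Y e \<omega>))" using int1 int_trunc assms by simp
  have "expectation (\<lambda>\<omega>. trunc K (Y e \<omega>)) = - expectation (\<lambda>\<omega>. Y e \<omega> - trunc K (Y e \<omega>))"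
    using int1 int_trunc assms by (simp add: mean)
  then have "\<bar>expectation (\<lambda>\<omega>. trunc K (Y e \<omega>))\<bar> \<le> expectation (\<lambda>\<omega>. \<bar>Y e \<omega> - trunc K (Y e \<omega>)\<bar>)"
    using integral_norm_bound[of M "\<lambda>\<omega>. Y e \<omega> - trunc K (Y e \<omega>)"] by simp
  also have "\<dots> \<le> expectation (\<lambda>\<omega>. Y e \<omega> ^ 4 / K ^ 3)"
    using i int4 trunc_tail_le[OF assms] by (intro integral_mono) auto
  finally show ?thesis by (simp add: fourth)
qed

lemma prob_trace_large:
  assumes "0 < \<eta>" "\<sigma> \<le> 2 * level n" "2 \<le> n"
  shows "prob {\<omega> \<in> space M. path_trace (\<lambda>e. T (level n) e \<omega>) n (trace_len n)
      \<ge> ((1 + \<eta>) * norm_bound \<sigma> n) ^ trace_len n} \<le> real n / (1 + \<eta>) ^ trace_len n" (is "prob ?A \<le> _")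
proof -
  let ?p = "trace_len n" and ?B = "norm_bound \<sigma> n"
  let ?f = "\<lambda>\<omega>. path_trace (\<lambda>e. T (level n) e \<omega>) n ?p"
  have L: "0 \<le> level n" by (simp add: level_def)
  note tr = expectation_path_trace_le[OF T_indep abs_T_le[OF L] T_mean[OF L] T_second[OF L] _ assms(2), where n = n and r = ?p]
  have s0: "0 \<le> \<sigma>" using sigma_pos by simp
  have "0 < 2 * \<sigma> * sqrt (real n)" using sigma_pos assms(3) by simp
  then have B: "0 < ?B" using L unfolding norm_bound_def by (intro add_pos_nonneg) auto
  have nn: "0 \<le> ?f \<omega>" for \<omega>
  proof -
    \<comment> \<open>The factor 4 in \<open>trace_len\<close> makes half the length even, so the
      trace is a sum of squares and Markov's inequality applies.\<close>
    have "?p = 2 * (2 * nat \<lceil>(ln (real n))\<^sup>2\<rceil>)" by (simp add: trace_len_def)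
    then have "?f \<omega> = (\<Sum>u<n. \<Sum>z<n. (path_sum (\<lambda>e. T (level n) e \<omega>) n True (2 * nat \<lceil>(ln (real n))\<^sup>2\<rceil>) u z)\<^sup>2)"
      by (simp only: sum_path_sum_squares[OF even_mult_iff[THEN iffD2, OF disjI1, OF even_numeral]])
    then show ?thesis by (simp add: sum_nonneg)
  qed
  have c: "0 < ((1 + \<eta>) * ?B) ^ ?p" using B assms(1) by simp
  have "prob ?A \<le> (1 / ((1 + \<eta>) * ?B) ^ ?p) * expectation ?f"
    using integral_Markov_inequality_measure[OF tr(2)[OF s0], of "{}" "((1 + \<eta>) * ?B) ^ ?p"] nn c by simp
  also have "\<dots> \<le> (1 / ((1 + \<eta>) * ?B) ^ ?p) * (real n * ?B ^ ?p)"
    using tr(1)[OF s0] c by (intro mult_left_mono) (auto simp: norm_bound_def)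
  also have "\<dots> = real n / (1 + \<eta>) ^ ?p" using B by (simp add: power_mult_distrib)
  finally show ?thesis .
qed

lemma path_trace_T_measurable [measurable]:
  "(\<lambda>\<omega>. path_trace (\<lambda>e. T K e \<omega>) n r) \<in> borel_measurable M"
proof -
  have "(\<lambda>\<omega>. path_sum (\<lambda>e. T K e \<omega>) n b r u z) \<in> borel_measurable M" for b u z
    by (induction r arbitrary: b u) auto
  then show ?thesis unfolding path_trace_def by measurable
qed

lemma AE_trace_small:
  assumes "0 < \<eta>"
  shows "AE \<omega> in M. \<forall>\<^sub>F n in sequentially.
    path_trace (\<lambda>e. T (level n) e \<omega>) n (trace_len n) < ((1 + \<eta>) * norm_bound \<sigma> n) ^ trace_len n"
proof (rule AE_eventuallyI)
  show "Measurable.pred M (\<lambda>\<omega>. path_trace (\<lambda>e. T (level n) e \<omega>) n (trace_len n) < ((1 + \<eta>) * norm_bound \<sigma> n) ^ trace_len n)" for n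
    by measurable
  show "summable (\<lambda>n. 1 / real n ^ 2)" using inverse_power_summable[of 2] by (simp add: inverse_eq_divide)
  have 1: "\<forall>\<^sub>F n in sequentially. \<sigma> \<le> 2 * level n"
    unfolding level_def by real_asymp
  define c where "c = ln (1 + \<eta>)"
  have "0 < c" using assms by (simp add: c_def)
  then have 2: "\<forall>\<^sub>F n in sequentially. real n * exp (- (4 * c * (ln (real n))\<^sup>2)) \<le> 1 / real n ^ 2"
    by real_asymp
  show "\<forall>\<^sub>F n in sequentially. prob {\<omega> \<in> space M. \<not> path_trace (\<lambda>e. T (level n) e \<omega>) n (trace_len n)
      < ((1 + \<eta>) * norm_bound \<sigma> n) ^ trace_len n} \<le> 1 / real n ^ 2"
    using 1 2 eventually_ge_at_top[of 2]
  proof eventually_elim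
    case (elim n)
    \<comment> \<open>With a length of order \<open>(ln n)^2\<close>, the power of
      \<open>1 + \<eta>\<close> outgrows every power of \<open>n\<close>, in particular the
      prefactor \<open>n\<close> of the trace bound.\<close>
    have "exp (4 * c * (ln (real n))\<^sup>2) = (1 + \<eta>) powr (4 * (ln (real n))\<^sup>2)"
      using assms by (simp add: powr_def c_def mult_ac)
    also have "\<dots> \<le> (1 + \<eta>) powr (real (trace_len n))"
      using assms by (intro powr_mono) (auto simp: trace_len_def)
    also have "\<dots> = (1 + \<eta>) ^ trace_len n" using assms by (simp add: powr_realpow)
    finally have "real n / (1 + \<eta>) ^ trace_len n \<le> real n / exp (4 * c * (ln (real n))\<^sup>2)"
      using assms by (intro divide_left_mono) auto
    also have "\<dots> = real n * exp (- (4 * c * (ln (real n))\<^sup>2))" by (simp add: exp_minus field_simps)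
    also note elim(2)
    finally show ?case using prob_trace_large[OF assms elim(1,3)] by (simp add: not_less)
  qed
qed

end

subsection \<open>Large entries\<close>

lemma strict_mono_bracket:
  fixes N :: "nat \<Rightarrow> nat"
  assumes "strict_mono N" "N L \<le> n"
  obtains l where "L \<le> l" "N l \<le> n" "n < N (Suc l)"
proof -
  have fin: "finite {l. N l \<le> n}"
    by (rule finite_subset[of _ "{..n}"]) (use seq_suble[OF assms(1)] in \<open>auto intro: order.trans\<close>)
  define l where "l = Max {l. N l \<le> n}"
  have "N l \<le> n" "L \<le> l" using Max_in[OF fin] Max_ge[OF fin] assms(2) by (auto simp: l_def)
  moreover have "n < N (Suc l)" using Max_ge[OF fin, of "Suc l"] by (force simp: l_def not_le[symmetric])
  ultimately show ?thesis using that by blast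
qed

text \<open>Lets Borel-Cantelli run over the blocks only, while the conclusion holds for every
  size.\<close>

lemma eventually_blocks:
  fixes N :: "nat \<Rightarrow> nat"
  assumes "strict_mono N" "\<forall>\<^sub>F l in sequentially. P l"
    and "\<And>l n. P l \<Longrightarrow> N l \<le> n \<Longrightarrow> n < N (Suc l) \<Longrightarrow> Q n"
  shows "\<forall>\<^sub>F n in sequentially. Q n"
proof -
  obtain L where "\<And>l. L \<le> l \<Longrightarrow> P l" using assms(2) by (auto simp: eventually_sequentially)
  then have "Q n" if "N L \<le> n" for n
    using strict_mono_bracket[OF assms(1) that] assms(3) by metis
  then show ?thesis by (auto simp: eventually_sequentially)
qed

lemma sum_powers_below_le:
  fixes z :: real
  assumes "0 \<le> z"
  shows "(\<Sum>l<L. if 4 ^ l < z then 4 ^ l else 0) \<le> 2 * z"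
proof (induction L)
  case (Suc L)
  show ?case
  proof (cases "4 ^ L < z")
    case True
    have "(\<Sum>l<Suc L. if 4 ^ l < z then 4 ^ l else 0) \<le> (\<Sum>l<Suc L. (4::real) ^ l)"
      by (rule sum_mono) auto
    also have "\<dots> = (4 ^ Suc L - 1) / 3" by (simp only: geometric_sum[of "4::real"]) simp
    also have "\<dots> \<le> 2 * 4 ^ L" using zero_le_power[of "4::real" L] by (simp, linarith)
    finally show ?thesis using True by linarith
  next
    case False
    then show ?thesis using Suc by simp
  qed
qed (use assms in simp)

context prob_space
begin

lemma prob_finite_union_le:
  assumes "finite I" "\<And>i. i \<in> I \<Longrightarrow> Measurable.pred M (P i)" "\<And>i. i \<in> I \<Longrightarrow> prob {\<omega> \<in> space M. P i \<omega>} \<le> c"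
  shows "prob {\<omega> \<in> space M. \<exists>i\<in>I. P i \<omega>} \<le> real (card I) * c"
proof -
  have "{\<omega> \<in> space M. \<exists>i\<in>I. P i \<omega>} = (\<Union>i\<in>I. {\<omega> \<in> space M. P i \<omega>})" by auto
  moreover have "(\<lambda>i. {\<omega> \<in> space M. P i \<omega>}) ` I \<subseteq> sets M" using assms(2) by (auto simp: pred_def)
  ultimately have "prob {\<omega> \<in> space M. \<exists>i\<in>I. P i \<omega>} \<le> (\<Sum>i\<in>I. prob {\<omega> \<in> space M. P i \<omega>})"
    using finite_measure_subadditive_finite[OF assms(1), of "\<lambda>i. {\<omega> \<in> space M. P i \<omega>}"] by simp
  also have "\<dots> \<le> (\<Sum>i\<in>I. c)" by (intro sum_mono assms(3))
  finally show ?thesis by simp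
qed

text \<open>The powers of 4 below \<open>Z\<close> sum to at most a multiple of \<open>Z\<close>;
  taking expectations gives the series. The base 4 fits corners of size \<open>2 ^ l\<close>, which
  have \<open>4 ^ l\<close> entries.\<close>

lemma summable_dyadic_tail:
  fixes Z :: "'a \<Rightarrow> real"
  assumes Z: "integrable M Z" and nn: "\<And>\<omega>. 0 \<le> Z \<omega>"
  shows "summable (\<lambda>l. 4 ^ l * prob {\<omega> \<in> space M. 4 ^ l < Z \<omega>})"
proof (rule summableI_nonneg_bounded)
  have [measurable]: "Z \<in> borel_measurable M" using Z by simp
  have ind: "integrable M (\<lambda>\<omega>. 4 ^ l * indicator {\<omega> \<in> space M. 4 ^ l < Z \<omega>} \<omega> :: real)" for l
    by (intro integrable_mult_right integrable_real_indicator) (auto simp: emeasure_eq_measure)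
  fix L
  have "(\<Sum>l<L. 4 ^ l * prob {\<omega> \<in> space M. 4 ^ l < Z \<omega>}) =
      (\<Sum>l<L. expectation (\<lambda>\<omega>. 4 ^ l * indicator {\<omega> \<in> space M. 4 ^ l < Z \<omega>} \<omega>))"
    by (simp add: Collect_conj_eq Int_commute)
  also have "\<dots> = expectation (\<lambda>\<omega>. \<Sum>l<L. 4 ^ l * indicator {\<omega> \<in> space M. 4 ^ l < Z \<omega>} \<omega>)"
    by (rule Bochner_Integration.integral_sum[symmetric]) (rule ind)
  also have "\<dots> \<le> expectation (\<lambda>\<omega>. 2 * Z \<omega>)"
  proof (rule integral_mono)
    show "integrable M (\<lambda>\<omega>. \<Sum>l<L. 4 ^ l * indicator {\<omega> \<in> space M. 4 ^ l < Z \<omega>} \<omega> :: real)"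
      by (rule Bochner_Integration.integrable_sum) (rule ind)
    show "integrable M (\<lambda>\<omega>. 2 * Z \<omega>)" using Z by simp
    fix \<omega> assume "\<omega> \<in> space M"
    then have "(\<Sum>l<L. 4 ^ l * indicator {\<omega> \<in> space M. 4 ^ l < Z \<omega>} \<omega>) = (\<Sum>l<L. if 4 ^ l < Z \<omega> then 4 ^ l else 0 :: real)"
      by (intro sum.cong) auto
    then show "(\<Sum>l<L. 4 ^ l * indicator {\<omega> \<in> space M. 4 ^ l < Z \<omega>} \<omega>) \<le> 2 * Z \<omega>"
      using sum_powers_below_le[OF nn] by simp
  qed
  finally show "(\<Sum>l<L. 4 ^ l * prob {\<omega> \<in> space M. 4 ^ l < Z \<omega>}) \<le> expectation (\<lambda>\<omega>. 2 * Z \<omega>)" .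
qed simp

end

definition aligned :: "(nat \<times> nat) \<Rightarrow> (nat \<times> nat) \<Rightarrow> bool" where
  "aligned e e' \<longleftrightarrow> e \<noteq> e' \<and> (fst e = fst e' \<or> snd e = snd e')"

lemma finite_aligned: "finite {(e, e'). e \<in> {..<N} \<times> {..<N} \<and> e' \<in> {..<N} \<times> {..<N} \<and> aligned e e'}"
  by (rule finite_subset[of _ "({..<N} \<times> {..<N}) \<times> ({..<N} \<times> {..<N})"]) auto

lemma card_aligned_le:
  "card {(e, e'). e \<in> {..<N} \<times> {..<N} \<and> e' \<in> {..<N} \<times> {..<N} \<and> aligned e e'} \<le> 2 * N ^ 3" (is "card ?A \<le> _")
proof -
  let ?I = "{..<N} \<times> {..<N} \<times> {..<N}"
  let ?f = "\<lambda>(i, j, k). ((i, j), (i, k))" and ?g = "\<lambda>(i, j, k). ((j, i), (k, i))"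
  have "?A \<subseteq> ?f ` ?I \<union> ?g ` ?I" by (auto simp: aligned_def image_iff)
  then have "card ?A \<le> card (?f ` ?I \<union> ?g ` ?I)" by (intro card_mono) auto
  also have "\<dots> \<le> card (?f ` ?I) + card (?g ` ?I)" by (rule card_Un_le)
  also have "\<dots> \<le> card ?I + card ?I" by (intro add_mono card_image_le) auto
  also have "\<dots> = 2 * N ^ 3" by (simp add: power3_eq_cube)
  finally show ?thesis .
qed

context iid_array
begin

lemma prob_same:
  assumes "Measurable.pred borel P"
  shows "prob {\<omega> \<in> space M. P (Y e \<omega>)} = prob {\<omega> \<in> space M. P (Y e' \<omega>)}"
proof -
  have "prob {\<omega> \<in> space M. P (Y e \<omega>)} = measure (distr M borel (Y e)) {y. P y}" for e
    using assms by (subst measure_distr) (auto intro!: arg_cong[where f = prob] simp: pred_def)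
  then show ?thesis using same_distr[of e e'] by metis
qed

lemma prob_large_le:
  assumes "0 < t"
  shows "prob {\<omega> \<in> space M. t < \<bar>Y e \<omega>\<bar>} \<le> C4 / t ^ 4"
proof -
  have "prob {\<omega> \<in> space M. t < \<bar>Y e \<omega>\<bar>} \<le> prob {\<omega> \<in> space M. t ^ 4 \<le> Y e \<omega> ^ 4}"
  proof (rule finite_measure_mono)
    have "t ^ 4 \<le> y ^ 4" if "t < \<bar>y\<bar>" for y :: real
    proof -
      have "t ^ 4 \<le> \<bar>y\<bar> ^ 4" using that assms by (intro power_mono) auto
      then show ?thesis by simp
    qed
    then show "{\<omega> \<in> space M. t < \<bar>Y e \<omega>\<bar>} \<subseteq> {\<omega> \<in> space M. t ^ 4 \<le> Y e \<omega> ^ 4}" by auto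
  qed measurable
  also have "\<dots> \<le> C4 / t ^ 4"
    using integral_Markov_inequality_measure[OF int4[of e], of "{}" "t ^ 4"] assms by (simp add: fourth)
  finally show ?thesis .
qed

lemma prob_two_large_le:
  assumes "0 < t" "e \<noteq> e'"
  shows "prob {\<omega> \<in> space M. t < \<bar>Y e \<omega>\<bar> \<and> t < \<bar>Y e' \<omega>\<bar>} \<le> (C4 / t ^ 4)\<^sup>2"
proof -
  let ?A = "\<lambda>e. {\<omega> \<in> space M. t < \<bar>Y e \<omega>\<bar>}"
  have eq: "Y e -` {y. t < \<bar>y\<bar>} \<inter> space M = ?A e" for e by auto
  have "prob (\<Inter>i\<in>{e, e'}. Y i -` {y. t < \<bar>y\<bar>} \<inter> space M) = (\<Prod>i\<in>{e, e'}. prob (Y i -` {y. t < \<bar>y\<bar>} \<inter> space M))"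
    by (rule indep_varsD_finite[OF indep_vars_subset[OF indep]]) auto
  then have "prob (?A e \<inter> ?A e') = prob (?A e) * prob (?A e')"
    using assms(2) by (simp only: eq) simp
  also have "\<dots> \<le> (C4 / t ^ 4) * (C4 / t ^ 4)"
    using C4_nonneg assms(1) by (intro mult_mono prob_large_le) auto
  also have "?A e \<inter> ?A e' = {\<omega> \<in> space M. t < \<bar>Y e \<omega>\<bar> \<and> t < \<bar>Y e' \<omega>\<bar>}" by auto
  finally show ?thesis by (simp only: power2_eq_square)
qed

text \<open>A dyadic corner has of order \<open>4 ^ l\<close> entries, and the fourth power of the
  threshold is \<open>\<eta> ^ 4 * 4 ^ l\<close>. Markov's inequality would only bound each block by
  a constant; integrability of the fourth power makes the series of tails converge.\<close>

lemma AE_entries_small: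
  assumes "0 < \<eta>"
  shows "AE \<omega> in M. \<forall>\<^sub>F n in sequentially. \<forall>i<n. \<forall>j<n. \<bar>Y (i, j) \<omega>\<bar> \<le> \<eta> * sqrt (real n)"
proof -
  let ?I = "\<lambda>l. {..<2 ^ Suc l} \<times> {..<2 ^ Suc l} :: (nat \<times> nat) set"
  let ?P = "\<lambda>l \<omega>. \<not> (\<exists>e\<in>?I l. \<eta> * 2 powr (l / 2) < \<bar>Y e \<omega>\<bar>)"
  let ?Z = "\<lambda>\<omega>. Y (0, 0) \<omega> ^ 4 / \<eta> ^ 4"
  have "AE \<omega> in M. \<forall>\<^sub>F l in sequentially. ?P l \<omega>"
  proof (rule AE_eventuallyI)
    show "summable (\<lambda>l. 4 * (4 ^ l * prob {\<omega> \<in> space M. 4 ^ l < ?Z \<omega>}))"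
      by (intro summable_mult summable_dyadic_tail) (use int4 in auto)
    have "prob {\<omega> \<in> space M. \<not> ?P l \<omega>} \<le> 4 * (4 ^ l * prob {\<omega> \<in> space M. 4 ^ l < ?Z \<omega>})" for l
    proof -
      have p: "(\<eta> * 2 powr (l / 2)) ^ 4 = \<eta> ^ 4 * 4 ^ l"
      proof -
        have "(2 powr (l / 2)) ^ 4 = (2::real) powr (2 * l)" by (simp add: powr_power)
        also have "\<dots> = 2 ^ (2 * l)" using powr_realpow[of 2 "2 * l"] by simp
        finally show ?thesis by (simp add: power_mult_distrib power_mult)
      qed
      have "prob {\<omega> \<in> space M. \<eta> * 2 powr (l / 2) < \<bar>Y e \<omega>\<bar>} \<le> prob {\<omega> \<in> space M. 4 ^ l < ?Z \<omega>}" for e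
      proof -
        have "prob {\<omega> \<in> space M. \<eta> * 2 powr (l / 2) < \<bar>Y e \<omega>\<bar>} = prob {\<omega> \<in> space M. \<eta> * 2 powr (l / 2) < \<bar>Y (0, 0) \<omega>\<bar>}"
          by (rule prob_same) measurable
        also have "\<dots> \<le> prob {\<omega> \<in> space M. 4 ^ l < ?Z \<omega>}"
        proof (rule finite_measure_mono)
          have "4 ^ l < y ^ 4 / \<eta> ^ 4" if "\<eta> * 2 powr (l / 2) < \<bar>y\<bar>" for y :: real
          proof -
            have "(\<eta> * 2 powr (l / 2)) ^ 4 < \<bar>y\<bar> ^ 4" using that assms by (intro power_strict_mono) auto
            then have "\<eta> ^ 4 * 4 ^ l < y ^ 4" by (simp only: p power_even_abs even_numeral)
            then show ?thesis using assms by (simp add: field_simps)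
          qed
          then show "{\<omega> \<in> space M. \<eta> * 2 powr (l / 2) < \<bar>Y (0, 0) \<omega>\<bar>} \<subseteq> {\<omega> \<in> space M. 4 ^ l < ?Z \<omega>}" by auto
        qed measurable
        finally show ?thesis .
      qed
      then have "prob {\<omega> \<in> space M. \<exists>e\<in>?I l. \<eta> * 2 powr (l / 2) < \<bar>Y e \<omega>\<bar>} \<le>
          real (card (?I l)) * prob {\<omega> \<in> space M. 4 ^ l < ?Z \<omega>}"
        by (intro prob_finite_union_le) auto
      also have "real (card (?I l)) = 4 * 4 ^ l"
        by (simp add: power_mult_distrib[symmetric])
      finally show ?thesis by (simp add: mult.assoc)
    qed
    then show "\<forall>\<^sub>F l in sequentially. prob {\<omega> \<in> space M. \<not> ?P l \<omega>} \<le> 4 * (4 ^ l * prob {\<omega> \<in> space M. 4 ^ l < ?Z \<omega>})"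
      by simp
  qed measurable
  then show ?thesis
  proof eventually_elim
    case (elim \<omega>)
    show ?case
    proof (rule eventually_blocks[OF _ elim])
      show "strict_mono (\<lambda>l. 2 ^ l :: nat)" by (rule strict_monoI) simp
      fix l n :: nat assume P: "?P l \<omega>" and n: "2 ^ l \<le> n" "n < 2 ^ Suc l"
      have "2 powr (l / 2) = sqrt (2 ^ l)" by (simp add: powr_half_sqrt[symmetric] powr_realpow[symmetric] powr_powr)
      also have "\<dots> \<le> sqrt (real n)" using n(1) by (metis of_nat_le_iff of_nat_numeral of_nat_power real_sqrt_le_iff)
      finally have "\<eta> * 2 powr (l / 2) \<le> \<eta> * sqrt (real n)" using assms by simp
      then show "\<forall>i<n. \<forall>j<n. \<bar>Y (i, j) \<omega>\<bar> \<le> \<eta> * sqrt (real n)"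
      proof (intro allI impI)
        fix i j assume "i < n" "j < n"
        then have "(i, j) \<in> ?I l" using n(2) by simp
        then have "\<bar>Y (i, j) \<omega>\<bar> \<le> \<eta> * 2 powr (l / 2)" using P not_less by blast
        then show "\<bar>Y (i, j) \<omega>\<bar> \<le> \<eta> * sqrt (real n)" using \<open>\<eta> * 2 powr (l / 2) \<le> \<eta> * sqrt (real n)\<close> by linarith
      qed
    qed
  qed
qed

text \<open>A corner of size \<open>N\<close> has about \<open>N ^ 3\<close> aligned pairs, each having two large entries with probability
  at most of order \<open>N powr (- 8 * 5 / 12)\<close>; this is summable along powers of 2.\<close>

lemma AE_large_not_aligned:
  "AE \<omega> in M. \<forall>\<^sub>F n in sequentially. \<forall>e\<in>{..<n} \<times> {..<n}. \<forall>e'\<in>{..<n} \<times> {..<n}.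
     aligned e e' \<longrightarrow> \<not> (real n powr (5 / 12) < \<bar>Y e \<omega>\<bar> \<and> real n powr (5 / 12) < \<bar>Y e' \<omega>\<bar>)"
proof -
  let ?I = "\<lambda>N. {(e, e'). e \<in> {..<N} \<times> {..<N} \<and> e' \<in> {..<N} \<times> {..<N} \<and> aligned e e'}"
  define c :: real where "c = 2 powr (5 / 12)"
  have c0: "0 < c" by (simp add: c_def)
  let ?P = "\<lambda>l \<omega>. \<not> (\<exists>p\<in>?I (2 ^ Suc l). c ^ l < \<bar>Y (fst p) \<omega>\<bar> \<and> c ^ l < \<bar>Y (snd p) \<omega>\<bar>)"
  \<comment> \<open>The union bound for block \<open>l\<close> is of order
    \<open>(8 / c ^ 8) ^ l\<close>; this is where \<open>5 / 12 > 3 / 8\<close> enters.\<close>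
  have c8: "8 / c ^ 8 < 1"
  proof -
    have "c ^ 8 = 2 powr (10 / 3)" by (simp add: c_def powr_power)
    also have "\<dots> > 2 powr 3" by (rule powr_less_mono) auto
    finally show ?thesis using c0 by (simp add: divide_less_eq)
  qed
  have "AE \<omega> in M. \<forall>\<^sub>F l in sequentially. ?P l \<omega>"
  proof (rule AE_eventuallyI)
    show "Measurable.pred M (?P l)" for l
      using finite_aligned by measurable
    show "summable (\<lambda>l. (16 * C4\<^sup>2) * (8 / c ^ 8) ^ l)"
      by (intro summable_mult summable_geometric) (use c8 in auto)
    have "prob {\<omega> \<in> space M. \<not> ?P l \<omega>} \<le> (16 * C4\<^sup>2) * (8 / c ^ 8) ^ l" for l
    proof -
      let ?N = "2 ^ Suc l :: nat"
      have "prob {\<omega> \<in> space M. \<exists>p\<in>?I ?N. c ^ l < \<bar>Y (fst p) \<omega>\<bar> \<and> c ^ l < \<bar>Y (snd p) \<omega>\<bar>} \<le>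
          real (card (?I ?N)) * (C4 / (c ^ l) ^ 4)\<^sup>2"
        by (intro prob_finite_union_le finite_aligned prob_two_large_le) (use c0 in \<open>auto simp: aligned_def\<close>)
      also have "\<dots> \<le> real (2 * ?N ^ 3) * (C4 / (c ^ l) ^ 4)\<^sup>2"
        by (intro mult_right_mono) (use card_aligned_le[of ?N] of_nat_mono in \<open>blast, simp\<close>)
      also have "\<dots> = (16 * C4\<^sup>2) * (8 / c ^ 8) ^ l"
      proof -
        have "real (?N ^ 3) = 8 * 8 ^ l"
          by (simp add: power_mult_distrib power_mult[symmetric] mult.commute[of l]) (simp add: power_mult)
        moreover have "((c ^ l) ^ 4)\<^sup>2 = (c ^ 8) ^ l"
          by (simp add: power_mult[symmetric] mult.commute)
        ultimately show ?thesis by (simp add: power_divide)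
      qed
      finally show ?thesis by (simp only: not_not)
    qed
    then show "\<forall>\<^sub>F l in sequentially. prob {\<omega> \<in> space M. \<not> ?P l \<omega>} \<le> (16 * C4\<^sup>2) * (8 / c ^ 8) ^ l"
      by simp
  qed
  then show ?thesis
  proof eventually_elim
    case (elim \<omega>)
    show ?case
    proof (rule eventually_blocks[OF _ elim])
      show "strict_mono (\<lambda>l. 2 ^ l :: nat)" by (rule strict_monoI) simp
      fix l n :: nat assume P: "?P l \<omega>" and n: "2 ^ l \<le> n" "n < 2 ^ Suc l"
      have "c ^ l = (2 ^ l) powr (5 / 12)"
        by (simp add: c_def powr_powr powr_realpow[symmetric] mult.commute)
      also have "\<dots> \<le> real n powr (5 / 12)"
        using n(1) by (intro powr_mono2) (auto simp: numeral_power_le_of_nat_cancel_iff)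
      finally have c: "c ^ l \<le> real n powr (5 / 12)" .
      show "\<forall>e\<in>{..<n} \<times> {..<n}. \<forall>e'\<in>{..<n} \<times> {..<n}.
         aligned e e' \<longrightarrow> \<not> (real n powr (5 / 12) < \<bar>Y e \<omega>\<bar> \<and> real n powr (5 / 12) < \<bar>Y e' \<omega>\<bar>)"
      proof (intro ballI impI notI)
        fix e e' assume e: "e \<in> {..<n} \<times> {..<n}" "e' \<in> {..<n} \<times> {..<n}" "aligned e e'"
          and "real n powr (5 / 12) < \<bar>Y e \<omega>\<bar> \<and> real n powr (5 / 12) < \<bar>Y e' \<omega>\<bar>"
        then have "c ^ l < \<bar>Y e \<omega>\<bar> \<and> c ^ l < \<bar>Y e' \<omega>\<bar>" using c by auto
        moreover have "(e, e') \<in> ?I (2 ^ Suc l)" using e n(2) by auto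
        ultimately have "\<exists>p\<in>?I (2 ^ Suc l). c ^ l < \<bar>Y (fst p) \<omega>\<bar> \<and> c ^ l < \<bar>Y (snd p) \<omega>\<bar>"
          by (intro bexI[of _ "(e, e')"]) simp_all
        then show False using P by (rule notE[rotated])
      qed
    qed
  qed
qed

end

subsection \<open>Row sums\<close>

text \<open>At most one term exceeds \<open>K\<close>, so truncation changes at most one
  term.\<close>

lemma sum_tail_le:
  fixes f :: "'b \<Rightarrow> real"
  assumes "finite I" "0 \<le> \<rho>" "\<And>i. i \<in> I \<Longrightarrow> \<bar>f i\<bar> \<le> \<rho>"
    and one: "\<And>i j. i \<in> I \<Longrightarrow> j \<in> I \<Longrightarrow> i \<noteq> j \<Longrightarrow> \<not> (K < \<bar>f i\<bar> \<and> K < \<bar>f j\<bar>)"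
  shows "(\<Sum>i\<in>I. \<bar>f i - trunc K (f i)\<bar>) \<le> \<rho>"
proof (cases "\<exists>i\<in>I. K < \<bar>f i\<bar>")
  case True
  then obtain i where i: "i \<in> I" "K < \<bar>f i\<bar>" by auto
  have "(\<Sum>j\<in>I - {i}. \<bar>f j - trunc K (f j)\<bar>) = 0"
    by (rule sum.neutral) (use one[of _ i] i in \<open>auto simp: trunc_def not_le\<close>)
  then have "(\<Sum>i\<in>I. \<bar>f i - trunc K (f i)\<bar>) = \<bar>f i\<bar>"
    using i assms(1) by (simp add: sum.remove trunc_def)
  then show ?thesis using assms(3) i by simp
next
  case False
  then have "(\<Sum>i\<in>I. \<bar>f i - trunc K (f i)\<bar>) = 0" by (intro sum.neutral) (auto simp: trunc_def)
  then show ?thesis using assms(2) by simp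
qed

lemma exp_le_quadratic: "exp x \<le> 1 + x + x\<^sup>2 / 2 * exp \<bar>x\<bar>" for x :: real
proof -
  obtain t where t: "\<bar>t\<bar> \<le> \<bar>x\<bar>" "exp x = (\<Sum>m<2. x ^ m / fact m) + exp t / fact 2 * x ^ 2"
    using Maclaurin_exp_le[of x 2] by auto
  have "exp t * x\<^sup>2 \<le> exp \<bar>x\<bar> * x\<^sup>2" using t(1) by (intro mult_right_mono) auto
  then show ?thesis using t(2) by (simp add: numeral_2_eq_2 mult.commute)
qed

context iid_array
begin

text \<open>In the second-order Taylor bound the linear term vanishes by centring. The Gaussian
  constant survives up to \<open>exp (2 * \<theta> * K)\<close>, which is close to 1 when
  \<open>\<theta> * K\<close> is small. The sign \<open>s\<close> selects the upper or the lower
  tail.\<close>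

lemma expectation_exp_T_le:
  assumes "0 \<le> K" "\<bar>s\<bar> = 1" "0 \<le> \<theta>"
  shows "expectation (\<lambda>\<omega>. exp (\<theta> * s * T K e \<omega>)) \<le> exp (\<theta>\<^sup>2 * \<sigma>\<^sup>2 * exp (2 * \<theta> * K) / 2)"
    and "integrable M (\<lambda>\<omega>. exp (\<theta> * s * T K e \<omega>))"
proof -
  have s2: "s\<^sup>2 = 1" using assms(2) by (metis power2_abs power_one)
  have b: "\<bar>\<theta> * s * T K e \<omega>\<bar> \<le> 2 * \<theta> * K" for \<omega>
    using mult_left_mono[OF abs_T_le[OF assms(1), of e \<omega>] assms(3)] assms by (simp add: abs_mult mult_ac)
  show int: "integrable M (\<lambda>\<omega>. exp (\<theta> * s * T K e \<omega>))"
    by (rule integrable_const_bound[where B = "exp (2 * \<theta> * K)"]) (use b abs_le_D1 in auto)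
  have iT: "integrable M (T K e)" by (rule integrable_const_bound[where B = "2 * K"]) (use abs_T_le assms in auto)
  have iT2: "integrable M (\<lambda>\<omega>. (T K e \<omega>)\<^sup>2)"
  proof (rule integrable_const_bound[where B = "(2 * K)\<^sup>2"])
    have "(T K e \<omega>)\<^sup>2 \<le> (2 * K)\<^sup>2" for \<omega>
      using power_mono[OF abs_T_le[OF assms(1), of e \<omega>] abs_ge_zero, of 2] by simp
    then show "AE \<omega> in M. norm ((T K e \<omega>)\<^sup>2) \<le> (2 * K)\<^sup>2" by simp
  qed simp
  have "expectation (\<lambda>\<omega>. exp (\<theta> * s * T K e \<omega>)) \<le>
      expectation (\<lambda>\<omega>. 1 + (\<theta> * s) * T K e \<omega> + (\<theta>\<^sup>2 * exp (2 * \<theta> * K) / 2) * (T K e \<omega>)\<^sup>2)"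
  proof (rule integral_mono[OF int])
    show "integrable M (\<lambda>\<omega>. 1 + (\<theta> * s) * T K e \<omega> + (\<theta>\<^sup>2 * exp (2 * \<theta> * K) / 2) * (T K e \<omega>)\<^sup>2)"
      using iT iT2 by simp
    fix \<omega>
    have "(\<theta> * s * T K e \<omega>)\<^sup>2 / 2 * exp \<bar>\<theta> * s * T K e \<omega>\<bar> \<le> (\<theta> * s * T K e \<omega>)\<^sup>2 / 2 * exp (2 * \<theta> * K)"
      using b by (intro mult_left_mono) auto
    then show "exp (\<theta> * s * T K e \<omega>) \<le> 1 + (\<theta> * s) * T K e \<omega> + (\<theta>\<^sup>2 * exp (2 * \<theta> * K) / 2) * (T K e \<omega>)\<^sup>2"
      using exp_le_quadratic[of "\<theta> * s * T K e \<omega>"] by (simp add: power_mult_distrib s2 mult_ac)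
  qed
  also have "\<dots> = 1 + (\<theta>\<^sup>2 * exp (2 * \<theta> * K) / 2) * expectation (\<lambda>\<omega>. (T K e \<omega>)\<^sup>2)"
    using iT iT2 by (simp add: T_mean assms(1) prob_space)
  also have "\<dots> \<le> 1 + (\<theta>\<^sup>2 * exp (2 * \<theta> * K) / 2) * \<sigma>\<^sup>2"
    using T_second[OF assms(1)] by (intro add_left_mono mult_left_mono) auto
  also have "\<dots> \<le> exp ((\<theta>\<^sup>2 * exp (2 * \<theta> * K) / 2) * \<sigma>\<^sup>2)" by (rule exp_ge_add_one_self)
  finally show "expectation (\<lambda>\<omega>. exp (\<theta> * s * T K e \<omega>)) \<le> exp (\<theta>\<^sup>2 * \<sigma>\<^sup>2 * exp (2 * \<theta> * K) / 2)"
    by (simp add: mult_ac)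
qed

lemma bernstein_one_sided:
  assumes "finite I" "0 \<le> K" "\<bar>s\<bar> = 1" "0 < \<theta>" "\<theta>\<^sup>2 * \<sigma>\<^sup>2 * exp (2 * \<theta> * K) / 2 * real (card I) \<le> v"
  shows "prob {\<omega> \<in> space M. t < s * (\<Sum>e\<in>I. T K e \<omega>)} \<le> exp (v - \<theta> * t)"
proof -
  let ?S = "\<lambda>\<omega>. \<Sum>e\<in>I. T K e \<omega>"
  note ex = expectation_exp_T_le[OF assms(2,3) less_imp_le[OF assms(4)]]
  have eq: "exp (\<theta> * (s * ?S \<omega>)) = (\<Prod>e\<in>I. exp (\<theta> * s * T K e \<omega>))" for \<omega>
    using assms(1) by (simp add: exp_sum[symmetric] sum_distrib_left mult_ac)
  have ind: "indep_vars (\<lambda>_. borel) (\<lambda>e \<omega>. exp (\<theta> * s * T K e \<omega>)) I"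
    by (rule indep_vars_compose2[OF indep_vars_subset[OF T_indep]]) auto
  have int: "integrable M (\<lambda>\<omega>. exp (\<theta> * (s * ?S \<omega>)))"
    unfolding eq by (rule indep_vars_integrable[OF assms(1) ind ex(2)])
  have "prob {\<omega> \<in> space M. t < s * ?S \<omega>} \<le> prob {\<omega> \<in> space M. exp (\<theta> * t) \<le> exp (\<theta> * (s * ?S \<omega>))}"
    by (rule finite_measure_mono) (use assms(4) in auto)
  also have "\<dots> \<le> expectation (\<lambda>\<omega>. exp (\<theta> * (s * ?S \<omega>))) / exp (\<theta> * t)"
    by (rule integral_Markov_inequality_measure[OF int, of "{}"]) auto
  also have "expectation (\<lambda>\<omega>. exp (\<theta> * (s * ?S \<omega>))) = (\<Prod>e\<in>I. expectation (\<lambda>\<omega>. exp (\<theta> * s * T K e \<omega>)))"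
    unfolding eq by (rule indep_vars_lebesgue_integral[OF assms(1) ind ex(2)])
  also have "\<dots> \<le> (\<Prod>e\<in>I. exp (\<theta>\<^sup>2 * \<sigma>\<^sup>2 * exp (2 * \<theta> * K) / 2))"
    by (rule prod_mono) (use ex(1) in auto)
  also have "\<dots> = exp (\<theta>\<^sup>2 * \<sigma>\<^sup>2 * exp (2 * \<theta> * K) / 2 * real (card I))"
    by (simp add: exp_of_nat_mult[symmetric] mult.commute)
  also have "\<dots> \<le> exp v" using assms(5) by simp
  finally show ?thesis by (simp add: exp_diff divide_right_mono)
qed

lemma bernstein:
  assumes "finite I" "0 \<le> K" "0 < \<theta>" "\<theta>\<^sup>2 * \<sigma>\<^sup>2 * exp (2 * \<theta> * K) / 2 * real (card I) \<le> v"
  shows "prob {\<omega> \<in> space M. t < \<bar>\<Sum>e\<in>I. T K e \<omega>\<bar>} \<le> 2 * exp (v - \<theta> * t)"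
proof -
  have "{\<omega> \<in> space M. t < \<bar>\<Sum>e\<in>I. T K e \<omega>\<bar>} \<subseteq>
    {\<omega> \<in> space M. t < 1 * (\<Sum>e\<in>I. T K e \<omega>)} \<union> {\<omega> \<in> space M. t < (- 1) * (\<Sum>e\<in>I. T K e \<omega>)}"
    by auto
  then have "prob {\<omega> \<in> space M. t < \<bar>\<Sum>e\<in>I. T K e \<omega>\<bar>} \<le>
    prob ({\<omega> \<in> space M. t < 1 * (\<Sum>e\<in>I. T K e \<omega>)} \<union> {\<omega> \<in> space M. t < (- 1) * (\<Sum>e\<in>I. T K e \<omega>)})"
    by (intro finite_measure_mono) measurable
  also have "\<dots> \<le> prob {\<omega> \<in> space M. t < 1 * (\<Sum>e\<in>I. T K e \<omega>)} + prob {\<omega> \<in> space M. t < (- 1) * (\<Sum>e\<in>I. T K e \<omega>)}"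
    by (rule measure_Un_le) measurable
  also have "\<dots> \<le> exp (v - \<theta> * t) + exp (v - \<theta> * t)"
    by (intro add_mono bernstein_one_sided) (use assms in auto)
  finally show ?thesis by simp
qed

lemma sum_row: "(\<Sum>k\<in>J. T K (i, k) \<omega>) = (\<Sum>e\<in>Pair i ` J. T K e \<omega>)"
  by (simp add: sum.reindex inj_on_def)

definition row_scale :: "nat \<Rightarrow> real" where
  "row_scale n = \<sigma> * sqrt (2 * real n * ln (real n))"

lemma row_scale_sq:
  assumes "1 \<le> n"
  shows "(row_scale n)\<^sup>2 = \<sigma>\<^sup>2 * (2 * real n * ln (real n))"
  using assms by (simp add: row_scale_def power_mult_distrib)

lemma row_scale_mono:
  assumes "1 \<le> a" "a \<le> b"
  shows "row_scale a \<le> row_scale b"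
  unfolding row_scale_def using sigma_pos assms by (intro mult_left_mono real_sqrt_le_mono mult_mono) auto

lemma prob_row_main:
  assumes "0 < \<eta>"
  shows "\<forall>\<^sub>F N in sequentially. \<forall>i. prob {\<omega> \<in> space M. (1 + \<eta>) * row_scale N < \<bar>\<Sum>k<N. T (level N) (i, k) \<omega>\<bar>}
    \<le> 2 * real N powr (- (1 + \<eta>))"
proof -
  \<comment> \<open>The minimiser in \<open>\<theta>\<close> of the Gaussian exponent
    \<open>\<theta>^2 * \<sigma>^2 * N / 2 - \<theta> * t\<close> at
    \<open>t = (1 + \<eta>) * row_scale N\<close>.\<close>
  define l :: "nat \<Rightarrow> real" where "l N = (1 + \<eta>) * row_scale N / (real N * \<sigma>\<^sup>2)" for N
  \<comment> \<open>Since \<open>l N * level N\<close> tends to 0, the exponential tends to 1. One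
    of the two factors \<open>1 + \<eta>\<close> in the exponent is given up to absorb the
    error.\<close>
  have "\<forall>\<^sub>F N in sequentially. 1 \<le> (1 + \<eta>) * (2 - exp (2 * ((1 + \<eta>) * (\<sigma> * sqrt (2 * real N * ln (real N))) / (real N * \<sigma>\<^sup>2)) * (real N powr (7 / 16))))"
    using assms sigma_pos by real_asymp
  then have "\<forall>\<^sub>F N in sequentially. 1 \<le> (1 + \<eta>) * (2 - exp (2 * l N * level N))"
    by (simp add: l_def row_scale_def level_def)
  then show ?thesis using eventually_ge_at_top[of 2]
  proof eventually_elim
    case (elim N)
    have lnN: "0 < ln (real N)" and N: "0 < real N" using elim(2) by auto
    have r: "0 < row_scale N" using lnN N sigma_pos by (simp add: row_scale_def)
    have l: "0 < l N" using r N sigma_pos assms by (simp add: l_def)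
    have lt: "l N * ((1 + \<eta>) * row_scale N) = 2 * (1 + \<eta>)\<^sup>2 * ln (real N)"
    proof -
      have "l N * ((1 + \<eta>) * row_scale N) = (1 + \<eta>)\<^sup>2 * (row_scale N)\<^sup>2 / (real N * \<sigma>\<^sup>2)"
        by (simp add: l_def power2_eq_square)
      then show ?thesis using row_scale_sq[of N] N sigma_pos elim(2) by simp
    qed
    have ll: "(l N)\<^sup>2 * \<sigma>\<^sup>2 * real N = 2 * (1 + \<eta>)\<^sup>2 * ln (real N)"
    proof -
      have "l N * \<sigma>\<^sup>2 * real N = (1 + \<eta>) * row_scale N" using N sigma_pos by (simp add: l_def)
      then have "l N * (l N * \<sigma>\<^sup>2 * real N) = 2 * (1 + \<eta>)\<^sup>2 * ln (real N)" using lt by simp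
      then show ?thesis by (simp add: power2_eq_square mult_ac)
    qed
    show ?case
    proof
      fix i
      let ?v = "(l N)\<^sup>2 * \<sigma>\<^sup>2 * exp (2 * l N * level N) / 2 * real N"
      have "prob {\<omega> \<in> space M. (1 + \<eta>) * row_scale N < \<bar>\<Sum>k<N. T (level N) (i, k) \<omega>\<bar>}
          \<le> 2 * exp (?v - l N * ((1 + \<eta>) * row_scale N))"
        unfolding sum_row by (rule bernstein) (use l in \<open>auto simp: level_def card_image inj_on_def\<close>)
      also have "?v - l N * ((1 + \<eta>) * row_scale N) = - ((1 + \<eta>)\<^sup>2 * ln (real N) * (2 - exp (2 * l N * level N)))"
      proof -
        have "?v = (l N)\<^sup>2 * \<sigma>\<^sup>2 * real N * (exp (2 * l N * level N) / 2)" by simp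
        also have "\<dots> = (1 + \<eta>)\<^sup>2 * ln (real N) * exp (2 * l N * level N)" unfolding ll by simp
        finally have v: "?v = (1 + \<eta>)\<^sup>2 * ln (real N) * exp (2 * l N * level N)" .
        show ?thesis unfolding v lt by (simp add: algebra_simps)
      qed
      also have "\<dots> \<le> - ((1 + \<eta>) * ln (real N))"
      proof -
        have "(1 + \<eta>) * ln (real N) * 1 \<le> (1 + \<eta>) * ln (real N) * ((1 + \<eta>) * (2 - exp (2 * l N * level N)))"
          using elim(1) lnN assms by (intro mult_left_mono) auto
        then show ?thesis by (simp add: power2_eq_square mult_ac)
      qed
      also have "exp (- ((1 + \<eta>) * ln (real N))) = real N powr (- (1 + \<eta>))"
        using N by (simp add: powr_def algebra_simps)
      finally show "prob {\<omega> \<in> space M. (1 + \<eta>) * row_scale N < \<bar>\<Sum>k<N. T (level N) (i, k) \<omega>\<bar>}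
          \<le> 2 * real N powr (- (1 + \<eta>))" by simp
    qed
  qed
qed

text \<open>A sum over a small fraction of \<open>N\<close> columns has small variance, so
  deviations of order \<open>row_scale N\<close> become as rare as desired. The exponent 3 leaves
  \<open>1 / N\<close> after a union over about \<open>N ^ 2\<close> pairs of a row and an end
  point.\<close>

lemma prob_row_increment:
  assumes "0 < \<eta>"
  obtains \<kappa> where "0 < \<kappa>"
    "\<forall>\<^sub>F N in sequentially. \<forall>i J. finite J \<longrightarrow> real (card J) \<le> \<kappa> * real N \<longrightarrow>
      prob {\<omega> \<in> space M. \<eta> * row_scale N < \<bar>\<Sum>k\<in>J. T (level N) (i, k) \<omega>\<bar>} \<le> 2 * real N powr (- 3)"
proof -
  \<comment> \<open>\<open>C\<close> makes the linear term of the exponent equal to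
    \<open>4 * ln N\<close>; then \<open>\<kappa>\<close> keeps the quadratic term below
    \<open>ln N\<close>, leaving \<open>- 3 * ln N\<close>.\<close>
  define C where "C = 4 / (\<eta> * \<sigma> * sqrt 2)"
  have C: "0 < C" using assms sigma_pos by (simp add: C_def)
  define l :: "nat \<Rightarrow> real" where "l N = C * sqrt (ln (real N) / real N)" for N
  define \<kappa> where "\<kappa> = 1 / (C\<^sup>2 * \<sigma>\<^sup>2)"
  have \<kappa>: "0 < \<kappa>" using C sigma_pos by (simp add: \<kappa>_def)
  have "\<forall>\<^sub>F N in sequentially. exp (2 * (C * sqrt (ln (real N) / real N)) * (real N powr (7 / 16))) \<le> 2"
    using C by real_asymp
  then have "\<forall>\<^sub>F N in sequentially. exp (2 * l N * level N) \<le> 2"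
    by (simp add: l_def level_def)
  then have "\<forall>\<^sub>F N in sequentially. \<forall>i J. finite J \<longrightarrow> real (card J) \<le> \<kappa> * real N \<longrightarrow>
      prob {\<omega> \<in> space M. \<eta> * row_scale N < \<bar>\<Sum>k\<in>J. T (level N) (i, k) \<omega>\<bar>} \<le> 2 * real N powr (- 3)"
    using eventually_ge_at_top[of 2]
  proof eventually_elim
    case (elim N)
    have lnN: "0 < ln (real N)" and N: "0 < real N" using elim(2) by auto
    have l: "0 < l N" using C lnN N by (simp add: l_def)
    have lt: "l N * (\<eta> * row_scale N) = 4 * ln (real N)"
    proof -
      have "sqrt (ln (real N) / real N) * sqrt (2 * real N * ln (real N)) = sqrt 2 * sqrt ((ln (real N))\<^sup>2)"
        unfolding real_sqrt_mult[symmetric] using N by (simp add: power2_eq_square)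
      then have "sqrt (ln (real N) / real N) * sqrt (2 * real N * ln (real N)) = sqrt 2 * ln (real N)"
        using lnN by simp
      then have "l N * (\<eta> * row_scale N) = (C * \<eta> * \<sigma> * sqrt 2) * ln (real N)"
        by (simp add: l_def row_scale_def mult_ac)
      also have "C * \<eta> * \<sigma> * sqrt 2 = 4" using assms sigma_pos by (simp add: C_def)
      finally show ?thesis .
    qed
    show ?case
    proof (intro allI impI)
      fix i and J :: "nat set" assume J: "finite J" "real (card J) \<le> \<kappa> * real N"
      have "(l N)\<^sup>2 * \<sigma>\<^sup>2 * exp (2 * l N * level N) / 2 * real (card J) \<le> (l N)\<^sup>2 * \<sigma>\<^sup>2 * 2 / 2 * (\<kappa> * real N)"
        using elim(1) J by (intro mult_mono divide_right_mono) auto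
      also have "\<dots> = ln (real N)"
        using N lnN C sigma_pos by (simp add: l_def power_mult_distrib \<kappa>_def)
      finally have "prob {\<omega> \<in> space M. \<eta> * row_scale N < \<bar>\<Sum>k\<in>J. T (level N) (i, k) \<omega>\<bar>}
          \<le> 2 * exp (ln (real N) - l N * (\<eta> * row_scale N))"
        unfolding sum_row by (intro bernstein) (use l J in \<open>auto simp: level_def card_image inj_on_def\<close>)
      also have "\<dots> = 2 * real N powr (- 3)" unfolding lt using N by (simp add: powr_def)
      finally show "prob {\<omega> \<in> space M. \<eta> * row_scale N < \<bar>\<Sum>k\<in>J. T (level N) (i, k) \<omega>\<bar>} \<le> 2 * real N powr (- 3)" .
    qed
  qed
  with \<kappa> show ?thesis by (rule that)
qed

text \<open>The blocks between consecutive powers \<open>l ^ A\<close> are so short that within a block the increments of the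
  row sums are negligible with a probability that survives a union bound, so no maximal inequality is
  needed; taking \<open>A\<close> large makes the exponent \<open>A * \<eta>\<close> summable over the blocks.\<close>

lemma AE_rows_blocks:
  assumes "0 < \<eta>" "2 \<le> real A * \<eta>" "2 \<le> A"
  shows "AE \<omega> in M. \<forall>\<^sub>F l in sequentially. \<forall>i<Suc l ^ A.
    \<not> (1 + \<eta>) * row_scale (l ^ A) < \<bar>\<Sum>k<l ^ A. T (level (l ^ A)) (i, k) \<omega>\<bar> \<and>
    (\<forall>n<Suc l ^ A. \<not> \<eta> * row_scale (l ^ A) < \<bar>\<Sum>k\<in>{l ^ A..<n}. T (level (l ^ A)) (i, k) \<omega>\<bar>)"
    (is "AE \<omega> in M. \<forall>\<^sub>F l in sequentially. \<forall>i<Suc l ^ A. \<not> ?P l i \<omega> \<and> (\<forall>n<Suc l ^ A. \<not> ?Q l i n \<omega>)")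
proof -
  obtain \<kappa> where \<kappa>: "0 < \<kappa>" and incr: "\<forall>\<^sub>F N in sequentially. \<forall>i J. finite J \<longrightarrow> real (card J) \<le> \<kappa> * real N \<longrightarrow>
      prob {\<omega> \<in> space M. \<eta> * row_scale N < \<bar>\<Sum>k\<in>J. T (level N) (i, k) \<omega>\<bar>} \<le> 2 * real N powr (- 3)"
    using prob_row_increment[OF assms(1)] .
  have A: "0 < A" using assms(3) by simp
  have lim: "filterlim (\<lambda>l. l ^ A :: nat) sequentially sequentially"
    using A by (intro filterlim_subseq) (auto intro!: strict_monoI power_strict_mono)
  have "(\<lambda>l. real (Suc l) / real l) \<longlonglongrightarrow> 1" by real_asymp
  from tendsto_power[OF this, of A] have ratio: "(\<lambda>l. (real (Suc l) / real l) ^ A) \<longlonglongrightarrow> 1" by simp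
  \<comment> \<open>The ends of a block have ratio close to 1: it at most doubles the number of rows
    and adds at most \<open>\<kappa> * N\<close> columns.\<close>
  have r1: "\<forall>\<^sub>F l in sequentially. (real (Suc l) / real l) ^ A < 1 + min 1 \<kappa>"
    using order_tendstoD(2)[OF ratio, of "1 + min 1 \<kappa>"] \<kappa> by simp
  have "AE \<omega> in M. \<forall>\<^sub>F l in sequentially. \<not> (\<exists>i\<in>{..<Suc l ^ A}. ?P l i \<omega>)"
  proof (rule AE_eventuallyI)
    show "summable (\<lambda>l. 4 * (1 / real l ^ 2))"
      using inverse_power_summable[of 2, where 'a = real] by (intro summable_mult) (simp add: inverse_eq_divide)
    show "\<forall>\<^sub>F l in sequentially. prob {\<omega> \<in> space M. \<not> \<not> (\<exists>i\<in>{..<Suc l ^ A}. ?P l i \<omega>)} \<le> 4 * (1 / real l ^ 2)"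
      using filterlim_iff[THEN iffD1, OF lim, rule_format, OF prob_row_main[OF assms(1)]] r1 eventually_ge_at_top[of 1]
    proof eventually_elim
      case (elim l)
      let ?N = "real (l ^ A)"
      have N: "0 < ?N" using elim(3) by simp
      have "real (Suc l ^ A) = (real (Suc l) / real l) ^ A * ?N" using elim(3) by (simp add: power_divide)
      also have "\<dots> \<le> 2 * ?N" using elim(2) by (intro mult_right_mono) auto
      finally have N': "real (Suc l ^ A) \<le> 2 * ?N" .
      have "prob {\<omega> \<in> space M. \<exists>i\<in>{..<Suc l ^ A}. ?P l i \<omega>} \<le> real (card {..<Suc l ^ A}) * (2 * ?N powr (- (1 + \<eta>)))"
        by (intro prob_finite_union_le) (use elim(1) in auto)
      also have "\<dots> \<le> (2 * ?N) * (2 * ?N powr (- (1 + \<eta>)))"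
        using N' by (intro mult_right_mono) auto
      also have "\<dots> = 4 * ?N powr (- \<eta>)"
        using N powr_add[of ?N 1 "- (1 + \<eta>)"] by simp
      also have "?N powr (- \<eta>) = real l powr (- (real A * \<eta>))"
        using elim(3) by (simp add: powr_realpow[symmetric] powr_powr)
      also have "\<dots> \<le> real l powr (- 2)" using elim(3) assms(2) by (intro powr_mono) auto
      also have "\<dots> = 1 / real l ^ 2" using elim(3) by (simp add: powr_minus inverse_eq_divide)
      finally show ?case by simp
    qed
  qed measurable
  moreover have "AE \<omega> in M. \<forall>\<^sub>F l in sequentially. \<not> (\<exists>p\<in>{..<Suc l ^ A} \<times> {..<Suc l ^ A}. ?Q l (fst p) (snd p) \<omega>)"
  proof (rule AE_eventuallyI)
    show "summable (\<lambda>l. 8 * (1 / real l ^ 2))"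
      using inverse_power_summable[of 2, where 'a = real] by (intro summable_mult) (simp add: inverse_eq_divide)
    show "\<forall>\<^sub>F l in sequentially. prob {\<omega> \<in> space M. \<not> \<not> (\<exists>p\<in>{..<Suc l ^ A} \<times> {..<Suc l ^ A}. ?Q l (fst p) (snd p) \<omega>)} \<le> 8 * (1 / real l ^ 2)"
      using filterlim_iff[THEN iffD1, OF lim, rule_format, OF incr] r1 eventually_ge_at_top[of 1]
    proof eventually_elim
      case (elim l)
      let ?N = "real (l ^ A)"
      have N: "0 < ?N" using elim(3) by simp
      have r: "real (Suc l ^ A) = (real (Suc l) / real l) ^ A * ?N" using elim(3) by (simp add: power_divide)
      have N': "real (Suc l ^ A) \<le> 2 * ?N" "real (Suc l ^ A) \<le> (1 + \<kappa>) * ?N"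
        unfolding r using elim(2) by (auto intro!: mult_right_mono)
      have c: "real (card {l ^ A..<n}) \<le> \<kappa> * ?N" if "n < Suc l ^ A" for n
      proof -
        have "real n < real (Suc l ^ A)" using that by (simp only: of_nat_less_iff)
        then show ?thesis using N'(2) \<kappa> N by (cases "l ^ A \<le> n") (simp_all add: of_nat_diff algebra_simps)
      qed
      have "prob {\<omega> \<in> space M. \<exists>p\<in>{..<Suc l ^ A} \<times> {..<Suc l ^ A}. ?Q l (fst p) (snd p) \<omega>} \<le>
          real (card ({..<Suc l ^ A} \<times> {..<Suc l ^ A})) * (2 * ?N powr (- 3))"
        by (intro prob_finite_union_le) (use elim(1) c in auto)
      also have "\<dots> = (real (Suc l ^ A) * real (Suc l ^ A)) * (2 * ?N powr (- 3))" by simp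
      also have "\<dots> \<le> ((2 * ?N) * (2 * ?N)) * (2 * ?N powr (- 3))"
        using N'(1) by (intro mult_right_mono mult_mono) auto
      also have "\<dots> = 8 * (1 / ?N)"
      proof -
        have "?N powr (- 3) = 1 / ?N ^ 3" using N by (simp add: powr_minus inverse_eq_divide)
        then show ?thesis using N by (simp add: power3_eq_cube)
      qed
      also have "\<dots> \<le> 8 * (1 / real l ^ 2)"
        using elim(3) assms(3) by (intro mult_left_mono divide_left_mono) (auto intro: power_increasing)
      finally show ?case by simp
    qed
  qed measurable
  ultimately show ?thesis
  proof eventually_elim
    case (elim \<omega>)
    show ?case using elim(1) elim(2)
    proof eventually_elim
      case (elim l)
      show ?case
      proof (intro allI impI conjI)
        show "\<not> ?P l i \<omega>" if "i < Suc l ^ A" for i using elim(1) that by blast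
        show "\<not> ?Q l i n \<omega>" if "i < Suc l ^ A" "n < Suc l ^ A" for i n
          using elim(2) that by (metis SigmaI fst_conv lessThan_iff snd_conv)
      qed
    qed
  qed
qed

text \<open>Throughout a block the truncation level is frozen at its initial value, so all sizes in
  the block share the same truncated variables. The three \<open>\<eta>\<close> pay for the
  fluctuation at the start of the block, the increment within it, and the truncation error, which is
  one isolated entry plus \<open>n\<close> truncated means.\<close>

lemma AE_rows:
  assumes "0 < \<eta>"
  shows "AE \<omega> in M. \<forall>\<^sub>F n in sequentially. \<forall>i<n. \<bar>\<Sum>k<n. Y (i, k) \<omega>\<bar> \<le> (1 + 3 * \<eta>) * row_scale n"
proof -
  obtain A where A: "2 \<le> real A * \<eta>" "2 \<le> A"
  proof -
    obtain a where "2 / \<eta> \<le> real a" using real_arch_simple by blast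
    then have "2 / \<eta> \<le> real (max 2 a)" by simp
    then have "2 \<le> real (max 2 a) * \<eta>" using assms by (simp add: field_simps)
    then show ?thesis using that[of "max 2 a"] by simp
  qed
  have "(\<lambda>l. real (Suc l) / real l) \<longlonglongrightarrow> 1" by real_asymp
  from tendsto_power[OF this, of A] have ratio: "(\<lambda>l. (real (Suc l) / real l) ^ A) \<longlonglongrightarrow> 1" by simp
  have r1: "\<forall>\<^sub>F l in sequentially. (real (Suc l) / real l) ^ A < 2"
    using order_tendstoD(2)[OF ratio, of 2] by simp
  have a1: "\<forall>\<^sub>F n in sequentially. real n powr (5 / 12) \<le> (real n / 2) powr (7 / 16)" by real_asymp
  define c where "c = C4 + 1"
  have c: "0 < c" "C4 \<le> c" using C4_nonneg by (auto simp: c_def)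
  have a2: "\<forall>\<^sub>F n in sequentially. 1 * sqrt (real n) + real n * (c / ((real n / 2) powr (7 / 16)) ^ 3) \<le>
      \<eta> * (\<sigma> * sqrt (2 * real n * ln (real n)))"
    using assms sigma_pos c(1) by real_asymp
  show ?thesis
    using AE_rows_blocks[OF assms A] AE_entries_small[of 1, simplified] AE_large_not_aligned
  proof eventually_elim
    case (elim \<omega>)
    let ?P = "\<lambda>l. (\<forall>i<Suc l ^ A. \<not> (1 + \<eta>) * row_scale (l ^ A) < \<bar>\<Sum>k<l ^ A. T (level (l ^ A)) (i, k) \<omega>\<bar> \<and>
      (\<forall>n<Suc l ^ A. \<not> \<eta> * row_scale (l ^ A) < \<bar>\<Sum>k\<in>{l ^ A..<n}. T (level (l ^ A)) (i, k) \<omega>\<bar>)) \<and>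
      (real (Suc l) / real l) ^ A < 2 \<and> 1 \<le> l"
    have "\<forall>\<^sub>F l in sequentially. ?P l"
      using elim(1) r1 eventually_ge_at_top[of 1] by eventually_elim simp
    then have "\<forall>\<^sub>F n in sequentially. \<exists>l. ?P l \<and> l ^ A \<le> n \<and> n < Suc l ^ A"
    proof (rule eventually_blocks[rotated])
      show "strict_mono (\<lambda>l. l ^ A :: nat)" using A by (auto intro!: strict_monoI power_strict_mono)
    qed auto
    then show ?case using elim(2,3) a1 a2 eventually_ge_at_top[of 1]
    proof eventually_elim
      case (elim n)
      then obtain l where P: "?P l" and n: "l ^ A \<le> n" "n < Suc l ^ A" by auto
      let ?N = "l ^ A" and ?K = "level (l ^ A)"
      have "real (Suc l ^ A) < 2 * real ?N" using P by (simp add: power_divide divide_less_eq)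
      then have nN: "real n / 2 \<le> real ?N" using n(2) by linarith
      have N1: "1 \<le> ?N" using P by simp
      have K: "(real n / 2) powr (7 / 16) \<le> ?K" unfolding level_def using nN by (intro powr_mono2) auto
      have n0: "0 < (real n / 2) powr (7 / 16)" using elim(6) by simp
      have K0: "0 < ?K" using K n0 by linarith
      have rs: "row_scale ?N \<le> row_scale n"
        using N1 n(1) by (rule row_scale_mono)
      show ?case
      proof (intro allI impI)
        fix i assume i: "i < n"
        have "C4 / ?K ^ 3 \<le> c / ?K ^ 3" using c K0 by (intro divide_right_mono) auto
        also have "\<dots> \<le> c / ((real n / 2) powr (7 / 16)) ^ 3"
          by (rule divide_left_mono[OF power_mono[OF K less_imp_le[OF n0]] less_imp_le[OF c(1)] mult_pos_pos[OF zero_less_power[OF K0] zero_less_power[OF n0]]])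
        finally have e: "C4 / ?K ^ 3 \<le> c / ((real n / 2) powr (7 / 16)) ^ 3" .
        let ?E = "expectation (\<lambda>\<omega>. trunc ?K (Y (0, 0) \<omega>))"
        have Eq: "expectation (\<lambda>\<omega>. trunc ?K (Y e \<omega>)) = ?E" for e by (rule expectation_same) simp
        have Y: "Y e \<omega> = T ?K e \<omega> + (Y e \<omega> - trunc ?K (Y e \<omega>)) + ?E" for e
          unfolding T_def using Eq[of e] by linarith
        have split: "(\<Sum>k<n. Y (i, k) \<omega>) = (\<Sum>k<?N. T ?K (i, k) \<omega>) + (\<Sum>k\<in>{?N..<n}. T ?K (i, k) \<omega>) +
            (\<Sum>k<n. Y (i, k) \<omega> - trunc ?K (Y (i, k) \<omega>)) + real n * ?E"
        proof -
          have "(\<Sum>k<n. T ?K (i, k) \<omega>) = (\<Sum>k<?N. T ?K (i, k) \<omega>) + (\<Sum>k\<in>{?N..<n}. T ?K (i, k) \<omega>)"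
            using n(1) sum.atLeastLessThan_concat[of 0 ?N n "\<lambda>k. T ?K (i, k) \<omega>"] by (simp add: atLeast0LessThan)
          moreover have "(\<Sum>k<n. Y (i, k) \<omega>) = (\<Sum>k<n. T ?K (i, k) \<omega>) + (\<Sum>k<n. Y (i, k) \<omega> - trunc ?K (Y (i, k) \<omega>)) + real n * ?E"
          proof -
            have "(\<Sum>k<n. Y (i, k) \<omega>) = (\<Sum>k<n. T ?K (i, k) \<omega> + (Y (i, k) \<omega> - trunc ?K (Y (i, k) \<omega>)) + ?E)"
              by (intro sum.cong refl Y)
            then show ?thesis by (simp only: sum.distrib sum_constant card_lessThan)
          qed
          ultimately show ?thesis by simp
        qed
        have "\<bar>\<Sum>k<n. Y (i, k) \<omega> - trunc ?K (Y (i, k) \<omega>)\<bar> \<le> (\<Sum>k<n. \<bar>Y (i, k) \<omega> - trunc ?K (Y (i, k) \<omega>)\<bar>)"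
          by (rule sum_abs)
        also have "\<dots> \<le> 1 * sqrt (real n)"
        proof (rule sum_tail_le)
          fix j k assume jk: "j \<in> {..<n}" "k \<in> {..<n}" "j \<noteq> k"
          have "\<not> (real n powr (5 / 12) < \<bar>Y (i, j) \<omega>\<bar> \<and> real n powr (5 / 12) < \<bar>Y (i, k) \<omega>\<bar>)"
            by (rule elim(3)[rule_format, of "(i, j)" "(i, k)"]) (use jk i in \<open>auto simp: aligned_def\<close>)
          then show "\<not> (?K < \<bar>Y (i, j) \<omega>\<bar> \<and> ?K < \<bar>Y (i, k) \<omega>\<bar>)" using elim(4) K by linarith
        qed (use elim(2) i in auto)
        finally have t: "\<bar>\<Sum>k<n. Y (i, k) \<omega> - trunc ?K (Y (i, k) \<omega>)\<bar> \<le> 1 * sqrt (real n)" .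
        have E: "\<bar>real n * ?E\<bar> \<le> real n * (c / ((real n / 2) powr (7 / 16)) ^ 3)"
          unfolding abs_mult abs_of_nat
          by (intro mult_left_mono order.trans[OF expectation_trunc_small[OF K0, of "(0, 0)"] e]) simp
        have i': "i < Suc l ^ A" using i n(2) by simp
        have b: "\<bar>\<Sum>k<?N. T ?K (i, k) \<omega>\<bar> \<le> (1 + \<eta>) * row_scale ?N" "\<bar>\<Sum>k\<in>{?N..<n}. T ?K (i, k) \<omega>\<bar> \<le> \<eta> * row_scale ?N"
          using P i' n(2) by (auto simp: not_less)
        have d: "(1 + \<eta>) * row_scale ?N \<le> (1 + \<eta>) * row_scale n" "\<eta> * row_scale ?N \<le> \<eta> * row_scale n"
          using rs assms by (auto intro: mult_left_mono)
        have "1 * sqrt (real n) + real n * (c / ((real n / 2) powr (7 / 16)) ^ 3) \<le> \<eta> * row_scale n"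
          using elim(5) by (simp only: row_scale_def)
        then have "\<bar>\<Sum>k<n. Y (i, k) \<omega>\<bar> \<le> (1 + \<eta>) * row_scale n + \<eta> * row_scale n + \<eta> * row_scale n"
          unfolding split using t E b d by linarith
        then show "\<bar>\<Sum>k<n. Y (i, k) \<omega>\<bar> \<le> (1 + 3 * \<eta>) * row_scale n" by (simp add: algebra_simps)
      qed
    qed
  qed
qed

end

subsection \<open>From quadratic forms to eigenvalues\<close>

text \<open>Cauchy-Schwarz, then the inequality of the means. A sum of squares on the right, rather
  than a product of norms, lets the bounds be added over the parts of the matrix and over real and
  imaginary parts.\<close>

lemma bilinear_norm_bound:
  fixes a b :: "nat \<Rightarrow> real"
  assumes "0 \<le> \<beta>" "\<And>v. (\<Sum>i<n. (\<Sum>j<n. t (i, j) * v j)\<^sup>2) \<le> \<beta>\<^sup>2 * (\<Sum>j<n. (v j)\<^sup>2)"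
  shows "\<bar>\<Sum>i<n. \<Sum>j<n. a i * t (i, j) * b j\<bar> \<le> \<beta> / 2 * ((\<Sum>i<n. (a i)\<^sup>2) + (\<Sum>i<n. (b i)\<^sup>2))"
proof -
  let ?A = "\<Sum>i<n. (a i)\<^sup>2" and ?B = "\<Sum>i<n. (b i)\<^sup>2" and ?S = "\<Sum>i<n. a i * (\<Sum>j<n. t (i, j) * b j)"
  have A: "0 \<le> ?A" and B: "0 \<le> ?B" by (simp_all add: sum_nonneg)
  have "?S\<^sup>2 \<le> ?A * (\<Sum>i<n. (\<Sum>j<n. t (i, j) * b j)\<^sup>2)" by (rule Cauchy_Schwarz_ineq_sum)
  also have "\<dots> \<le> ?A * (\<beta>\<^sup>2 * ?B)" using assms(2) A by (intro mult_left_mono) auto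
  also have "\<dots> = \<beta>\<^sup>2 * (?A * ?B)" by simp
  also have "\<dots> \<le> \<beta>\<^sup>2 * ((?A + ?B) / 2)\<^sup>2"
    using sum_squares_bound[of ?A ?B] by (intro mult_left_mono) (simp_all add: power2_eq_square field_simps)
  also have "\<dots> = (\<beta> / 2 * (?A + ?B))\<^sup>2" by (simp add: power_mult_distrib power_divide)
  finally have "\<bar>?S\<bar> \<le> \<bar>\<beta> / 2 * (?A + ?B)\<bar>" by (simp only: abs_le_square_iff)
  also have "\<dots> = \<beta> / 2 * (?A + ?B)" using assms(1) A B by simp
  finally show ?thesis by (simp add: sum_distrib_left mult.assoc)
qed

text \<open>Schur's test: the inequality of the means is applied to each entry, after which one half
  is summed along rows and the other along columns.\<close>

lemma bilinear_schur_bound: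
  fixes a b :: "nat \<Rightarrow> real"
  assumes "\<And>i. i < n \<Longrightarrow> (\<Sum>j<n. \<bar>r (i, j)\<bar>) \<le> \<rho>" "\<And>j. j < n \<Longrightarrow> (\<Sum>i<n. \<bar>r (i, j)\<bar>) \<le> \<rho>"
  shows "\<bar>\<Sum>i<n. \<Sum>j<n. a i * r (i, j) * b j\<bar> \<le> \<rho> / 2 * ((\<Sum>i<n. (a i)\<^sup>2) + (\<Sum>i<n. (b i)\<^sup>2))"
proof -
  have p: "\<bar>a i * r (i, j) * b j\<bar> \<le> \<bar>r (i, j)\<bar> * (a i)\<^sup>2 / 2 + \<bar>r (i, j)\<bar> * (b j)\<^sup>2 / 2" for i j
  proof -
    have "\<bar>a i\<bar> * \<bar>b j\<bar> \<le> ((a i)\<^sup>2 + (b j)\<^sup>2) / 2" using sum_squares_bound[of "\<bar>a i\<bar>" "\<bar>b j\<bar>"] by simp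
    then have "\<bar>r (i, j)\<bar> * (\<bar>a i\<bar> * \<bar>b j\<bar>) \<le> \<bar>r (i, j)\<bar> * (((a i)\<^sup>2 + (b j)\<^sup>2) / 2)" by (rule mult_left_mono) simp
    then show ?thesis by (simp add: abs_mult algebra_simps add_divide_distrib)
  qed
  have "\<bar>\<Sum>i<n. \<Sum>j<n. a i * r (i, j) * b j\<bar> \<le> (\<Sum>i<n. \<Sum>j<n. \<bar>a i * r (i, j) * b j\<bar>)"
    by (rule order.trans[OF sum_abs]) (intro sum_mono sum_abs)
  also have "\<dots> \<le> (\<Sum>i<n. \<Sum>j<n. \<bar>r (i, j)\<bar> * (a i)\<^sup>2 / 2 + \<bar>r (i, j)\<bar> * (b j)\<^sup>2 / 2)"
    by (intro sum_mono p)
  also have "\<dots> = (\<Sum>i<n. (\<Sum>j<n. \<bar>r (i, j)\<bar>) * ((a i)\<^sup>2 / 2)) + (\<Sum>j<n. (\<Sum>i<n. \<bar>r (i, j)\<bar>) * ((b j)\<^sup>2 / 2))"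
    unfolding sum.distrib sum_distrib_right by (subst (2) sum.swap) simp
  also have "\<dots> \<le> (\<Sum>i<n. \<rho> * ((a i)\<^sup>2 / 2)) + (\<Sum>j<n. \<rho> * ((b j)\<^sup>2 / 2))"
    using assms by (intro add_mono sum_mono mult_right_mono) auto
  also have "\<dots> = \<rho> / 2 * ((\<Sum>i<n. (a i)\<^sup>2) + (\<Sum>i<n. (b i)\<^sup>2))"
    by (simp add: sum_distrib_left algebra_simps sum_divide_distrib)
  finally show ?thesis .
qed

text \<open>The real part of the form consists of the two pure terms in the real and imaginary parts
  of \<open>w\<close>, the imaginary part of the two mixed ones. In both cases the bounds add up to
  \<open>\<gamma>\<close> times the squared norm, with no loss of constant.\<close>

lemma quadratic_form_bounds:
  fixes w :: "nat \<Rightarrow> complex" and y :: "nat \<times> nat \<Rightarrow> real"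
  assumes "\<And>a b. \<bar>\<Sum>i<n. \<Sum>j<n. a i * y (i, j) * b j\<bar> \<le> \<gamma> / 2 * ((\<Sum>i<n. (a i)\<^sup>2) + (\<Sum>i<n. (b i)\<^sup>2))"
  defines "q \<equiv> (\<Sum>i<n. cnj (w i) * (\<Sum>j<n. of_real (y (i, j)) * w j))"
  shows "\<bar>Re q\<bar> \<le> \<gamma> * (\<Sum>i<n. (cmod (w i))\<^sup>2)" "\<bar>Im q\<bar> \<le> \<gamma> * (\<Sum>i<n. (cmod (w i))\<^sup>2)"
proof -
  let ?B = "\<lambda>a b. \<Sum>i<n. \<Sum>j<n. a i * y (i, j) * b j"
  let ?r = "\<lambda>i. Re (w i)" and ?m = "\<lambda>i. Im (w i)"
  have w: "(\<Sum>i<n. (cmod (w i))\<^sup>2) = (\<Sum>i<n. (?r i)\<^sup>2) + (\<Sum>i<n. (?m i)\<^sup>2)"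
    by (simp add: cmod_power2 sum.distrib)
  have "Re q = ?B ?r ?r + ?B ?m ?m"
    unfolding q_def by (simp add: sum_distrib_left sum.distrib[symmetric] algebra_simps)
  then have "\<bar>Re q\<bar> \<le> \<bar>?B ?r ?r\<bar> + \<bar>?B ?m ?m\<bar>" by linarith
  also have "\<dots> \<le> \<gamma> / 2 * ((\<Sum>i<n. (?r i)\<^sup>2) + (\<Sum>i<n. (?r i)\<^sup>2)) + \<gamma> / 2 * ((\<Sum>i<n. (?m i)\<^sup>2) + (\<Sum>i<n. (?m i)\<^sup>2))"
    by (intro add_mono assms(1))
  finally show "\<bar>Re q\<bar> \<le> \<gamma> * (\<Sum>i<n. (cmod (w i))\<^sup>2)" unfolding w by (simp add: algebra_simps)
  have "Im q = ?B ?r ?m - ?B ?m ?r"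
    unfolding q_def by (simp add: sum_distrib_left sum_subtractf[symmetric] algebra_simps)
  then have "\<bar>Im q\<bar> \<le> \<bar>?B ?r ?m\<bar> + \<bar>?B ?m ?r\<bar>" by linarith
  also have "\<dots> \<le> \<gamma> / 2 * ((\<Sum>i<n. (?r i)\<^sup>2) + (\<Sum>i<n. (?m i)\<^sup>2)) + \<gamma> / 2 * ((\<Sum>i<n. (?m i)\<^sup>2) + (\<Sum>i<n. (?r i)\<^sup>2))"
    by (intro add_mono assms(1))
  finally show "\<bar>Im q\<bar> \<le> \<gamma> * (\<Sum>i<n. (cmod (w i))\<^sup>2)" unfolding w by (simp add: algebra_simps)
qed

text \<open>The constant \<open>\<kappa>\<close> appears when an eigenvector is replaced by its projection orthogonal to the constant
  vectors; it is then harmless because the entries of \<open>w\<close> sum to zero.\<close>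

lemma generator_eigenvalue_bounds:
  fixes w :: "nat \<Rightarrow> complex" and y :: "nat \<times> nat \<Rightarrow> real" and d :: "nat \<Rightarrow> real"
  assumes bil: "\<And>a b. \<bar>\<Sum>i<n. \<Sum>j<n. a i * y (i, j) * b j\<bar> \<le> \<gamma> / 2 * ((\<Sum>i<n. (a i)\<^sup>2) + (\<Sum>i<n. (b i)\<^sup>2))"
    and d: "\<And>i. i < n \<Longrightarrow> \<bar>d i\<bar> \<le> R"
    and eig: "\<And>i. i < n \<Longrightarrow> \<mu> * w i = (\<Sum>j<n. of_real (y (i, j)) * w j) - of_real (d i) * w i + \<kappa>"
    and \<kappa>: "\<kappa> * (\<Sum>i<n. w i) = 0" and "k < n" "w k \<noteq> 0"
  shows "\<bar>Re \<mu>\<bar> \<le> \<gamma> + R" "\<bar>Im \<mu>\<bar> \<le> \<gamma>"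
proof -
  define q where "q = (\<Sum>i<n. cnj (w i) * (\<Sum>j<n. of_real (y (i, j)) * w j))"
  define W where "W = (\<Sum>i<n. (cmod (w i))\<^sup>2)"
  have "0 < (cmod (w k))\<^sup>2" using assms by simp
  also have "\<dots> \<le> W" unfolding W_def using \<open>k < n\<close> by (intro member_le_sum) auto
  finally have W: "0 < W" .
  have \<kappa>': "(\<Sum>i<n. cnj (w i) * \<kappa>) = 0"
  proof (cases "\<kappa> = 0")
    case False
    then have "cnj (\<Sum>i<n. w i) = 0" using \<kappa> by simp
    then show ?thesis by (simp add: sum_distrib_right[symmetric])
  qed simp
  \<comment> \<open>The diagonal contributes a real number to the form, so the row sums affect only
    the real part of \<open>\<mu>\<close>.\<close>
  define D where "D = (\<Sum>i<n. d i * (cmod (w i))\<^sup>2)"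
  have n: "cnj z * z = of_real ((cmod z)\<^sup>2)" for z :: complex
    using complex_norm_square[of z] by (simp add: mult.commute)
  have "\<mu> * of_real W = (\<Sum>i<n. cnj (w i) * (\<mu> * w i))"
    unfolding W_def of_real_sum n[symmetric] by (simp add: sum_distrib_left mult_ac)
  also have "\<dots> = (\<Sum>i<n. cnj (w i) * ((\<Sum>j<n. of_real (y (i, j)) * w j) - of_real (d i) * w i + \<kappa>))"
    by (intro sum.cong refl) (simp add: eig)
  also have "\<dots> = q - (\<Sum>i<n. of_real (d i) * (cnj (w i) * w i))"
    using \<kappa>' by (simp add: q_def distrib_left right_diff_distrib sum.distrib sum_subtractf mult_ac)
  also have "\<dots> = q - of_real D" unfolding D_def n by simp
  finally have eq: "\<mu> * of_real W = q - of_real D" .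
  have "\<bar>D\<bar> \<le> (\<Sum>i<n. \<bar>d i\<bar> * (cmod (w i))\<^sup>2)" unfolding D_def
    by (rule order.trans[OF sum_abs]) (simp add: abs_mult)
  also have "\<dots> \<le> R * W" unfolding W_def sum_distrib_left using d by (intro sum_mono mult_right_mono) auto
  finally have D: "\<bar>D\<bar> \<le> R * W" .
  note qb = quadratic_form_bounds[OF bil, of w, folded q_def W_def]
  have "\<bar>Re \<mu>\<bar> * W = \<bar>Re \<mu> * W\<bar>" using W by (simp add: abs_mult)
  also have "\<dots> = \<bar>Re q - D\<bar>" using arg_cong[OF eq, of Re] by simp
  also have "\<dots> \<le> (\<gamma> + R) * W" using qb(1) D by (simp add: distrib_right)
  finally show "\<bar>Re \<mu>\<bar> \<le> \<gamma> + R" using W by simp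
  have "\<bar>Im \<mu>\<bar> * W = \<bar>Im \<mu> * W\<bar>" using W by (simp add: abs_mult)
  also have "\<dots> = \<bar>Im q\<bar>" using arg_cong[OF eq, of Im] by simp
  also have "\<dots> \<le> \<gamma> * W" using qb(2) by simp
  finally show "\<bar>Im \<mu>\<bar> \<le> \<gamma>" using W by simp
qed

text \<open>Bounds that hold almost surely for every fixed accuracy \<open>k\<close> hold with a deterministic accuracy \<open>j n\<close>
  that improves with \<open>n\<close>.\<close>

lemma (in prob_space) AE_diagonal:
  fixes E :: "nat \<Rightarrow> nat \<Rightarrow> 'a \<Rightarrow> bool"
  assumes [measurable]: "\<And>k n. Measurable.pred M (E k n)"
    and ev: "\<And>k. AE \<omega> in M. \<forall>\<^sub>F n in sequentially. E k n \<omega>"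
  obtains j where "filterlim j sequentially sequentially" "AE \<omega> in M. \<forall>\<^sub>F n in sequentially. E (j n) n \<omega>"
proof -
  \<comment> \<open>The events of some failure beyond \<open>N\<close> decrease to a null
    set.\<close>
  have "\<exists>N. prob {\<omega> \<in> space M. \<not> (\<forall>n\<ge>N. E k n \<omega>)} \<le> (1 / 2) ^ k" for k
  proof -
    let ?A = "\<lambda>N. {\<omega> \<in> space M. \<not> (\<forall>n\<ge>N. E k n \<omega>)}"
    have "(\<lambda>N. prob (?A N)) \<longlonglongrightarrow> prob (\<Inter>N. ?A N)"
      by (rule finite_Lim_measure_decseq) (auto simp: decseq_def, meson le_trans)
    moreover have "prob (\<Inter>N. ?A N) = 0"
    proof -
      have "AE \<omega> in M. \<omega> \<notin> (\<Inter>N. ?A N)"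
        using ev[of k] by eventually_elim (auto simp: eventually_sequentially)
      then show ?thesis by (intro prob_eq_0[THEN iffD2]) auto
    qed
    ultimately have "\<forall>\<^sub>F N in sequentially. prob (?A N) < (1 / 2) ^ k"
      by (intro order_tendstoD(2)[where a = "(1 / 2) ^ k"]) auto
    then show ?thesis using less_imp_le by (auto simp: eventually_sequentially)
  qed
  then obtain N0 where N0: "\<And>k. prob {\<omega> \<in> space M. \<not> (\<forall>n\<ge>N0 k. E k n \<omega>)} \<le> (1 / 2) ^ k" by metis
  \<comment> \<open>Partial sums give strictly increasing thresholds that stay above
    \<open>N0\<close>. Accuracy \<open>k\<close> is used for the sizes from \<open>N k\<close> up to
    \<open>N (Suc k)\<close>, excluding the latter.\<close>
  define N where "N k = (\<Sum>i\<le>k. Suc (N0 i))" for k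
  have mono: "strict_mono N" by (rule strict_mono_Suc_iff[THEN iffD2]) (simp add: N_def)
  have N0N: "N0 k \<le> N k" for k
  proof -
    have "Suc (N0 k) \<le> N k" unfolding N_def by (rule member_le_sum) auto
    then show ?thesis by simp
  qed
  have "\<forall>n. \<exists>k. N 0 \<le> n \<longrightarrow> N k \<le> n \<and> n < N (Suc k)" using strict_mono_bracket[OF mono] by metis
  then obtain j where j: "\<And>n. N 0 \<le> n \<Longrightarrow> N (j n) \<le> n \<and> n < N (Suc (j n))" by metis
  have N_0: "N 0 \<le> N k" for k using mono by (simp add: strict_mono_less_eq)
  have jge: "L \<le> j n" if "N L \<le> n" for L n
  proof -
    have "N L < N (Suc (j n))" using j[of n] N_0[of L] that by linarith
    then show ?thesis using mono by (simp add: strict_mono_less)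
  qed
  show ?thesis
  proof (rule that)
    show "filterlim j sequentially sequentially"
      unfolding filterlim_at_top eventually_sequentially using jge by blast
    have "AE \<omega> in M. \<forall>\<^sub>F k in sequentially. \<forall>n\<ge>N k. E k n \<omega>"
    proof (rule AE_eventuallyI)
      show "summable (\<lambda>k. (1 / 2 :: real) ^ k)" by (rule summable_geometric) simp
      have "prob {\<omega> \<in> space M. \<not> (\<forall>n\<ge>N k. E k n \<omega>)} \<le> prob {\<omega> \<in> space M. \<not> (\<forall>n\<ge>N0 k. E k n \<omega>)}" for k
        using N0N[of k] by (intro finite_measure_mono) (auto intro: order.trans)
      then show "\<forall>\<^sub>F k in sequentially. prob {\<omega> \<in> space M. \<not> (\<forall>n\<ge>N k. E k n \<omega>)} \<le> (1 / 2) ^ k"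
        using N0 order.trans by (intro always_eventually allI) blast
    qed measurable
    then show "AE \<omega> in M. \<forall>\<^sub>F n in sequentially. E (j n) n \<omega>"
    proof eventually_elim
      case (elim \<omega>)
      then obtain L where L: "\<And>k n. L \<le> k \<Longrightarrow> N k \<le> n \<Longrightarrow> E k n \<omega>" by (auto simp: eventually_sequentially)
      have "E (j n) n \<omega>" if "N L \<le> n" for n
        using L[of "j n" n] jge[OF that] j[of n] N_0[of L] that by linarith
      then show ?case by (auto simp: eventually_sequentially)
    qed
  qed
qed

section \<open>Almost sure bounds with deterministic error terms\<close>

context iid_array
begin

text \<open>The four almost sure properties at accuracy \<open>\<eta>\<close> are gathered in one
  measurable event per size, the form in which the diagonal argument takes them.\<close>

definition good :: "real \<Rightarrow> nat \<Rightarrow> 'a \<Rightarrow> bool" where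
  "good \<eta> n \<omega> \<longleftrightarrow>
     path_trace (\<lambda>e. T (level n) e \<omega>) n (trace_len n) < ((1 + \<eta>) * norm_bound \<sigma> n) ^ trace_len n \<and>
     (\<forall>i<n. \<forall>j<n. \<bar>Y (i, j) \<omega>\<bar> \<le> \<eta> * sqrt (real n)) \<and>
     (\<forall>e\<in>{..<n} \<times> {..<n}. \<forall>e'\<in>{..<n} \<times> {..<n}.
        aligned e e' \<longrightarrow> \<not> (real n powr (5 / 12) < \<bar>Y e \<omega>\<bar> \<and> real n powr (5 / 12) < \<bar>Y e' \<omega>\<bar>)) \<and>
     (\<forall>i<n. \<bar>\<Sum>k<n. Y (i, k) \<omega>\<bar> \<le> (1 + 3 * \<eta>) * row_scale n)"

lemma good_measurable: "Measurable.pred M (good \<eta> n)"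
proof -
  have "Measurable.pred M (\<lambda>\<omega>. \<forall>e\<in>{..<n} \<times> {..<n}. \<forall>e'\<in>{..<n} \<times> {..<n}.
        aligned e e' \<longrightarrow> \<not> (real n powr (5 / 12) < \<bar>Y e \<omega>\<bar> \<and> real n powr (5 / 12) < \<bar>Y e' \<omega>\<bar>))"
    by (intro pred_intros_finite) (auto simp del: ball_simps)
  then show ?thesis unfolding good_def[abs_def] by measurable
qed

lemma AE_good:
  assumes "0 < \<eta>"
  shows "AE \<omega> in M. \<forall>\<^sub>F n in sequentially. good \<eta> n \<omega>"
  using AE_trace_small[OF assms] AE_entries_small[OF assms] AE_large_not_aligned AE_rows[OF assms]
proof eventually_elim
  case (elim \<omega>)
  then show ?case unfolding good_def by eventually_elim blast
qed

text \<open>The norm of the truncated part, plus a Schur bound for the rest: one isolated large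
  entry in a row or column, and a constant matrix made of the truncated mean.\<close>

definition form_bound :: "real \<Rightarrow> nat \<Rightarrow> real" where
  "form_bound \<eta> n = (1 + \<eta>) * norm_bound \<sigma> n + (\<eta> * sqrt (real n) + real n * (C4 / level n ^ 3))"

lemma good_bilinear:
  assumes good: "good \<eta> n \<omega>" and "0 < \<eta>" "2 \<le> n"
  shows "\<bar>\<Sum>i<n. \<Sum>j<n. a i * Y (i, j) \<omega> * b j\<bar> \<le> form_bound \<eta> n / 2 * ((\<Sum>i<n. (a i)\<^sup>2) + (\<Sum>i<n. (b i)\<^sup>2))"
proof -
  let ?K = "level n" and ?\<beta> = "(1 + \<eta>) * norm_bound \<sigma> n" and ?\<rho> = "\<eta> * sqrt (real n) + real n * (C4 / level n ^ 3)"
  let ?E = "expectation (\<lambda>\<omega>. trunc ?K (Y (0, 0) \<omega>))"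
  define t where "t e = T ?K e \<omega>" for e
  define r where "r e = (Y e \<omega> - trunc ?K (Y e \<omega>)) + ?E" for e
  have K: "0 < ?K" using assms(3) by (simp add: level_def)
  have Y: "Y e \<omega> = t e + r e" for e
    unfolding t_def T_def r_def using expectation_same[of "trunc ?K" e "(0, 0)"] by simp
  have \<beta>: "0 \<le> ?\<beta>" using assms(2) sigma_pos K by (simp add: norm_bound_def)
  define q where "q = 2 * nat \<lceil>(ln (real n))\<^sup>2\<rceil>"
  have p: "trace_len n = 2 * q" by (simp add: trace_len_def q_def)
  have "0 < ln (real n)" using assms(3) by simp
  then have q: "even q" "0 < q" by (simp_all add: q_def)
  have "path_trace t n (2 * q) \<le> ?\<beta> ^ (2 * q)"
    using good unfolding good_def t_def[abs_def] p[symmetric] by simp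
  then have tb: "(\<Sum>i<n. (\<Sum>j<n. t (i, j) * v j)\<^sup>2) \<le> ?\<beta>\<^sup>2 * (\<Sum>j<n. (v j)\<^sup>2)" for v
    by (rule norm_image_le_path_trace[OF q \<beta>])
  have lev: "real n powr (5 / 12) \<le> ?K" using assms(3) by (simp add: level_def powr_mono)
  have one: "\<not> (?K < \<bar>Y e \<omega>\<bar> \<and> ?K < \<bar>Y e' \<omega>\<bar>)" if "e \<in> {..<n} \<times> {..<n}" "e' \<in> {..<n} \<times> {..<n}" "aligned e e'" for e e'
    using good that lev unfolding good_def by (meson order.strict_trans1)
  have Eb: "\<bar>?E\<bar> \<le> C4 / ?K ^ 3" by (rule expectation_trunc_small[OF K])
  \<comment> \<open>Here \<open>f\<close> runs along a row or along a column, so both hypotheses of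
    the Schur bound are covered at once.\<close>
  have sumr: "(\<Sum>k<n. \<bar>r (f k)\<bar>) \<le> ?\<rho>"
    if "\<And>k. k < n \<Longrightarrow> f k \<in> {..<n} \<times> {..<n}" "\<And>k l. k < n \<Longrightarrow> l < n \<Longrightarrow> k \<noteq> l \<Longrightarrow> aligned (f k) (f l)" for f
  proof -
    have "(\<Sum>k<n. \<bar>r (f k)\<bar>) \<le> (\<Sum>k<n. \<bar>Y (f k) \<omega> - trunc ?K (Y (f k) \<omega>)\<bar> + C4 / ?K ^ 3)"
      unfolding r_def using Eb by (intro sum_mono) linarith
    also have "\<dots> = (\<Sum>k<n. \<bar>Y (f k) \<omega> - trunc ?K (Y (f k) \<omega>)\<bar>) + real n * (C4 / ?K ^ 3)"
      by (simp add: sum.distrib)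
    also have "(\<Sum>k<n. \<bar>Y (f k) \<omega> - trunc ?K (Y (f k) \<omega>)\<bar>) \<le> \<eta> * sqrt (real n)"
    proof (rule sum_tail_le)
      show "\<bar>Y (f k) \<omega>\<bar> \<le> \<eta> * sqrt (real n)" if "k \<in> {..<n}" for k
        using good \<open>\<And>k. k < n \<Longrightarrow> f k \<in> {..<n} \<times> {..<n}\<close>[of k] that unfolding good_def by (cases "f k") auto
      show "\<not> (?K < \<bar>Y (f k) \<omega>\<bar> \<and> ?K < \<bar>Y (f l) \<omega>\<bar>)" if "k \<in> {..<n}" "l \<in> {..<n}" "k \<noteq> l" for k l
        by (rule one) (use that \<open>\<And>k. k < n \<Longrightarrow> f k \<in> {..<n} \<times> {..<n}\<close>
          \<open>\<And>k l. k < n \<Longrightarrow> l < n \<Longrightarrow> k \<noteq> l \<Longrightarrow> aligned (f k) (f l)\<close> in auto)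
    qed (use assms(2) in auto)
    finally show ?thesis by simp
  qed
  have "\<bar>\<Sum>i<n. \<Sum>j<n. a i * Y (i, j) \<omega> * b j\<bar> =
      \<bar>(\<Sum>i<n. \<Sum>j<n. a i * t (i, j) * b j) + (\<Sum>i<n. \<Sum>j<n. a i * r (i, j) * b j)\<bar>"
    unfolding Y by (simp add: distrib_left distrib_right sum.distrib)
  also have "\<dots> \<le> \<bar>\<Sum>i<n. \<Sum>j<n. a i * t (i, j) * b j\<bar> + \<bar>\<Sum>i<n. \<Sum>j<n. a i * r (i, j) * b j\<bar>"
    by (rule abs_triangle_ineq)
  also have "\<dots> \<le> ?\<beta> / 2 * ((\<Sum>i<n. (a i)\<^sup>2) + (\<Sum>i<n. (b i)\<^sup>2)) + ?\<rho> / 2 * ((\<Sum>i<n. (a i)\<^sup>2) + (\<Sum>i<n. (b i)\<^sup>2))"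
  proof (intro add_mono bilinear_norm_bound[OF \<beta> tb] bilinear_schur_bound)
    show "(\<Sum>j<n. \<bar>r (i, j)\<bar>) \<le> ?\<rho>" if "i < n" for i
      by (rule sumr) (use that in \<open>auto simp: aligned_def\<close>)
    show "(\<Sum>i<n. \<bar>r (i, j)\<bar>) \<le> ?\<rho>" if "j < n" for j
      by (rule sumr[of "\<lambda>i. (i, j)"]) (use that in \<open>auto simp: aligned_def\<close>)
  qed
  also have "\<dots> = form_bound \<eta> n / 2 * ((\<Sum>i<n. (a i)\<^sup>2) + (\<Sum>i<n. (b i)\<^sup>2))"
    unfolding form_bound_def by (simp add: algebra_simps add_divide_distrib)
  finally show ?thesis .
qed

text \<open>One constant serves both bounds. In the first, \<open>2 * \<eta>\<close> comes from the
  factor \<open>1 + \<eta>\<close>, \<open>\<eta> / \<sigma>\<close> from the largest entries and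
  \<open>\<eta>\<close> from lower-order terms. In the second, the whole form bound is below
  \<open>\<eta> * row_scale n\<close>, being smaller by a factor of order
  \<open>sqrt (ln n)\<close>, and joins the three \<open>\<eta>\<close> of the row sums.\<close>

lemma form_bound_asymptotics:
  assumes "0 < \<eta>"
  shows "\<forall>\<^sub>F n in sequentially. form_bound \<eta> n \<le> \<sigma> * sqrt (real n) * (2 + (4 + 1 / \<sigma>) * \<eta>) \<and>
    form_bound \<eta> n + (1 + 3 * \<eta>) * row_scale n \<le> row_scale n * (1 + (4 + 1 / \<sigma>) * \<eta>)"
proof -
  define c where "c = C4 + 1"
  have c: "0 < c" "C4 \<le> c" using C4_nonneg by (auto simp: c_def)
  define s where "s = 1 + \<eta>"
  have s: "0 < s" using assms by (simp add: s_def)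
  have 1: "\<forall>\<^sub>F n in sequentially. s * (2 * real n powr (7 / 16) * (4 * (ln (real n))\<^sup>2 + 5) ^ 2) +
      real n * (c / (real n powr (7 / 16)) ^ 3) \<le> \<eta> * (\<sigma> * sqrt (real n))"
    using c(1) s assms sigma_pos by real_asymp
  define B where "B = \<sigma> * (2 + (4 + 1 / \<sigma>) * \<eta>)"
  have B: "0 < B" using assms sigma_pos by (simp add: B_def add_pos_pos)
  have 2: "\<forall>\<^sub>F n in sequentially. B * sqrt (real n) \<le> \<eta> * (\<sigma> * sqrt (2 * real n * ln (real n)))"
    using B assms sigma_pos by real_asymp
  show ?thesis using 1 2 eventually_ge_at_top[of 2]
  proof eventually_elim
    case (elim n)
    have K: "0 < level n" using elim(3) by (simp add: level_def)
    have cl: "real (nat \<lceil>(ln (real n))\<^sup>2\<rceil>) \<le> (ln (real n))\<^sup>2 + 1"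
    proof -
      have "0 \<le> \<lceil>(ln (real n))\<^sup>2\<rceil>" by (simp add: less_le_trans[of _ 0])
      then show ?thesis using of_int_ceiling_le_add_one[of "(ln (real n))\<^sup>2"] by (simp add: of_nat_nat)
    qed
    have "real (trace_len n + 1) \<le> 4 * (ln (real n))\<^sup>2 + 5"
      unfolding trace_len_def of_nat_add of_nat_mult of_nat_numeral of_nat_1 using cl by linarith
    then have t: "2 * level n * real (trace_len n + 1) ^ 2 \<le> 2 * level n * (4 * (ln (real n))\<^sup>2 + 5) ^ 2"
      using K by (intro mult_left_mono power_mono) auto
    have u: "real n * (C4 / level n ^ 3) \<le> real n * (c / level n ^ 3)"
      using c K by (intro mult_left_mono divide_right_mono) auto
    have "form_bound \<eta> n = s * (2 * \<sigma> * sqrt (real n)) + s * (2 * level n * real (trace_len n + 1) ^ 2)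
        + \<eta> * sqrt (real n) + real n * (C4 / level n ^ 3)"
      by (simp add: form_bound_def norm_bound_def s_def algebra_simps)
    also have "\<dots> \<le> s * (2 * \<sigma> * sqrt (real n)) + s * (2 * level n * (4 * (ln (real n))\<^sup>2 + 5) ^ 2)
        + \<eta> * sqrt (real n) + real n * (c / level n ^ 3)"
      using mult_left_mono[OF t less_imp_le[OF s]] u by linarith
    also have "\<dots> \<le> s * (2 * \<sigma> * sqrt (real n)) + \<eta> * sqrt (real n) + \<eta> * (\<sigma> * sqrt (real n))"
      using elim(1) by (simp only: level_def)
    also have "\<dots> \<le> \<sigma> * sqrt (real n) * (2 + (4 + 1 / \<sigma>) * \<eta>)"
      using sigma_pos assms by (simp add: s_def field_simps)
    finally have f: "form_bound \<eta> n \<le> \<sigma> * sqrt (real n) * (2 + (4 + 1 / \<sigma>) * \<eta>)" .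
    also have "\<dots> = B * sqrt (real n)" by (simp add: B_def)
    also have "\<dots> \<le> \<eta> * row_scale n" using elim(2) by (simp only: row_scale_def)
    finally have "form_bound \<eta> n + (1 + 3 * \<eta>) * row_scale n \<le> row_scale n * (1 + 4 * \<eta>)"
      by (simp add: algebra_simps)
    also have "\<dots> \<le> row_scale n * (1 + (4 + 1 / \<sigma>) * \<eta>)"
    proof (rule mult_left_mono)
      show "0 \<le> row_scale n" using elim(3) sigma_pos by (simp add: row_scale_def)
    qed (use assms sigma_pos in \<open>simp add: distrib_right\<close>)
    finally show ?case using f by simp
  qed
qed

text \<open>The quantifiers over \<open>w\<close> and \<open>\<kappa>\<close> let one null set and
  one error sequence serve both matrices: \<open>\<kappa> = 0\<close> for the centred one, and a
  multiple of the average of the eigenvector for \<open>L_mat\<close>.\<close>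

lemma uniform_bounds:
  obtains \<epsilon> :: "nat \<Rightarrow> real" where "\<epsilon> \<longlonglongrightarrow> 0"
    "AE \<omega> in M. \<forall>\<^sub>F n in sequentially. \<forall>\<mu> \<kappa> w.
       (\<forall>i<n. \<mu> * w i = (\<Sum>j<n. complex_of_real (Y (i, j) \<omega>) * w j) - of_real (\<Sum>j<n. Y (i, j) \<omega>) * w i + \<kappa>) \<longrightarrow>
       \<kappa> * (\<Sum>i<n. w i) = 0 \<longrightarrow> (\<exists>k<n. w k \<noteq> 0) \<longrightarrow>
       \<bar>Re \<mu>\<bar> \<le> \<sigma> * sqrt (2 * real n * ln (real n)) * (1 + \<epsilon> n) \<and> \<bar>Im \<mu>\<bar> \<le> \<sigma> * sqrt (real n) * (2 + \<epsilon> n)"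
proof -
  define \<eta> :: "nat \<Rightarrow> real" where "\<eta> k = 1 / real (Suc k)" for k
  have \<eta>: "0 < \<eta> k" for k by (simp add: \<eta>_def)
  let ?det = "\<lambda>k n. form_bound (\<eta> k) n \<le> \<sigma> * sqrt (real n) * (2 + (4 + 1 / \<sigma>) * \<eta> k) \<and>
    form_bound (\<eta> k) n + (1 + 3 * \<eta> k) * row_scale n \<le> row_scale n * (1 + (4 + 1 / \<sigma>) * \<eta> k)"
  let ?E = "\<lambda>k n \<omega>. good (\<eta> k) n \<omega> \<and> ?det k n"
  have "Measurable.pred M (?E k n)" for k n
    using good_measurable by measurable
  moreover have "AE \<omega> in M. \<forall>\<^sub>F n in sequentially. ?E k n \<omega>" for k
    using AE_good[OF \<eta>[of k]]
  proof eventually_elim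
    case (elim \<omega>)
    then show ?case using form_bound_asymptotics[OF \<eta>[of k]] by eventually_elim simp
  qed
  ultimately obtain j where j: "filterlim j sequentially sequentially" "AE \<omega> in M. \<forall>\<^sub>F n in sequentially. ?E (j n) n \<omega>"
    by (rule AE_diagonal)
  define \<epsilon> where "\<epsilon> n = (4 + 1 / \<sigma>) * \<eta> (j n)" for n
  have "\<eta> \<longlonglongrightarrow> 0" unfolding \<eta>_def by real_asymp
  then have "(\<lambda>n. \<eta> (j n)) \<longlonglongrightarrow> 0" by (rule filterlim_compose[OF _ j(1)])
  from tendsto_mult_left[OF this, of "4 + 1 / \<sigma>"] have e0: "\<epsilon> \<longlonglongrightarrow> 0" by (simp add: \<epsilon>_def[abs_def])
  show ?thesis
  proof (rule that[OF e0])
    show "AE \<omega> in M. \<forall>\<^sub>F n in sequentially. \<forall>\<mu> \<kappa> w.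
       (\<forall>i<n. \<mu> * w i = (\<Sum>j<n. complex_of_real (Y (i, j) \<omega>) * w j) - of_real (\<Sum>j<n. Y (i, j) \<omega>) * w i + \<kappa>) \<longrightarrow>
       \<kappa> * (\<Sum>i<n. w i) = 0 \<longrightarrow> (\<exists>k<n. w k \<noteq> 0) \<longrightarrow>
       \<bar>Re \<mu>\<bar> \<le> \<sigma> * sqrt (2 * real n * ln (real n)) * (1 + \<epsilon> n) \<and> \<bar>Im \<mu>\<bar> \<le> \<sigma> * sqrt (real n) * (2 + \<epsilon> n)"
      using j(2)
    proof eventually_elim
      case (elim \<omega>)
      then show ?case using eventually_ge_at_top[of 2]
      proof eventually_elim
        case (elim n)
        show ?case
        proof (intro allI impI)
          fix \<mu> \<kappa> w
          assume eig: "\<forall>i<n. \<mu> * w i = (\<Sum>j<n. complex_of_real (Y (i, j) \<omega>) * w j) - of_real (\<Sum>j<n. Y (i, j) \<omega>) * w i + \<kappa>"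
            and \<kappa>: "\<kappa> * (\<Sum>i<n. w i) = 0" and "\<exists>k<n. w k \<noteq> 0"
          then obtain k where k: "k < n" "w k \<noteq> 0" by auto
          have d: "\<bar>\<Sum>k<n. Y (i, k) \<omega>\<bar> \<le> (1 + 3 * \<eta> (j n)) * row_scale n" if "i < n" for i
            using elim(1) that unfolding good_def by blast
          note b = generator_eigenvalue_bounds[where y = "\<lambda>e. Y e \<omega>" and d = "\<lambda>i. \<Sum>k<n. Y (i, k) \<omega>",
            OF good_bilinear[OF conjunct1[OF elim(1)] \<eta> elim(2)] d eig[rule_format] \<kappa> k]
          show "\<bar>Re \<mu>\<bar> \<le> \<sigma> * sqrt (2 * real n * ln (real n)) * (1 + \<epsilon> n) \<and> \<bar>Im \<mu>\<bar> \<le> \<sigma> * sqrt (real n) * (2 + \<epsilon> n)"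
            using b elim(1) unfolding \<epsilon>_def row_scale_def by (auto intro: order.trans)
        qed
      qed
    qed
  qed
qed

end

section \<open>Eigenvalue equations in coordinates and the reduction to the centred array\<close>

lemma complex_eigenvalue_entries:
  assumes "A \<in> carrier_mat n n" "complex_eigenvalue A \<mu>"
  obtains v where "\<And>i. i < n \<Longrightarrow> (\<Sum>j<n. complex_of_real (A $$ (i, j)) * v j) = \<mu> * v i" "\<exists>k<n. v k \<noteq> 0"
proof -
  obtain v where v: "v \<in> carrier_vec n" "v \<noteq> 0\<^sub>v n" "map_mat complex_of_real A *\<^sub>v v = \<mu> \<cdot>\<^sub>v v"
    using assms unfolding eigenvalue_def eigenvector_def by auto
  show ?thesis
  proof (rule that[of "\<lambda>j. v $ j"])
    fix i assume i: "i < n"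
    have "(map_mat complex_of_real A *\<^sub>v v) $ i = (\<mu> \<cdot>\<^sub>v v) $ i" by (simp only: v)
    then show "(\<Sum>j<n. complex_of_real (A $$ (i, j)) * v $ j) = \<mu> * v $ i"
      using i v(1) assms(1) by (auto simp: scalar_prod_def atLeast0LessThan intro!: sum.cong elim!: trans[rotated])
  next
    show "\<exists>k<n. v $ k \<noteq> 0"
    proof (rule ccontr)
      assume "\<not> (\<exists>k<n. v $ k \<noteq> 0)"
      then have "v = 0\<^sub>v n" using v(1) by (intro eq_vecI) auto
      with v(2) show False ..
    qed
  qed
qed

lemma L_mat_carrier: "L_mat X n \<omega> \<in> carrier_mat n n"
  by (simp add: L_mat_def X_mat_def D_mat_def mat_diag_def minus_carrier_mat)

lemma L_mat_entry:
  assumes "i < n" "j < n"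
  shows "L_mat X n \<omega> $$ (i, j) = X i j \<omega> - (if i = j then \<Sum>k<n. X i k \<omega> else 0)"
  using assms by (auto simp: L_mat_def X_mat_def D_mat_def mat_diag_def)

lemma L_centered_carrier: "L_centered M X n \<omega> \<in> carrier_mat n n"
  by (simp add: L_centered_def mat_expectation_def minus_carrier_mat)

theorem theorem1p5:
  fixes M :: "'a measure"
    and x :: "'a \<Rightarrow> real"
    and X :: "nat \<Rightarrow> nat \<Rightarrow> 'a \<Rightarrow> real"
    and m \<sigma> :: real
  assumes "prob_space M"
    and x_rv: "x \<in> borel_measurable M"
    and x_nonneg: "\<And>\<omega>. \<omega> \<in> space M \<Longrightarrow> 0 \<le> x \<omega>"
    and mean: "prob_space.expectation M x = m"
    and variance: "prob_space.variance M x = \<sigma>\<^sup>2"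
    and sigma_pos: "0 < \<sigma>"
    and fourth_moment: "integrable M (\<lambda>\<omega>. \<bar>x \<omega>\<bar> ^ 4)"
    and indep: "prob_space.indep_vars M (\<lambda>_. borel) (\<lambda>(i, j). X i j) (UNIV :: (nat \<times> nat) set)"
    and copies: "\<And>i j. distr M borel (X i j) = distr M borel x"
  shows
    "(\<exists>\<epsilon> \<delta> :: nat \<Rightarrow> real. \<epsilon> \<longlonglongrightarrow> 0 \<and> \<delta> \<longlonglongrightarrow> 0 \<and>
        (AE \<omega> in M. \<forall>\<^sub>F n in sequentially.
           \<forall>\<mu>. complex_eigenvalue (L_centered M X n \<omega>) \<mu> \<longrightarrow>
             \<bar>Re \<mu>\<bar> \<le> \<sigma> * sqrt (2 * real n * ln (real n)) * (1 + \<epsilon> n) \<and>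
             \<bar>Im \<mu>\<bar> \<le> \<sigma> * sqrt (real n) * (2 + \<delta> n))) \<and>
     (\<exists>\<epsilon> \<delta> :: nat \<Rightarrow> real. \<epsilon> \<longlonglongrightarrow> 0 \<and> \<delta> \<longlonglongrightarrow> 0 \<and>
        (AE \<omega> in M. \<forall>\<^sub>F n in sequentially.
           \<forall>\<mu>. complex_eigenvalue (L_mat X n \<omega>) \<mu> \<and> \<mu> \<noteq> 0 \<longrightarrow>
             \<bar>Re \<mu> + m * real n\<bar> \<le> \<sigma> * sqrt (2 * real n * ln (real n)) * (1 + \<epsilon> n) \<and>
             \<bar>Im \<mu>\<bar> \<le> \<sigma> * sqrt (real n) * (2 + \<delta> n)))"
proof -
  interpret prob_space M by fact
  define Y where "Y e \<omega> = X (fst e) (snd e) \<omega> - m" for e \<omega>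
  have X_rv [measurable]: "X i j \<in> borel_measurable M" for i j
    using indep unfolding indep_vars_def2 by (auto dest!: conjunct1)
  have [measurable]: "x \<in> borel_measurable M" by (rule x_rv)
  have X_integral: "expectation (\<lambda>\<omega>. f (X i j \<omega>)) = (expectation (\<lambda>\<omega>. f (x \<omega>)) :: real)"
    if [measurable]: "f \<in> borel_measurable borel" for f i j
    using integral_distr[of "X i j" M borel f] integral_distr[of x M borel f] copies[of i j] by simp
  have X_integrable: "integrable M (\<lambda>\<omega>. f (X i j \<omega>)) \<longleftrightarrow> integrable M (\<lambda>\<omega>. f (x \<omega>) :: real)"
    if [measurable]: "f \<in> borel_measurable borel" for f i j
    using integrable_distr_eq[of "X i j" M borel f] integrable_distr_eq[of x M borel f] copies[of i j] by simp
  have power4: "\<bar>y + z\<bar> ^ 4 \<le> 8 * (\<bar>y\<bar> ^ 4 + \<bar>z\<bar> ^ 4)" for y z :: real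
  proof -
    have sq: "(a + b)\<^sup>2 \<le> 2 * (a\<^sup>2 + b\<^sup>2)" for a b :: real
      using sum_squares_bound[of a b] by (simp add: power2_sum)
    have "(y + z) ^ 4 = ((y + z)\<^sup>2)\<^sup>2" by (simp add: power_mult[symmetric])
    also have "\<dots> \<le> (2 * (y\<^sup>2 + z\<^sup>2))\<^sup>2" using sq by (intro power_mono) auto
    also have "\<dots> \<le> 4 * (2 * ((y\<^sup>2)\<^sup>2 + (z\<^sup>2)\<^sup>2))" unfolding power_mult_distrib using sq[of "y\<^sup>2" "z\<^sup>2"] by simp
    finally show ?thesis by (simp add: power_mult[symmetric])
  qed
  have x4: "integrable M (\<lambda>\<omega>. (x \<omega> - m) ^ 4)"
  proof (rule Bochner_Integration.integrable_bound)
    show "integrable M (\<lambda>\<omega>. 8 * (\<bar>x \<omega>\<bar> ^ 4 + \<bar>- m\<bar> ^ 4))" using fourth_moment by simp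
    show "AE \<omega> in M. norm ((x \<omega> - m) ^ 4) \<le> norm (8 * (\<bar>x \<omega>\<bar> ^ 4 + \<bar>- m\<bar> ^ 4))"
      using power4[of "x _" "- m"] by (intro AE_I2) simp
  qed simp
  have x1: "integrable M x"
  proof (rule Bochner_Integration.integrable_bound)
    show "integrable M (\<lambda>\<omega>. 1 + \<bar>x \<omega>\<bar> ^ 4)" using fourth_moment by simp
    show "AE \<omega> in M. norm (x \<omega>) \<le> norm (1 + \<bar>x \<omega>\<bar> ^ 4)"
      using abs_le_one_plus_power4 by auto
  qed simp
  have X1: "integrable M (X i j)" and EX: "expectation (X i j) = m" for i j
    using X_integrable[of "\<lambda>y. y" i j] X_integral[of "\<lambda>y. y" i j] x1 mean by simp_all
  interpret iid_array M Y \<sigma>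
  proof
    show "indep_vars (\<lambda>_. borel) Y UNIV"
      using indep_vars_compose2[OF indep, of "\<lambda>_ y. y - m" "\<lambda>_. borel"] by (simp add: Y_def[abs_def] case_prod_unfold)
    show "distr M borel (Y e) = distr M borel (Y e')" for e e'
    proof -
      have "distr M borel (Y e) = distr (distr M borel x) borel (\<lambda>y. y - m)" for e
        unfolding copies[of "fst e" "snd e", symmetric] by (simp add: distr_distr comp_def Y_def[abs_def])
      then show ?thesis by simp
    qed
    show "expectation (Y e) = 0" for e
      unfolding Y_def[abs_def] using X1 EX by (simp add: prob_space)
    show "expectation (\<lambda>\<omega>. (Y e \<omega>)\<^sup>2) = \<sigma>\<^sup>2" for e
      unfolding Y_def using X_integral[of "\<lambda>y. (y - m)\<^sup>2"] variance mean by simp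
    show "integrable M (\<lambda>\<omega>. Y e \<omega> ^ 4)" for e
      unfolding Y_def using X_integrable[of "\<lambda>y. (y - m) ^ 4"] x4 by simp
    show "0 < \<sigma>" by fact
  qed
  have X_Y: "X i j \<omega> = Y (i, j) \<omega> + m" for i j \<omega> by (simp add: Y_def)
  have EL: "expectation (\<lambda>\<omega>. L_mat X n \<omega> $$ (i, j)) = m - (if i = j then real n * m else 0)"
    if "i < n" "j < n" for n i j
    using that X1 by (simp add: L_mat_entry EX)
  have centered: "L_centered M X n \<omega> $$ (i, j) = Y (i, j) \<omega> - (if i = j then \<Sum>k<n. Y (i, k) \<omega> else 0)"
    if "i < n" "j < n" for n i j \<omega>
  proof -
    have "L_mat X n \<omega> \<in> carrier_mat n n" by (rule L_mat_carrier)
    then have "L_centered M X n \<omega> $$ (i, j) = L_mat X n \<omega> $$ (i, j) - expectation (\<lambda>\<omega>. L_mat X n \<omega> $$ (i, j))"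
      using that by (simp add: L_centered_def mat_expectation_def)
    then have "L_centered M X n \<omega> $$ (i, j) = L_mat X n \<omega> $$ (i, j) - (m - (if i = j then real n * m else 0))"
      by (simp only: EL[OF that])
    then show ?thesis using that by (simp add: L_mat_entry X_Y sum.distrib)
  qed
  obtain \<epsilon> where \<epsilon>: "\<epsilon> \<longlonglongrightarrow> 0" and bounds:
    "AE \<omega> in M. \<forall>\<^sub>F n in sequentially. \<forall>\<mu> \<kappa> w.
       (\<forall>i<n. \<mu> * w i = (\<Sum>j<n. complex_of_real (Y (i, j) \<omega>) * w j) - of_real (\<Sum>j<n. Y (i, j) \<omega>) * w i + \<kappa>) \<longrightarrow>
       \<kappa> * (\<Sum>i<n. w i) = 0 \<longrightarrow> (\<exists>k<n. w k \<noteq> 0) \<longrightarrow>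
       \<bar>Re \<mu>\<bar> \<le> \<sigma> * sqrt (2 * real n * ln (real n)) * (1 + \<epsilon> n) \<and> \<bar>Im \<mu>\<bar> \<le> \<sigma> * sqrt (real n) * (2 + \<epsilon> n)"
    by (rule uniform_bounds)
  have part1: "AE \<omega> in M. \<forall>\<^sub>F n in sequentially.
           \<forall>\<mu>. complex_eigenvalue (L_centered M X n \<omega>) \<mu> \<longrightarrow>
             \<bar>Re \<mu>\<bar> \<le> \<sigma> * sqrt (2 * real n * ln (real n)) * (1 + \<epsilon> n) \<and>
             \<bar>Im \<mu>\<bar> \<le> \<sigma> * sqrt (real n) * (2 + \<epsilon> n)"
    using bounds
  proof eventually_elim
    case (elim \<omega>)
    then show ?case
    proof eventually_elim
      case (elim n)
      show ?case
      proof (intro allI impI)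
        fix \<mu> assume "complex_eigenvalue (L_centered M X n \<omega>) \<mu>"
        then obtain v where v: "\<And>i. i < n \<Longrightarrow> (\<Sum>j<n. complex_of_real (L_centered M X n \<omega> $$ (i, j)) * v j) = \<mu> * v i"
          "\<exists>k<n. v k \<noteq> 0"
          by (rule complex_eigenvalue_entries[OF L_centered_carrier]) blast
        have "\<mu> * v i = (\<Sum>j<n. complex_of_real (Y (i, j) \<omega>) * v j) - of_real (\<Sum>j<n. Y (i, j) \<omega>) * v i + 0"
          if i: "i < n" for i
        proof -
          have "\<mu> * v i = (\<Sum>j<n. complex_of_real (Y (i, j) \<omega>) * v j -
              (if i = j then of_real (\<Sum>k<n. Y (i, k) \<omega>) * v i else 0))"
            unfolding v(1)[OF i, symmetric] by (rule sum.cong) (use i in \<open>auto simp: centered algebra_simps\<close>)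
          then show ?thesis using i by (simp add: sum_subtractf)
        qed
        then show "\<bar>Re \<mu>\<bar> \<le> \<sigma> * sqrt (2 * real n * ln (real n)) * (1 + \<epsilon> n) \<and> \<bar>Im \<mu>\<bar> \<le> \<sigma> * sqrt (real n) * (2 + \<epsilon> n)"
          using elim[rule_format, of \<mu> v 0] v(2) by simp
      qed
    qed
  qed
  have part2: "AE \<omega> in M. \<forall>\<^sub>F n in sequentially.
           \<forall>\<mu>. complex_eigenvalue (L_mat X n \<omega>) \<mu> \<and> \<mu> \<noteq> 0 \<longrightarrow>
             \<bar>Re \<mu> + m * real n\<bar> \<le> \<sigma> * sqrt (2 * real n * ln (real n)) * (1 + \<epsilon> n) \<and>
             \<bar>Im \<mu>\<bar> \<le> \<sigma> * sqrt (real n) * (2 + \<epsilon> n)"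
    using bounds
  proof eventually_elim
    case (elim \<omega>)
    then show ?case using eventually_ge_at_top[of 1]
    proof eventually_elim
      case (elim n)
      show ?case
      proof (intro allI impI)
        fix \<mu> assume \<mu>: "complex_eigenvalue (L_mat X n \<omega>) \<mu> \<and> \<mu> \<noteq> 0"
        from conjunct1[OF \<mu>] obtain v where v: "\<And>i. i < n \<Longrightarrow> (\<Sum>j<n. complex_of_real (L_mat X n \<omega> $$ (i, j)) * v j) = \<mu> * v i"
          "\<exists>k<n. v k \<noteq> 0"
          by (rule complex_eigenvalue_entries[OF L_mat_carrier]) blast
        \<comment> \<open>Subtracting the average \<open>s\<close> projects \<open>v\<close> onto
          the vectors of sum zero. The equation for \<open>w\<close> then has the constant defect
          \<open>- \<mu> * s\<close>, which is orthogonal to \<open>w\<close>.\<close>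
        define s where "s = (\<Sum>i<n. v i) / of_nat n"
        define w where "w i = v i - s" for i
        define d where "d i = complex_of_real (\<Sum>j<n. Y (i, j) \<omega>)" for i
        have w0: "(\<Sum>i<n. w i) = 0" using elim(2) by (simp add: w_def s_def sum_subtractf)
        have eig: "(\<mu> + of_real (m * real n)) * w i = (\<Sum>j<n. complex_of_real (Y (i, j) \<omega>) * w j) - d i * w i + (- \<mu> * s)"
          if i: "i < n" for i
        proof -
          have "\<mu> * v i = (\<Sum>j<n. complex_of_real (X i j \<omega>) * v j -
              (if i = j then of_real (\<Sum>k<n. X i k \<omega>) * v i else 0))"
            unfolding v(1)[OF i, symmetric] by (rule sum.cong) (use i in \<open>auto simp: L_mat_entry algebra_simps\<close>)
          also have "\<dots> = (\<Sum>j<n. complex_of_real (X i j \<omega>) * v j) - of_real (\<Sum>k<n. X i k \<omega>) * v i"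
            using i by (simp add: sum_subtractf)
          \<comment> \<open>The rows of \<open>L_mat\<close> sum to zero, so \<open>v\<close> may be
            replaced by \<open>w\<close>. Next, the constant part of \<open>X\<close> vanishes on
            \<open>w\<close>, and the mean contributes only \<open>- m * n\<close> on the
            diagonal.\<close>
          also have "\<dots> = (\<Sum>j<n. complex_of_real (X i j \<omega>) * w j) - of_real (\<Sum>k<n. X i k \<omega>) * w i"
            by (simp add: w_def right_diff_distrib sum_subtractf sum_distrib_right)
          also have "\<dots> = (\<Sum>j<n. complex_of_real (Y (i, j) \<omega>) * w j) + of_real m * (\<Sum>j<n. w j) - (d i + of_nat n * of_real m) * w i"
            unfolding X_Y d_def by (simp add: distrib_right sum.distrib sum_distrib_left)
          finally show ?thesis unfolding w0 by (simp add: w_def algebra_simps)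
        qed
        \<comment> \<open>If \<open>w\<close> vanished, \<open>v\<close> would be the constant
          \<open>s\<close> and the equation would reduce to \<open>\<mu> * s = 0\<close>; here
          \<open>\<mu> \<noteq> 0\<close> is essential.\<close>
        have "\<exists>k<n. w k \<noteq> 0"
        proof (rule ccontr)
          assume "\<not> (\<exists>k<n. w k \<noteq> 0)"
          then have z: "w i = 0" if "i < n" for i using that by blast
          then have "\<mu> * s = 0" using eig[of 0] elim(2) by simp
          then have "s = 0" using \<mu> by simp
          then have "v i = 0" if "i < n" for i using z[OF that] by (simp add: w_def)
          then show False using v(2) by blast
        qed
        then have "\<bar>Re (\<mu> + of_real (m * real n))\<bar> \<le> \<sigma> * sqrt (2 * real n * ln (real n)) * (1 + \<epsilon> n) \<and>
            \<bar>Im (\<mu> + of_real (m * real n))\<bar> \<le> \<sigma> * sqrt (real n) * (2 + \<epsilon> n)"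
          using elim(1)[rule_format, of "\<mu> + of_real (m * real n)" w "- \<mu> * s"] eig w0 unfolding d_def by simp
        then show "\<bar>Re \<mu> + m * real n\<bar> \<le> \<sigma> * sqrt (2 * real n * ln (real n)) * (1 + \<epsilon> n) \<and>
             \<bar>Im \<mu>\<bar> \<le> \<sigma> * sqrt (real n) * (2 + \<epsilon> n)" by simp
      qed
    qed
  qed
  show ?thesis using \<epsilon> part1 part2 by blast
qed

end
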